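(* Let $(V,\mathbb{L},\rho,*,Q)$ and $(V',\mathbb{L}',\rho',*',Q')$ be two cyclic composition algebras of rank $8$ over a field $\mathbb{F}$, where $\mathbb{L}=\mathbb{F}\times\mathbb{F}\times\mathbb{F}$, such that $\mathrm{char}\,\mathbb{F}\ne2,3$ and $\mathbb{F}$ contains a primitive cube root of unity. Suppose $V$ and $V'$ are given Type III gradings by an abelian group $G$. Let $E=\mathrm{End}_{\mathbb{L}}(V)$ and $E'=\mathrm{End}_{\mathbb{L}'}(V')$ be the corresponding trialitarian algebras with induced $G$-gradings. Then, for any isomorphism $(\varphi_1,\varphi_0)$ of graded cyclic composition algebras from either $V$ or $V^{\mathrm{op}}$ to $V'$, there exists a unique compatible isomorphism $\varphi\colon E\to E'$ of graded trialitarian algebras. Conversely, for any isomorphism $\varphi\colon E\to E'$ of graded trialitarian algebras, there exists a unique compatible isomorphism of graded cyclic composition algebras $(\varphi_1,\varphi_0)$ from either $V$ or $V^{\mathrm{op}}$ (but not both) to $V'$.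
   Context: Cyclic composition algebras. Let $\mathbb{L}$ be a Galois algebra over $\mathbb{F}$ with respect to the cyclic group of order $3$ with chosen generator $\rho$. A cyclic composition algebra over $(\mathbb{L},\rho)$ is a free $\mathbb{L}$-module $V$ with a nonsingular $\mathbb{L}$-valued quadratic form $Q$, with polar form $b_Q(x,y)=Q(x+y)-Q(x)-Q(y)$, and an $\mathbb{F}$-bilinear multiplication $*$ on $V$, $\rho$-semilinear in the first and $\rho^2$-semilinear in the second argument, such that $Q(x*y)=\rho(Q(x))\rho^2(Q(y))$ and $b_Q(x*y,z)=\rho(b_Q(y*z,x))=\rho^2(b_Q(z*x,y))$. Its rank is the $\mathbb{L}$-rank of $V$. An isomorphism $(V,\mathbb{L},\rho,*,Q)\to(V',\mathbb{L}',\rho',*',Q')$ is a pair $(\varphi_1,\varphi_0)$ where $\varphi_0\colon\mathbb{L}\to\mathbb{L}'$ is an $\mathbb{F}$-algebra isomorphism with $\varphi_0\rho=\rho'\varphi_0$ and $\varphi_1\colon V\to V'$ is a $\varphi_0$-semilinear bijection with $\varphi_1(x*y)=\varphi_1(x)*'\varphi_1(y)$ and $\varphi_0(Q(x))=Q'(\varphi_1(x))$. The opposite $V^{\mathrm{op}}$ is the same $\mathbb{L}$-module with the same $Q$ and multiplication $x*^{\mathrm{op}}y=y*x$; it is a cyclic composition algebra over $(\mathbb{L},\rho^2)$. Gradings on $V$. A $G$-grading on $(V,\mathbb{L},\rho,*,Q)$ consists of a $G$-grading on the $\mathbb{F}$-algebra $(V,* )$ and a $G$-grading on the algebra $\mathbb{L}$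 (with $\rho$ degree-preserving) such that $V$ is a graded $\mathbb{L}$-module and $b_Q$ is degree-preserving ($b_Q(V_a,V_b)\subset\mathbb{L}_{ab}$). It is of Type III if $\mathbb{L}$ has three one-dimensional homogeneous components, of degrees $e,h,h^2$ with $h$ of order $3$ (for $\mathbb{L}=\mathbb{F}^3$, $\rho(\lambda_1,\lambda_2,\lambda_3)=(\lambda_2,\lambda_3,\lambda_1)$: $\mathbb{L}=\mathbb{F}1\oplus\mathbb{F}\xi\oplus\mathbb{F}\xi^2$ with $\xi=(1,\omega,\omega^2)$, $\omega$ a primitive cube root of $1$). Isomorphisms of graded cyclic composition algebras are isomorphisms preserving degrees on both $V$ and $\mathbb{L}$. The induced grading on $\mathrm{End}_{\mathbb{L}}(V)$: $a$ has degree $g$ iff $a(V_k)\subset V_{gk}$ for all $k\in G$. Trialitarian algebras. For $V$ of rank $8$, let $E=\mathrm{End}_{\mathbb{L}}(V)$ and $\sigma$ the involution of $E$ adjoint to $b_Q$. The even Clifford algebra $\mathrm{Cl}(E,\sigma)$ is the quotient of the tensor algebra (over $\mathbb{L}$) of the $\mathbb{L}$-module $E$ by the two-sided ideal generated by the elements $[x\,b_Q(x,\cdot)]-Q(x)1$ and $[x\,b_Q(y,\cdot)]\otimes[y\,b_Q(z,\cdot)]-Q(y)[x\,b_Q(z,\cdot)]$ for $x,y,z\in V$, where $[x\,b_Q(y,\cdot)]$ is the operator $v\mapsto x\,b_Q(y,v)$ regarded as an element of degree one in the tensor algebra; this ideal depends only on $(E,\sigma)$. The algebra $\mathrm{Cl}(E,\sigma)$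 comes with a canonical $\mathbb{L}$-linear map $\kappa\colon E\to\mathrm{Cl}(E,\sigma)$ (induced by the inclusion of $E$ in its tensor algebra) with generating image, and is functorial for isomorphisms of algebras with involution (an isomorphism $\varphi\colon(E,\sigma)\to(E',\sigma')$ induces the isomorphism $\mathrm{Cl}(\varphi)$ sending $\kappa(a)$ to $\kappa'(\varphi(a))$, where $\kappa'$ is the canonical map for $(E',\sigma')$); it is identified with the even Clifford algebra $\mathrm{Cl}_0(V,Q)$ so that $\kappa(x\,b_Q(y,\cdot))$ corresponds to the Clifford product $x\cdot y$. With $l_x(y)=x*y=r_y(x)$, the $\mathbb{L}$-algebra isomorphism $\alpha\colon\mathrm{Cl}(E,\sigma)\to{}^{\rho}E\times{}^{\rho^2}E$ is determined by $\kappa(x\,b_Q(y,\cdot))\mapsto(l_xr_y,r_xl_y)$, where ${}^{\rho}E$ is $E$ with $\mathbb{L}$-module structure $\ell\cdot a=\rho(\ell)a$ (similarly ${}^{\rho^2}E$). The trialitarian algebra of $V$ is $(E,\mathbb{L},\rho,\sigma,\alpha)$. An isomorphism of trialitarian algebras $(E,\mathbb{L},\rho,\sigma,\alpha)\to(E',\mathbb{L}',\rho',\sigma',\alpha')$ is an isomorphism $\varphi\colon(E,\sigma)\to(E',\sigma')$ of $\mathbb{F}$-algebras with involution such that $\alpha'\circ\mathrm{Cl}(\varphi)=(\varphi\otimes\Delta(\varphi))\circ\alpha$, where ${}^\rho E\times{}^{\rho^2}E=E\otimes(\mathbb{F}\times\mathbb{F})$ as $\mathbb{F}$-algebras and $\Delta(\varphi)$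 is the identity of $\mathbb{F}\times\mathbb{F}$ if $\varphi|_{\mathbb{L}}$ conjugates $\rho$ to $\rho'$ and the flip if it conjugates $\rho$ to $\rho'^{-1}$. Isomorphisms of graded trialitarian algebras are those preserving degree. Compatibility. $(\varphi_1,\varphi_0)$ and an algebra isomorphism $\varphi\colon\mathrm{End}_{\mathbb{L}}(V)\to\mathrm{End}_{\mathbb{L}'}(V')$ are compatible if $\varphi_1(ax)=\varphi(a)\varphi_1(x)$ for all $a\in\mathrm{End}_{\mathbb{L}}(V)$, $x\in V$ (note that $V$ and $V^{\mathrm{op}}$ have the same underlying $\mathbb{L}$-module). *)

theory Defs
  imports
    "HOL-Analysis.Finite_Cartesian_Product"
    "HOL-Library.FuncSet"
    "HOL-Library.Poly_Mapping"
    "HOL-Algebra.Chinese_Remainder"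
begin

section \<open>Cyclic composition algebras\<close>

text \<open>
  The field \<open>F\<close>, the commutative ring \<open>L\<close> and the \<open>L\<close>-module \<open>V\<close> are types; the \<open>F\<close>-algebra
  structure of \<open>L\<close> is given by its structure map, and \<open>V\<close> is an \<open>F\<close>-space through it.
\<close>

record ('f, 'l, 'v) cyc =
  incl :: "'f \<Rightarrow> 'l"
  rot :: "'l \<Rightarrow> 'l"
  scl :: "'l \<Rightarrow> 'v \<Rightarrow> 'v"
  prd :: "'v \<Rightarrow> 'v \<Rightarrow> 'v"
  qf :: "'v \<Rightarrow> 'l"

definition is_ring_hom :: "('a::ring_1 \<Rightarrow> 'b::ring_1) \<Rightarrow> bool" where
  "is_ring_hom f \<longleftrightarrow>
    (\<forall>x y. f (x + y) = f x + f y) \<and> (\<forall>x y. f (x * y) = f x * f y) \<and> f 1 = 1"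

text \<open>
  Galois algebras with group \<open>\<langle>\<rho>\<rangle>\<close> of order 3, in the sense of Chase, Harrison and Rosenberg:
  the fixed ring is \<open>F\<close>, and there are \<open>x\<^sub>i, y\<^sub>i\<close> with \<open>\<Sum>\<^sub>i x\<^sub>i \<tau>(y\<^sub>i)\<close> equal to 1 for \<open>\<tau> = id\<close>
  and to 0 for \<open>\<tau> = \<rho>, \<rho>\<^sup>2\<close>.  Over a field this says that \<open>L\<close> is etale of dimension 3
  with fixed ring \<open>F\<close>.
\<close>

definition cyclic_cubic_galois ::
    "('f::field \<Rightarrow> 'l::comm_ring_1) \<Rightarrow> ('l \<Rightarrow> 'l) \<Rightarrow> bool" where
  "cyclic_cubic_galois \<iota> \<rho> \<longleftrightarrow>
    is_ring_hom \<iota> \<and> is_ring_hom \<rho> \<and>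
    (\<forall>x. \<rho> (\<rho> (\<rho> x)) = x) \<and>
    {x. \<rho> x = x} = range \<iota> \<and>
    (\<exists>(n::nat) x y. (\<Sum>i<n. x i * y i) = 1 \<and>
       (\<Sum>i<n. x i * \<rho> (y i)) = 0 \<and> (\<Sum>i<n. x i * \<rho> (\<rho> (y i))) = 0)"

definition module_basis :: "('l::comm_ring_1 \<Rightarrow> 'v::ab_group_add \<Rightarrow> 'v) \<Rightarrow> 'v set \<Rightarrow> bool" where
  "module_basis s B \<longleftrightarrow> \<not> module.dependent s B \<and> module.span s B = UNIV"

definition polar :: "('f, 'l::comm_ring_1, 'v::ab_group_add) cyc \<Rightarrow> 'v \<Rightarrow> 'v \<Rightarrow> 'l" where
  "polar V x y = qf V (x + y) - qf V x - qf V y"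

definition quadratic_form :: "('f, 'l::comm_ring_1, 'v::ab_group_add) cyc \<Rightarrow> bool" where
  "quadratic_form V \<longleftrightarrow>
    (\<forall>l x. qf V (scl V l x) = l\<^sup>2 * qf V x) \<and> (\<forall>x. module_hom (scl V) (*) (polar V x))"

text \<open>Nonsingular means that the polar form induces a bijection from \<open>V\<close> onto its dual.\<close>

definition nonsingular :: "('f, 'l::comm_ring_1, 'v::ab_group_add) cyc \<Rightarrow> bool" where
  "nonsingular V \<longleftrightarrow> (\<forall>f. module_hom (scl V) (*) f \<longrightarrow> (\<exists>!x. f = polar V x))"

text \<open>\<open>F\<close>-homogeneity of the product follows from the semilinearity, as \<open>\<rho>\<close> fixes \<open>F\<close>.\<close>

definition cyclic_composition_algebra ::
    "('f::field, 'l::comm_ring_1, 'v::ab_group_add) cyc \<Rightarrow> bool" where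
  "cyclic_composition_algebra V \<longleftrightarrow>
    cyclic_cubic_galois (incl V) (rot V) \<and>
    Modules.module (scl V) \<and> (\<exists>B. module_basis (scl V) B) \<and>
    quadratic_form V \<and> nonsingular V \<and>
    (\<forall>x y z. prd V (x + y) z = prd V x z + prd V y z) \<and>
    (\<forall>x y z. prd V x (y + z) = prd V x y + prd V x z) \<and>
    (\<forall>l x y. prd V (scl V l x) y = scl V (rot V l) (prd V x y)) \<and>
    (\<forall>l x y. prd V x (scl V l y) = scl V (rot V (rot V l)) (prd V x y)) \<and>
    (\<forall>x y. qf V (prd V x y) = rot V (qf V x) * rot V (rot V (qf V y))) \<and>
    (\<forall>x y z. polar V (prd V x y) z = rot V (polar V (prd V y z) x)) \<and>
    (\<forall>x y z. polar V (prd V x y) z = rot V (rot V (polar V (prd V z x) y)))"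

definition has_rank :: "('f, 'l::comm_ring_1, 'v::ab_group_add) cyc \<Rightarrow> nat \<Rightarrow> bool" where
  "has_rank V n \<longleftrightarrow> (\<exists>B. finite B \<and> card B = n \<and> module_basis (scl V) B)"

definition opposite :: "('f, 'l, 'v) cyc \<Rightarrow> ('f, 'l, 'v) cyc" where
  "opposite V = V\<lparr>rot := rot V \<circ> rot V, prd := (\<lambda>x y. prd V y x)\<rparr>"

definition cyc_iso ::
    "('f, 'l::comm_ring_1, 'v::ab_group_add) cyc \<Rightarrow> ('f, 'm::comm_ring_1, 'w::ab_group_add) cyc \<Rightarrow>
      ('v \<Rightarrow> 'w) \<Rightarrow> ('l \<Rightarrow> 'm) \<Rightarrow> bool" where
  "cyc_iso V V' \<phi>1 \<phi>0 \<longleftrightarrow>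
    bij \<phi>0 \<and> is_ring_hom \<phi>0 \<and> (\<forall>c. \<phi>0 (incl V c) = incl V' c) \<and>
    (\<forall>l. \<phi>0 (rot V l) = rot V' (\<phi>0 l)) \<and>
    bij \<phi>1 \<and> (\<forall>x y. \<phi>1 (x + y) = \<phi>1 x + \<phi>1 y) \<and>
    (\<forall>l x. \<phi>1 (scl V l x) = scl V' (\<phi>0 l) (\<phi>1 x)) \<and>
    (\<forall>x y. \<phi>1 (prd V x y) = prd V' (\<phi>1 x) (\<phi>1 y)) \<and>
    (\<forall>x. \<phi>0 (qf V x) = qf V' (\<phi>1 x))"


section \<open>Gradings\<close>

text \<open>The abelian grading group is written additively.\<close>

definition vs_grading ::
    "('f::field \<Rightarrow> 'a::ab_group_add \<Rightarrow> 'a) \<Rightarrow> ('g::ab_group_add \<Rightarrow> 'a set) \<Rightarrow> bool" where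
  "vs_grading s \<Gamma> \<longleftrightarrow>
    (\<forall>g. module.subspace s (\<Gamma> g)) \<and>
    (\<forall>x. \<exists>!c. finite {g. c g \<noteq> 0} \<and> (\<forall>g. c g \<in> \<Gamma> g) \<and> x = (\<Sum>g | c g \<noteq> 0. c g))"

definition cyc_grading ::
    "('f::field, 'l::comm_ring_1, 'v::ab_group_add) cyc \<Rightarrow>
      ('g::ab_group_add \<Rightarrow> 'v set) \<Rightarrow> ('g \<Rightarrow> 'l set) \<Rightarrow> bool" where
  "cyc_grading V \<Gamma>V \<Gamma>L \<longleftrightarrow>
    vs_grading (\<lambda>c. scl V (incl V c)) \<Gamma>V \<and>
    (\<forall>a b. \<forall>x\<in>\<Gamma>V a. \<forall>y\<in>\<Gamma>V b. prd V x y \<in> \<Gamma>V (a + b)) \<and>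
    vs_grading (\<lambda>c l. incl V c * l) \<Gamma>L \<and>
    (\<forall>a b. \<forall>l\<in>\<Gamma>L a. \<forall>m\<in>\<Gamma>L b. l * m \<in> \<Gamma>L (a + b)) \<and>
    (\<forall>a. \<forall>l\<in>\<Gamma>L a. rot V l \<in> \<Gamma>L a) \<and>
    (\<forall>a b. \<forall>l\<in>\<Gamma>L a. \<forall>x\<in>\<Gamma>V b. scl V l x \<in> \<Gamma>V (a + b)) \<and>
    (\<forall>a b. \<forall>x\<in>\<Gamma>V a. \<forall>y\<in>\<Gamma>V b. polar V x y \<in> \<Gamma>L (a + b))"

definition type_III ::
    "('f::field, 'l::comm_ring_1, 'v::ab_group_add) cyc \<Rightarrow>
      ('g::ab_group_add \<Rightarrow> 'v set) \<Rightarrow> ('g \<Rightarrow> 'l set) \<Rightarrow> bool" where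
  "type_III V \<Gamma>V \<Gamma>L \<longleftrightarrow>
    cyc_grading V \<Gamma>V \<Gamma>L \<and>
    (\<exists>h. h \<noteq> 0 \<and> h + h + h = 0 \<and>
      (\<forall>g\<in>{0, h, h + h}. \<exists>u. u \<noteq> 0 \<and> \<Gamma>L g = range (\<lambda>c. incl V c * u)) \<and>
      (\<forall>g. g \<notin> {0, h, h + h} \<longrightarrow> \<Gamma>L g = {0}))"

definition graded_cyc_iso where
  "graded_cyc_iso V \<Gamma>V \<Gamma>L V' \<Gamma>V' \<Gamma>L' \<phi>1 \<phi>0 \<longleftrightarrow>
    cyc_iso V V' \<phi>1 \<phi>0 \<and> (\<forall>g. \<phi>1 ` \<Gamma>V g = \<Gamma>V' g) \<and> (\<forall>g. \<phi>0 ` \<Gamma>L g = \<Gamma>L' g)"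


section \<open>The algebra of endomorphisms and its involution\<close>

definition End :: "('f, 'l::comm_ring_1, 'v::ab_group_add) cyc \<Rightarrow> ('v \<Rightarrow> 'v) set" where
  "End V = {a. module_hom (scl V) (scl V) a}"

definition End_ring :: "('f, 'l::comm_ring_1, 'v::ab_group_add) cyc \<Rightarrow> ('v \<Rightarrow> 'v) ring" where
  "End_ring V =
    \<lparr>carrier = End V, mult = (\<circ>), one = id, zero = (\<lambda>v. 0), add = (\<lambda>a b v. a v + b v)\<rparr>"

definition End_scale :: "('f, 'l, 'v) cyc \<Rightarrow> 'l \<Rightarrow> ('v \<Rightarrow> 'v) \<Rightarrow> 'v \<Rightarrow> 'v" where
  "End_scale V l a = (\<lambda>v. scl V l (a v))"

definition sigma ::
    "('f, 'l::comm_ring_1, 'v::ab_group_add) cyc \<Rightarrow> ('v \<Rightarrow> 'v) \<Rightarrow> 'v \<Rightarrow> 'v" where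
  "sigma V a = (THE a'. a' \<in> End V \<and> (\<forall>x y. polar V (a x) y = polar V x (a' y)))"

definition rank_one ::
    "('f, 'l::comm_ring_1, 'v::ab_group_add) cyc \<Rightarrow> 'v \<Rightarrow> 'v \<Rightarrow> 'v \<Rightarrow> 'v" where
  "rank_one V x y = (\<lambda>v. scl V (polar V y v) x)"

definition End_grading ::
    "('f, 'l::comm_ring_1, 'v::ab_group_add) cyc \<Rightarrow> ('g::ab_group_add \<Rightarrow> 'v set) \<Rightarrow>
      'g \<Rightarrow> ('v \<Rightarrow> 'v) set" where
  "End_grading V \<Gamma>V g = {a \<in> End V. \<forall>k. a ` \<Gamma>V k \<subseteq> \<Gamma>V (g + k)}"


section \<open>Tensor algebras\<close>

datatype 'a free_monoid = FM (letters: "'a list")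

instantiation free_monoid :: (type) monoid_add
begin

definition "0 = FM []"

definition "v + w = FM (letters v @ letters w)"

instance
  by standard (auto simp: zero_free_monoid_def plus_free_monoid_def)

end

text \<open>Noncommutative polynomials over \<open>L\<close> in variables from \<open>A\<close>; the product on
  \<^typ>\<open>'a free_monoid \<Rightarrow>\<^sub>0 'l\<close> is the convolution product of the library.\<close>

definition free_algebra :: "'a set \<Rightarrow> ('a free_monoid \<Rightarrow>\<^sub>0 'l::comm_ring_1) ring" where
  "free_algebra A =
    \<lparr>carrier = {p. \<forall>w\<in>Poly_Mapping.keys p. set (letters w) \<subseteq> A},
     mult = (*), one = 1, zero = 0, add = (+)\<rparr>"

definition free_var :: "'a \<Rightarrow> 'a free_monoid \<Rightarrow>\<^sub>0 'l::comm_ring_1" where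
  "free_var a = Poly_Mapping.single (FM [a]) 1"

definition free_const :: "'l::comm_ring_1 \<Rightarrow> 'a free_monoid \<Rightarrow>\<^sub>0 'l" where
  "free_const l = Poly_Mapping.single 0 l"

text \<open>The tensor algebra over \<open>L\<close> of the \<open>L\<close>-module with carrier \<open>M\<close>, addition \<open>pl\<close> and scalar
  multiplication \<open>sc\<close>: the free algebra on the set \<open>M\<close> modulo the linear relations.\<close>

definition tensor_ideal ::
    "'a set \<Rightarrow> ('a \<Rightarrow> 'a \<Rightarrow> 'a) \<Rightarrow> ('l::comm_ring_1 \<Rightarrow> 'a \<Rightarrow> 'a) \<Rightarrow>
      ('a free_monoid \<Rightarrow>\<^sub>0 'l) set" where
  "tensor_ideal M pl sc = genideal (free_algebra M)
    ({free_var (pl a b) - (free_var a + free_var b) | a b. a \<in> M \<and> b \<in> M} \<union>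
     {free_var (sc l a) - free_const l * free_var a | l a. a \<in> M})"

definition tensor_algebra ::
    "'a set \<Rightarrow> ('a \<Rightarrow> 'a \<Rightarrow> 'a) \<Rightarrow> ('l::comm_ring_1 \<Rightarrow> 'a \<Rightarrow> 'a) \<Rightarrow>
      ('a free_monoid \<Rightarrow>\<^sub>0 'l) set ring" where
  "tensor_algebra M pl sc = free_algebra M Quot tensor_ideal M pl sc"

abbreviation End_tensor ::
    "('f, 'l::comm_ring_1, 'v::ab_group_add) cyc \<Rightarrow>
      (('v \<Rightarrow> 'v) free_monoid \<Rightarrow>\<^sub>0 'l) set ring" where
  "End_tensor V \<equiv> tensor_algebra (End V) (add (End_ring V)) (End_scale V)"

definition End_tensor_class ::
    "('f, 'l::comm_ring_1, 'v::ab_group_add) cyc \<Rightarrow>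
      (('v \<Rightarrow> 'v) free_monoid \<Rightarrow>\<^sub>0 'l) \<Rightarrow> (('v \<Rightarrow> 'v) free_monoid \<Rightarrow>\<^sub>0 'l) set" where
  "End_tensor_class V p =
    tensor_ideal (End V) (add (End_ring V)) (End_scale V) +>\<^bsub>free_algebra (End V)\<^esub> p"

definition tgen where
  "tgen V a = End_tensor_class V (free_var a)"

definition tconst where
  "tconst V l = End_tensor_class V (free_const l)"


section \<open>The even Clifford algebra and trialitarian algebras\<close>

definition Cl_ideal ::
    "('f, 'l::comm_ring_1, 'v::ab_group_add) cyc \<Rightarrow>
      (('v \<Rightarrow> 'v) free_monoid \<Rightarrow>\<^sub>0 'l) set set" where
  "Cl_ideal V = genideal (End_tensor V)
    ({tgen V (rank_one V x x) \<ominus>\<^bsub>End_tensor V\<^esub> tconst V (qf V x) | x. True} \<union>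
     {tgen V (rank_one V x y) \<otimes>\<^bsub>End_tensor V\<^esub> tgen V (rank_one V y z)
        \<ominus>\<^bsub>End_tensor V\<^esub> tconst V (qf V y) \<otimes>\<^bsub>End_tensor V\<^esub> tgen V (rank_one V x z) | x y z. True})"

definition Cl ::
    "('f, 'l::comm_ring_1, 'v::ab_group_add) cyc \<Rightarrow>
      (('v \<Rightarrow> 'v) free_monoid \<Rightarrow>\<^sub>0 'l) set set ring" where
  "Cl V = End_tensor V Quot Cl_ideal V"

definition kappa where
  "kappa V a = Cl_ideal V +>\<^bsub>End_tensor V\<^esub> tgen V a"

definition cl_const where
  "cl_const V l = Cl_ideal V +>\<^bsub>End_tensor V\<^esub> tconst V l"

text \<open>
  The homomorphism from \<open>Cl(E, \<sigma>)\<close> to the product of the twists of \<open>E\<close> by \<open>\<rho>\<close> and \<open>\<rho>\<^sup>2\<close>; the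
  first condition on \<open>h\<close> says that it respects the structure maps from \<open>L\<close>, where \<open>l\<close> acts on the
  factors as \<open>\<rho> l\<close> and \<open>\<rho>\<^sup>2 l\<close>.  As the rank one operators span \<open>E\<close> and the image of \<open>\<kappa>\<close>
  generates, at most one \<open>h\<close> exists; it is bijective in rank 8, so \<open>alpha\<close> is the isomorphism
  determined by these values.
\<close>

definition alpha ::
    "('f, 'l::comm_ring_1, 'v::ab_group_add) cyc \<Rightarrow>
      (('v \<Rightarrow> 'v) free_monoid \<Rightarrow>\<^sub>0 'l) set set \<Rightarrow> ('v \<Rightarrow> 'v) \<times> ('v \<Rightarrow> 'v)" where
  "alpha V = (THE h.
    h \<in> extensional (carrier (Cl V)) \<and>
    h \<in> ring_hom (Cl V) (RDirProd (End_ring V) (End_ring V)) \<and>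
    (\<forall>l. h (cl_const V l) = (End_scale V (rot V l) id, End_scale V (rot V (rot V l)) id)) \<and>
    (\<forall>x y. h (kappa V (rank_one V x y)) = (\<lambda>v. prd V x (prd V v y), \<lambda>v. prd V (prd V y v) x)))"

text \<open>Isomorphisms of \<open>F\<close>-algebras with involution.  They are taken to be undefined outside of
  \<open>End V\<close>, so that equality of such maps is equality on \<open>End V\<close>.\<close>

definition involution_iso ::
    "('f, 'l::comm_ring_1, 'v::ab_group_add) cyc \<Rightarrow> ('f, 'm::comm_ring_1, 'w::ab_group_add) cyc \<Rightarrow>
      (('v \<Rightarrow> 'v) \<Rightarrow> 'w \<Rightarrow> 'w) \<Rightarrow> bool" where
  "involution_iso V V' \<phi> \<longleftrightarrow>
    \<phi> \<in> extensional (End V) \<and> \<phi> \<in> ring_iso (End_ring V) (End_ring V') \<and>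
    (\<forall>c. \<forall>a\<in>End V. \<phi> (End_scale V (incl V c) a) = End_scale V' (incl V' c) (\<phi> a)) \<and>
    (\<forall>a\<in>End V. \<phi> (sigma V a) = sigma V' (\<phi> a))"

text \<open>The restriction of \<open>\<phi>\<close> to the centre, which consists of the homotheties.\<close>

definition centre_map ::
    "('f, 'l::comm_ring_1, 'v::ab_group_add) cyc \<Rightarrow> ('f, 'm::comm_ring_1, 'w::ab_group_add) cyc \<Rightarrow>
      (('v \<Rightarrow> 'v) \<Rightarrow> 'w \<Rightarrow> 'w) \<Rightarrow> 'l \<Rightarrow> 'm" where
  "centre_map V V' \<phi> l = (THE m. \<phi> (End_scale V l id) = End_scale V' m id)"

definition Cl_map where
  "Cl_map V V' \<phi> = (THE h.
    h \<in> extensional (carrier (Cl V)) \<and> h \<in> ring_hom (Cl V) (Cl V') \<and>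
    (\<forall>l. h (cl_const V l) = cl_const V' (centre_map V V' \<phi> l)) \<and>
    (\<forall>a\<in>End V. h (kappa V a) = kappa V' (\<phi> a)))"

text \<open>The two disjuncts are the cases where \<open>\<Delta>(\<phi>)\<close> is the identity and the flip;
  \<open>\<rho>'\<^sup>-\<^sup>1\<close> is written as the square of \<open>\<rho>'\<close>.\<close>

definition trialitarian_iso ::
    "('f, 'l::comm_ring_1, 'v::ab_group_add) cyc \<Rightarrow> ('f, 'm::comm_ring_1, 'w::ab_group_add) cyc \<Rightarrow>
      (('v \<Rightarrow> 'v) \<Rightarrow> 'w \<Rightarrow> 'w) \<Rightarrow> bool" where
  "trialitarian_iso V V' \<phi> \<longleftrightarrow>
    involution_iso V V' \<phi> \<and>
    ((\<forall>l. centre_map V V' \<phi> (rot V l) = rot V' (centre_map V V' \<phi> l)) \<and>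
       (\<forall>c\<in>carrier (Cl V). alpha V' (Cl_map V V' \<phi> c) = map_prod \<phi> \<phi> (alpha V c)) \<or>
     (\<forall>l. centre_map V V' \<phi> (rot V l) = rot V' (rot V' (centre_map V V' \<phi> l))) \<and>
       (\<forall>c\<in>carrier (Cl V). alpha V' (Cl_map V V' \<phi> c) = map_prod \<phi> \<phi> (prod.swap (alpha V c))))"

definition graded_trialitarian_iso where
  "graded_trialitarian_iso V \<Gamma>V V' \<Gamma>V' \<phi> \<longleftrightarrow>
    trialitarian_iso V V' \<phi> \<and> (\<forall>g. \<phi> ` End_grading V \<Gamma>V g = End_grading V' \<Gamma>V' g)"

definition compatible ::
    "('f, 'l::comm_ring_1, 'v::ab_group_add) cyc \<Rightarrow> ('v \<Rightarrow> 'w) \<Rightarrow>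
      (('v \<Rightarrow> 'v) \<Rightarrow> 'w \<Rightarrow> 'w) \<Rightarrow> bool" where
  "compatible V \<phi>1 \<phi> \<longleftrightarrow> (\<forall>a\<in>End V. \<forall>x. \<phi>1 (a x) = \<phi> a (\<phi>1 x))"

end

theory Submission
  imports Defs
begin

text \<open>
  An isomorphism \<open>(\<phi>1, \<phi>0)\<close> of cyclic composition algebras acts on \<open>E\<close> by conjugation, and this
  respects \<open>\<alpha>\<close> because \<open>\<alpha>\<close> is given by products.  Passing from \<open>V\<close> to its opposite only swaps
  the two components of \<open>\<alpha>\<close>.

  Conversely, an isomorphism \<open>\<phi>\<close> of graded algebras with involution is conjugation by a semilinear
  similitude \<open>\<phi>1\<close> which is homogeneous of some degree \<open>d\<close>.  Write \<open>\<odot>\<close> for the product of \<open>V'\<close>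
  pulled back along \<open>\<phi>1\<close> and \<open>\<mu>\<close> for the multiplier.  Compatibility with \<open>\<alpha>\<close> says that
  \<open>x \<odot> (v \<odot> y) = \<rho>(\<mu>) x \<star> (v \<star> y)\<close> and \<open>(y \<odot> v) \<odot> x = \<rho>\<^sup>2(\<mu>) (y \<star> v) \<star> x\<close>.  In rank 8 this forces
  \<open>x \<odot> y = \<nu> (x \<star> y)\<close> for a scalar \<open>\<nu>\<close> with \<open>\<mu> = \<rho>(\<nu>) \<rho>\<^sup>2(\<nu>)\<close>.  Rescaling \<open>\<phi>1\<close> to an isomorphism
  needs a square root of \<open>\<nu> / N(\<nu>)\<close>; this is where the grading enters: \<open>\<nu>\<close> is homogeneous (of
  degree \<open>d\<close>), in a Type III grading this gives \<open>N(\<nu>) = \<nu>\<^sup>3\<close>, and \<open>\<nu>\<^sup>-\<^sup>1 \<phi>1\<close> is the required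
  isomorphism.
\<close>

section \<open>Quotient rings and free algebras\<close>

text \<open>Two obstacles shape the proof. \<open>alpha\<close> and \<open>Cl_map\<close> are
  definite descriptions on a quotient of a quotient of a free algebra. Each must be shown to exist,
  by the universal property of \<open>Cl V\<close>, and to be unique, because \<open>kappa\<close>
  generates and the rank one operators span \<open>E\<close>. Afterwards only their values on
  constants and on rank one operators matter. Scalars in \<open>'l\<close> need not be invertible
  when they are nonzero. A Type III grading makes the scalar ring a graded field: nonzero
  homogeneous elements are units. This gives homogeneous vectors \<open>x\<close>, \<open>y\<close>
  with \<open>\<beta> x y = 1\<close>, hence a homogeneous rank one idempotent, and the inverse of
  \<nu>. On the final rescaling: replacing \<phi>1 by \<phi>1 after a unit scalar t changes \<nu>
  into \<nu> \<rho>(t) \<rho>(\<rho>(t)) / t. Setting this equal to 1 and taking norms gives N(t)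
  N(\<nu>) = 1, hence t squared equals \<nu> / N(\<nu>); if N(\<nu>) is the cube of \<nu>, the
  inverse of \<nu> is a solution. That V and its opposite cannot both occur is seen on the centre:
  \<phi> determines \<phi>0, which cannot intertwine both \<rho> and its square with the rotation of
  V'.\<close>

text \<open>The induced map evaluates \<open>h\<close> at a chosen representative; two
  representatives of a coset differ by an element of \<open>I\<close>, which \<open>h\<close> kills,
  so the choice is immaterial.\<close>

lemma ring_hom_factor_Quot:
  assumes R: "ring R" and S: "ring S" and I: "ideal I R"
    and h: "h \<in> ring_hom R S" and kills: "\<And>x. x \<in> I \<Longrightarrow> h x = \<zero>\<^bsub>S\<^esub>"
  obtains g where "g \<in> ring_hom (R Quot I) S" "\<And>x. x \<in> carrier R \<Longrightarrow> g (I +>\<^bsub>R\<^esub> x) = h x"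
proof -
  interpret R: ring R by fact
  interpret S: ring S by fact
  interpret I: ideal I R by fact
  define g where "g X = h (SOME x. x \<in> carrier R \<and> X = I +>\<^bsub>R\<^esub> x)" for X
  have g: "g (I +>\<^bsub>R\<^esub> x) = h x" if x: "x \<in> carrier R" for x
  proof -
    define x' where "x' = (SOME x'. x' \<in> carrier R \<and> I +>\<^bsub>R\<^esub> x = I +>\<^bsub>R\<^esub> x')"
    have x': "x' \<in> carrier R \<and> I +>\<^bsub>R\<^esub> x = I +>\<^bsub>R\<^esub> x'"
      unfolding x'_def by (rule someI[of _ x]) (use x in simp)
    have "x \<in> I +>\<^bsub>R\<^esub> x'" using x' I.a_rcos_self[OF x] by simp
    then obtain i where i: "i \<in> I" "x = i \<oplus>\<^bsub>R\<^esub> x'"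
      by (auto simp: a_r_coset_def')
    then have "h x = h i \<oplus>\<^bsub>S\<^esub> h x'"
      using ring_hom_add[OF h] x' by (simp add: I.a_Hcarr)
    also have "\<dots> = h x'" using kills i ring_hom_closed[OF h] x' by simp
    finally show ?thesis unfolding g_def x'_def by simp
  qed
  have car: "carrier (R Quot I) = (\<lambda>x. I +>\<^bsub>R\<^esub> x) ` carrier R"
    by (auto simp: FactRing_simps)
  have "g \<in> ring_hom (R Quot I) S"
  proof (rule ring_hom_memI)
    fix X assume "X \<in> carrier (R Quot I)"
    then show "g X \<in> carrier S" using g ring_hom_closed[OF h] by (auto simp: car)
  next
    fix X Y assume "X \<in> carrier (R Quot I)" "Y \<in> carrier (R Quot I)"
    then obtain x y where xy: "x \<in> carrier R" "y \<in> carrier R" "X = I +>\<^bsub>R\<^esub> x" "Y = I +>\<^bsub>R\<^esub> y"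
      by (auto simp: car)
    then show "g (X \<otimes>\<^bsub>R Quot I\<^esub> Y) = g X \<otimes>\<^bsub>S\<^esub> g Y"
      using ring_hom_mult[OF I.rcos_ring_hom, of x y] g ring_hom_mult[OF h, of x y]
      by (metis R.m_closed)
    show "g (X \<oplus>\<^bsub>R Quot I\<^esub> Y) = g X \<oplus>\<^bsub>S\<^esub> g Y"
      using ring_hom_add[OF I.rcos_ring_hom, of x y] g ring_hom_add[OF h, of x y] xy
      by (metis R.a_closed)
  next
    show "g \<one>\<^bsub>R Quot I\<^esub> = \<one>\<^bsub>S\<^esub>"
      using ring_hom_one[OF I.rcos_ring_hom] g[of "\<one>\<^bsub>R\<^esub>"] ring_hom_one[OF h] by simp
  qed
  then show ?thesis using g that by blast
qed

lemma genideal_kernel: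
  assumes R: "ring R" and S: "ring S" and h: "h \<in> ring_hom R S"
    and X: "X \<subseteq> carrier R" "\<And>x. x \<in> X \<Longrightarrow> h x = \<zero>\<^bsub>S\<^esub>" and x: "x \<in> Idl\<^bsub>R\<^esub> X"
  shows "h x = \<zero>\<^bsub>S\<^esub>"
proof -
  interpret ring_hom_ring R S h by (intro ring_hom_ringI2) fact+
  have "X \<subseteq> a_kernel R S h" unfolding a_kernel_def' using X by blast
  then have "Idl\<^bsub>R\<^esub> X \<subseteq> a_kernel R S h" by (rule R.genideal_minimal[OF kernel_is_ideal])
  then show ?thesis using x unfolding a_kernel_def' by blast
qed

lemma poly_mapping_sum_single:
  fixes p :: "'k \<Rightarrow>\<^sub>0 'c::comm_monoid_add"
  shows "p = (\<Sum>w\<in>Poly_Mapping.keys p. Poly_Mapping.single w (Poly_Mapping.lookup p w))"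
proof (rule poly_mapping_eqI)
  fix k
  have "(\<Sum>w\<in>Poly_Mapping.keys p. Poly_Mapping.lookup (Poly_Mapping.single w (Poly_Mapping.lookup p w)) k)
      = (\<Sum>w\<in>Poly_Mapping.keys p. if w = k then Poly_Mapping.lookup p k else 0)"
    by (rule sum.cong) (auto simp: lookup_single)
  then show "Poly_Mapping.lookup p k = Poly_Mapping.lookup
      (\<Sum>w\<in>Poly_Mapping.keys p. Poly_Mapping.single w (Poly_Mapping.lookup p w)) k"
    by (simp add: lookup_sum in_keys_iff)
qed

text \<open>The set \<open>K\<close> of admissible keys keeps the induction inside the carrier of
  \<open>free_algebra A\<close>, where only words with letters in \<open>A\<close> may
  occur.\<close>

lemma poly_mapping_single_induct:
  fixes p :: "'k \<Rightarrow>\<^sub>0 'c::comm_monoid_add"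
  assumes "P 0" "\<And>k v p. k \<in> K \<Longrightarrow> P p \<Longrightarrow> P (Poly_Mapping.single k v + p)"
    and "Poly_Mapping.keys p \<subseteq> K"
  shows "P p"
proof -
  have "P (\<Sum>w\<in>A. Poly_Mapping.single w (Poly_Mapping.lookup p w))"
    if "finite A" "A \<subseteq> K" for A
    using that by (induction A) (simp_all add: assms)
  from this[OF finite_keys assms(3)] show ?thesis
    by (simp flip: poly_mapping_sum_single)
qed

section \<open>Free algebras: ring structure and evaluation homomorphisms\<close>

lemma free_algebra_simps [simp]:
  "mult (free_algebra A) = (*)" "one (free_algebra A) = 1" "zero (free_algebra A) = 0"
  "add (free_algebra A) = (+)"
  by (simp_all add: free_algebra_def)

lemma carrier_free_algebra:
  "p \<in> carrier (free_algebra A) \<longleftrightarrow> (\<forall>w\<in>Poly_Mapping.keys p. set (letters w) \<subseteq> A)"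
  by (simp add: free_algebra_def)

lemma letters_plus [simp]: "letters (v + w) = letters v @ letters w"
  by (simp add: plus_free_monoid_def)

lemma letters_zero [simp]: "letters 0 = []"
  by (simp add: zero_free_monoid_def)

lemma ring_free_algebra: "ring (free_algebra A :: ('a free_monoid \<Rightarrow>\<^sub>0 'l::comm_ring_1) ring)"
proof (rule ringI)
  let ?F = "free_algebra A :: ('a free_monoid \<Rightarrow>\<^sub>0 'l::comm_ring_1) ring"
  show "abelian_group ?F"
  proof (rule abelian_groupI)
    fix x y assume "x \<in> carrier ?F" "y \<in> carrier ?F"
    then show "x \<oplus>\<^bsub>?F\<^esub> y \<in> carrier ?F"
      using keys_add[of x y] by (auto simp: carrier_free_algebra)
  next
    fix x assume "x \<in> carrier ?F"
    then have "- x \<in> carrier ?F"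
      by (auto simp: carrier_free_algebra in_keys_iff)
    then show "\<exists>y\<in>carrier ?F. y \<oplus>\<^bsub>?F\<^esub> x = \<zero>\<^bsub>?F\<^esub>" by (intro bexI[of _ "- x"]) auto
  qed (auto simp: carrier_free_algebra algebra_simps)
  show "Group.monoid ?F"
  proof (rule monoidI)
    fix x y assume xy: "x \<in> carrier ?F" "y \<in> carrier ?F"
    have "set (letters w) \<subseteq> A" if w: "w \<in> Poly_Mapping.keys (x * y)" for w
    proof -
      obtain u v where "w = u + v" "u \<in> Poly_Mapping.keys x" "v \<in> Poly_Mapping.keys y"
        using keys_mult[of x y] w by blast
      then show ?thesis using xy by (auto simp: carrier_free_algebra)
    qed
    then show "x \<otimes>\<^bsub>?F\<^esub> y \<in> carrier ?F" by (auto simp: carrier_free_algebra)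
  qed (auto simp: carrier_free_algebra algebra_simps)
qed (auto simp: algebra_simps)

lemma free_var_closed: "a \<in> A \<Longrightarrow> free_var a \<in> carrier (free_algebra A)"
  by (auto simp: carrier_free_algebra free_var_def split: if_splits)

lemma free_const_closed: "free_const l \<in> carrier (free_algebra A)"
  by (auto simp: carrier_free_algebra free_const_def split: if_splits)

lemma free_const_add: "free_const (a + b) = free_const a + free_const b"
  by (simp add: free_const_def single_add)

lemma free_const_mult: "free_const (a * b) = free_const a * free_const b"
  by (simp add: free_const_def mult_single)

lemma free_const_one [simp]: "free_const 1 = 1"
  by (simp add: free_const_def)

lemma free_const_commute:
  fixes p :: "'a free_monoid \<Rightarrow>\<^sub>0 'l::comm_ring_1"
  shows "free_const l * p = p * free_const l"
proof (rule poly_mapping_single_induct[where K = UNIV and p = p])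
  fix k v and p :: "'a free_monoid \<Rightarrow>\<^sub>0 'l"
  assume "free_const l * p = p * free_const l"
  then show "free_const l * (Poly_Mapping.single k v + p) = (Poly_Mapping.single k v + p) * free_const l"
    by (simp add: distrib_left distrib_right) (simp add: free_const_def mult_single mult.commute)
qed auto

lemma single_word_Cons:
  "Poly_Mapping.single (FM (a # ws)) l = free_const l * (free_var a * Poly_Mapping.single (FM ws) 1)"
  by (simp add: free_var_def free_const_def mult_single plus_free_monoid_def zero_free_monoid_def)

text \<open>Each monomial is a constant times a product of variables, and each polynomial is a sum
  of monomials. The membership claims are carried through the inductions because homomorphism laws
  hold only on the carrier.\<close>

lemma free_algebra_hom_unique:
  fixes h h' :: "('a free_monoid \<Rightarrow>\<^sub>0 'l::comm_ring_1) \<Rightarrow> 'b"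
  assumes S: "ring S" and h: "h \<in> ring_hom (free_algebra A) S" and h': "h' \<in> ring_hom (free_algebra A) S"
    and c: "\<And>l. h (free_const l) = h' (free_const l)"
    and v: "\<And>a. a \<in> A \<Longrightarrow> h (free_var a) = h' (free_var a)"
    and p: "p \<in> carrier (free_algebra A)"
  shows "h p = h' p"
proof -
  let ?F = "free_algebra A :: ('a free_monoid \<Rightarrow>\<^sub>0 'l) ring"
  interpret F: ring ?F by (rule ring_free_algebra)
  have single1: "h (Poly_Mapping.single (FM ws) 1) = h' (Poly_Mapping.single (FM ws) 1)"
    "Poly_Mapping.single (FM ws) 1 \<in> carrier ?F"
    if "set ws \<subseteq> A" for ws
    using that
  proof (induction ws)
    case Nil
    { case 1 show ?case using ring_hom_one[OF h] ring_hom_one[OF h']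
        by (simp flip: zero_free_monoid_def) }
    { case 2 show ?case by (auto simp: carrier_free_algebra) }
  next
    case (Cons a ws)
    have e: "Poly_Mapping.single (FM (a # ws)) (1::'l) = free_var a * Poly_Mapping.single (FM ws) 1"
      by (simp add: single_word_Cons)
    { case 1 show ?case
        using ring_hom_mult[OF h, of "free_var a" "Poly_Mapping.single (FM ws) 1"]
         ring_hom_mult[OF h', of "free_var a" "Poly_Mapping.single (FM ws) 1"] Cons 1 v
        by (simp add: e free_var_closed) }
    { case 2 then show ?case by (auto simp: carrier_free_algebra) }
  qed
  have single: "h (Poly_Mapping.single w l) = h' (Poly_Mapping.single w l) \<and> Poly_Mapping.single w l \<in> carrier ?F"
    if "set (letters w) \<subseteq> A" for w l
  proof -
    have e: "Poly_Mapping.single w l = free_const l * Poly_Mapping.single (FM (letters w)) 1"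
      by (simp add: free_const_def mult_single)
    have "h (free_const l * Poly_Mapping.single (FM (letters w)) 1)
        = h' (free_const l * Poly_Mapping.single (FM (letters w)) 1)"
      using ring_hom_mult[OF h, of "free_const l" "Poly_Mapping.single (FM (letters w)) 1"]
        ring_hom_mult[OF h', of "free_const l" "Poly_Mapping.single (FM (letters w)) 1"]
        single1[OF that] c by (simp add: free_const_closed)
    then show ?thesis using F.m_closed[OF free_const_closed[of l] single1(2)[OF that]] e by simp
  qed
  have "h p = h' p \<and> p \<in> carrier ?F"
  proof (rule poly_mapping_single_induct[where K = "{w. set (letters w) \<subseteq> A}"])
    show "h 0 = h' 0 \<and> 0 \<in> carrier ?F"
      using ring_hom_zero[OF h F.ring_axioms S] ring_hom_zero[OF h' F.ring_axioms S]
      by (simp add: carrier_free_algebra)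
  next
    fix k v and p :: "'a free_monoid \<Rightarrow>\<^sub>0 'l"
    assume k: "k \<in> {w. set (letters w) \<subseteq> A}" and IH: "h p = h' p \<and> p \<in> carrier ?F"
    with single[of k v] show "h (Poly_Mapping.single k v + p) = h' (Poly_Mapping.single k v + p)
        \<and> Poly_Mapping.single k v + p \<in> carrier ?F"
      using ring_hom_add[OF h, of "Poly_Mapping.single k v" p]
        ring_hom_add[OF h', of "Poly_Mapping.single k v" p] F.a_closed by simp
  qed (use p in \<open>auto simp: carrier_free_algebra\<close>)
  then show ?thesis ..
qed

text \<open>Here \<open>g\<close> is total with values in \<open>S\<close>, so evaluation needs no
  side condition on words. Only commutation of scalars with the values of \<open>g\<close> is
  required; \<open>S\<close> itself is noncommutative in the applications.\<close>

locale free_evaluation = S: ring S for S :: "('b, 'm) ring_scheme" (structure) +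
  fixes c :: "'l::comm_ring_1 \<Rightarrow> 'b" and g :: "'a \<Rightarrow> 'b"
  assumes c_closed [simp]: "c l \<in> carrier S"
    and c_add: "c (l + m) = c l \<oplus> c m"
    and c_mult: "c (l * m) = c l \<otimes> c m"
    and c_one: "c 1 = \<one>"
    and g_closed [simp]: "g a \<in> carrier S"
    and c_central: "c l \<otimes> g a = g a \<otimes> c l"
begin

definition word :: "'a list \<Rightarrow> 'b" where
  "word ws = foldr (\<lambda>a r. g a \<otimes> r) ws \<one>"

lemma word_simps [simp]: "word [] = \<one>" "word (a # ws) = g a \<otimes> word ws"
  by (simp_all add: word_def)

lemma word_closed [simp]: "word ws \<in> carrier S"
  by (induction ws) auto

lemma word_append: "word (vs @ ws) = word vs \<otimes> word ws"
  by (induction vs) (auto simp: S.m_assoc)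

lemma word_central: "c l \<otimes> word ws = word ws \<otimes> c l"
proof (induction ws)
  case (Cons a ws)
  have "c l \<otimes> (g a \<otimes> word ws) = g a \<otimes> (c l \<otimes> word ws)"
    by (metis S.m_assoc c_central c_closed g_closed word_closed)
  then show ?case using Cons by (simp add: S.m_assoc)
qed simp

lemma c_zero: "c 0 = \<zero>"
  using c_add[of 0 0] by (metis S.add.r_cancel_one add_0 c_closed)

definition ev :: "('a free_monoid \<Rightarrow>\<^sub>0 'l) \<Rightarrow> 'b" where
  "ev p = (\<Oplus>w\<in>Poly_Mapping.keys p. c (Poly_Mapping.lookup p w) \<otimes> word (letters w))"

text \<open>Since \<open>c 0\<close> is zero, extra keys contribute nothing; two polynomials can
  thus be evaluated over a common finite set of words, which is what additivity needs.\<close>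

lemma ev_superset:
  assumes "finite K" "Poly_Mapping.keys p \<subseteq> K"
  shows "ev p = (\<Oplus>w\<in>K. c (Poly_Mapping.lookup p w) \<otimes> word (letters w))"
  unfolding ev_def
  by (rule S.add.finprod_mono_neutral_cong_left)
    (use assms in \<open>auto simp: in_keys_iff c_zero\<close>)

lemma ev_closed [simp]: "ev p \<in> carrier S"
  unfolding ev_def by (intro S.finsum_closed) auto

lemma ev_add: "ev (p + q) = ev p \<oplus> ev q"
proof -
  let ?K = "Poly_Mapping.keys p \<union> Poly_Mapping.keys q"
  have "ev (p + q) = (\<Oplus>w\<in>?K. c (Poly_Mapping.lookup p w) \<otimes> word (letters w)
      \<oplus> c (Poly_Mapping.lookup q w) \<otimes> word (letters w))"
    using keys_add[of p q]
    by (subst ev_superset[of ?K]) (auto simp: lookup_add c_add S.l_distr)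
  also have "\<dots> = ev p \<oplus> ev q"
    by (subst S.finsum_addf) (auto simp: ev_superset[of ?K])
  finally show ?thesis .
qed

lemma ev_single: "ev (Poly_Mapping.single w l) = c l \<otimes> word (letters w)"
  by (subst ev_superset[of "{w}"]) (auto split: if_splits)

lemma ev_zero: "ev 0 = \<zero>"
  by (simp add: ev_def)

text \<open>On two monomials this amounts to moving the second coefficient past the first word, by
  \<open>word_central\<close>. Additivity then extends it first in the right and then in the left
  factor.\<close>

lemma ev_mult: "ev (p * q) = ev p \<otimes> ev q"
proof -
  have s: "ev (Poly_Mapping.single w l * q) = ev (Poly_Mapping.single w l) \<otimes> ev q" for w l
  proof (rule poly_mapping_single_induct[where K = UNIV and p = q])
    fix k m and q :: "'a free_monoid \<Rightarrow>\<^sub>0 'l"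
    assume IH: "ev (Poly_Mapping.single w l * q) = ev (Poly_Mapping.single w l) \<otimes> ev q"
    have e: "ev (Poly_Mapping.single w l * Poly_Mapping.single k m)
        = ev (Poly_Mapping.single w l) \<otimes> ev (Poly_Mapping.single k m)"
      unfolding mult_single ev_single letters_plus word_append c_mult
      by (metis S.m_assoc S.m_closed c_closed word_central word_closed)
    show "ev (Poly_Mapping.single w l * (Poly_Mapping.single k m + q))
        = ev (Poly_Mapping.single w l) \<otimes> ev (Poly_Mapping.single k m + q)"
      by (simp add: distrib_left ev_add IH e S.r_distr)
  qed (auto simp: ev_zero)
  show ?thesis
  proof (rule poly_mapping_single_induct[where K = UNIV and p = p])
    fix k m and p :: "'a free_monoid \<Rightarrow>\<^sub>0 'l"
    assume "ev (p * q) = ev p \<otimes> ev q"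
    then show "ev ((Poly_Mapping.single k m + p) * q) = ev (Poly_Mapping.single k m + p) \<otimes> ev q"
      by (simp add: distrib_right ev_add s S.l_distr)
  qed (auto simp: ev_zero)
qed

lemma ev_hom: "ev \<in> ring_hom (free_algebra A) S"
  using ev_single[of 0 1] by (intro ring_hom_memI) (auto simp: ev_mult ev_add c_one)

lemma ev_const: "ev (free_const l) = c l"
  by (simp add: free_const_def ev_single)

lemma ev_var: "ev (free_var a) = g a"
  by (simp add: free_var_def ev_single c_one)

end

lemma free_algebra_hom:
  fixes c :: "'l::comm_ring_1 \<Rightarrow> 'b"
  assumes S: "ring S" and c: "\<And>l. c l \<in> carrier S" "\<And>l m. c (l + m) = c l \<oplus>\<^bsub>S\<^esub> c m"
    "\<And>l m. c (l * m) = c l \<otimes>\<^bsub>S\<^esub> c m" "c 1 = \<one>\<^bsub>S\<^esub>"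
    and g: "\<And>a. a \<in> A \<Longrightarrow> g a \<in> carrier S"
    and central: "\<And>a l. a \<in> A \<Longrightarrow> c l \<otimes>\<^bsub>S\<^esub> g a = g a \<otimes>\<^bsub>S\<^esub> c l"
  obtains h where "h \<in> ring_hom (free_algebra A) S" "\<And>l. h (free_const l) = c l"
    "\<And>a. a \<in> A \<Longrightarrow> h (free_var a) = g a"
proof -
  interpret S: ring S by fact
  \<comment> \<open>Letters outside \<open>A\<close> are sent to zero, which lies in
    \<open>S\<close> and commutes with all scalars, so the total version applies.\<close>
  interpret free_evaluation S c "\<lambda>a. if a \<in> A then g a else \<zero>\<^bsub>S\<^esub>"
    by unfold_locales (auto simp: assms)
  show ?thesis
    by (rule that[OF ev_hom]) (auto simp: ev_const ev_var)
qed

section \<open>Cyclic composition algebras and their endomorphisms\<close>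

lemma is_ring_homD:
  assumes "is_ring_hom f"
  shows "f (x + y) = f x + f y" "f (x * y) = f x * f y" "f 1 = 1" "f 0 = 0" "f (- x) = - f x"
    "f (x - y) = f x - f y"
proof -
  show *: "f (x + y) = f x + f y" "f (x * y) = f x * f y" "f 1 = 1" for x y
    using assms by (auto simp: is_ring_hom_def)
  show 0: "f 0 = 0" using *(1)[of 0 0] by simp
  show m: "f (- x) = - f x" for x using *(1)[of x "- x"] 0 by (simp add: eq_neg_iff_add_eq_0 add.commute)
  show "f (x - y) = f x - f y" using *(1)[of x "- y"] m by simp
qed

lemma is_ring_hom_sum:
  assumes "is_ring_hom f"
  shows "f (sum g A) = (\<Sum>a\<in>A. f (g a))"
  by (induction A rule: infinite_finite_induct) (simp_all add: is_ring_homD[OF assms])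

lemma is_ring_hom_numeral:
  assumes "is_ring_hom f"
  shows "f (numeral n) = numeral n"
  by (induction n) (simp_all only: numeral.simps is_ring_homD[OF assms])

locale cyclic_composition =
  fixes V :: "('f::field, 'l::comm_ring_1, 'v::ab_group_add) cyc"
  assumes cyclic_composition_algebra: "cyclic_composition_algebra V"
begin

abbreviation scale (infixr \<open>\<cdot>\<close> 75) where "l \<cdot> x \<equiv> scl V l x"
abbreviation star (infixl \<open>\<star>\<close> 70) where "x \<star> y \<equiv> prd V x y"
abbreviation rho (\<open>\<rho>\<close>) where "\<rho> \<equiv> rot V"
abbreviation beta (\<open>\<beta>\<close>) where "\<beta> \<equiv> polar V"
abbreviation quad (\<open>\<q>\<close>) where "\<q> \<equiv> qf V"

lemma galois: "cyclic_cubic_galois (incl V) \<rho>"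
  and module: "Modules.module (scl V)"
  and quadratic: "quadratic_form V"
  and nonsing: "nonsingular V"
  and star_add_left: "(x + y) \<star> z = x \<star> z + y \<star> z"
  and star_add_right: "x \<star> (y + z) = x \<star> y + x \<star> z"
  and star_scale_left: "(l \<cdot> x) \<star> y = \<rho> l \<cdot> (x \<star> y)"
  and star_scale_right: "x \<star> (l \<cdot> y) = \<rho> (\<rho> l) \<cdot> (x \<star> y)"
  and quad_star: "\<q> (x \<star> y) = \<rho> (\<q> x) * \<rho> (\<rho> (\<q> y))"
  and beta_star1: "\<beta> (x \<star> y) z = \<rho> (\<beta> (y \<star> z) x)"
  and beta_star2: "\<beta> (x \<star> y) z = \<rho> (\<rho> (\<beta> (z \<star> x) y))"
  using cyclic_composition_algebra unfolding cyclic_composition_algebra_def by blast+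

sublocale M: Modules.module "scl V"
  by (rule module)

lemma incl_hom: "is_ring_hom (incl V)" and rho_hom: "is_ring_hom \<rho>"
  and rho3 [simp]: "\<rho> (\<rho> (\<rho> l)) = l"
  and rho_fixed: "\<rho> l = l \<longleftrightarrow> l \<in> range (incl V)"
  using galois unfolding cyclic_cubic_galois_def by blast+

lemmas rho_simps [simp] = is_ring_homD[OF rho_hom] is_ring_hom_sum[OF rho_hom]
  is_ring_hom_numeral[OF rho_hom]

lemma rho_incl [simp]: "\<rho> (incl V c) = incl V c"
  using rho_fixed by blast

lemma rho_inj: "\<rho> l = \<rho> m \<longleftrightarrow> l = m"
  by (metis rho3)

lemma quad_scale: "\<q> (l \<cdot> x) = l\<^sup>2 * \<q> x"
  and beta_hom: "module_hom (scl V) (*) (\<beta> x)"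
  using quadratic unfolding quadratic_form_def by blast+

lemma beta_sym: "\<beta> x y = \<beta> y x"
  by (simp add: polar_def add.commute)

lemma beta_add_right: "\<beta> x (y + z) = \<beta> x y + \<beta> x z"
  using beta_hom by (rule module_hom.add)

lemma beta_add_left: "\<beta> (x + y) z = \<beta> x z + \<beta> y z"
  by (metis beta_add_right beta_sym)

lemma beta_scale_right: "\<beta> x (l \<cdot> y) = l * \<beta> x y"
  using beta_hom by (rule module_hom.scale)

lemma beta_scale_left: "\<beta> (l \<cdot> x) y = l * \<beta> x y"
  by (metis beta_scale_right beta_sym)

lemma beta_zero [simp]: "\<beta> 0 x = 0" "\<beta> x 0 = 0"
  using beta_scale_left[of 0 0 x] beta_scale_right[of x 0 0] by simp_all

lemma beta_sum: "\<beta> (sum g A) z = (\<Sum>a\<in>A. \<beta> (g a) z)" "\<beta> z (sum g A) = (\<Sum>a\<in>A. \<beta> z (g a))"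
  by (induction A rule: infinite_finite_induct) (simp_all add: beta_add_left beta_add_right)

lemma star_zero [simp]: "0 \<star> x = 0" "x \<star> 0 = 0"
  using star_scale_left[of 0 0 x] star_scale_right[of x 0 0] by simp_all

lemma star_minus [simp]: "(- x) \<star> y = - (x \<star> y)" "x \<star> (- y) = - (x \<star> y)"
  using star_scale_left[of "-1" x y] star_scale_right[of x "-1" y] by simp_all

lemma star_diff: "(x - y) \<star> z = x \<star> z - y \<star> z" "x \<star> (y - z) = x \<star> y - x \<star> z"
  using star_add_left[of x "- y" z] star_add_right[of x y "- z"] by simp_all

lemma star_sum: "sum g A \<star> z = (\<Sum>a\<in>A. g a \<star> z)" "z \<star> sum g A = (\<Sum>a\<in>A. z \<star> g a)"
  by (induction A rule: infinite_finite_induct) (simp_all add: star_add_left star_add_right)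

lemma beta_nondeg:
  assumes "\<And>z. \<beta> x z = \<beta> y z"
  shows "x = y"
proof -
  have "\<exists>!w. \<beta> x = \<beta> w" using nonsing beta_hom unfolding nonsingular_def by blast
  moreover have "\<beta> x = \<beta> y" using assms by blast
  ultimately show ?thesis by blast
qed

text \<open>The surjective half of nonsingularity. It is the source both of adjoints and of the dual
  basis.\<close>

lemma beta_represent:
  assumes "\<And>x y. f (x + y) = f x + f y" "\<And>l x. f (l \<cdot> x) = l * f x"
  obtains x where "\<And>y. f y = \<beta> x y"
proof -
  have "module_hom (scl V) (*) f"
    using beta_hom[of 0] assms by (simp add: module_hom_iff)
  then obtain x where "f = \<beta> x" using nonsing unfolding nonsingular_def by blast
  then show ?thesis using that by blast
qed

lemma quad_add: "\<q> (x + y) = \<q> x + \<q> y + \<beta> x y"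
  by (simp add: polar_def)

text \<open>Polarization of the multiplicativity \<open>quad_star\<close> in its second
  argument.\<close>

lemma beta_star_left: "\<beta> (x \<star> y) (x \<star> z) = \<rho> (\<q> x) * \<rho> (\<rho> (\<beta> y z))"
  using quad_star[of x "y + z"] by (simp add: star_add_right quad_add quad_star algebra_simps)

lemma beta_star_right: "\<beta> (y \<star> x) (z \<star> x) = \<rho> (\<beta> y z) * \<rho> (\<rho> (\<q> x))"
  using quad_star[of "y + z" x] by (simp add: star_add_left quad_add quad_star algebra_simps)

text \<open>The cyclic law turns the pairing of \<open>(x \<star> z) \<star> x\<close> with
  \<open>y\<close> into the pairing of \<open>x \<star> y\<close> with \<open>x \<star> z\<close>,
  which \<open>beta_star_left\<close> evaluates; nondegeneracy does the rest. This identity and its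
  mirror image are the Clifford relation for squares in the two components of \<alpha>.\<close>

lemma star_left_right: "(x \<star> z) \<star> x = \<rho> (\<rho> (\<q> x)) \<cdot> z"
proof (rule beta_nondeg)
  fix y
  have "\<rho> (\<rho> (\<beta> ((x \<star> z) \<star> x) y)) = \<rho> (\<q> x) * \<rho> (\<rho> (\<beta> y z))"
    using beta_star2[of x y "x \<star> z"] beta_star_left[of x y z] by simp
  then have "\<rho> (\<rho> (\<rho> (\<beta> ((x \<star> z) \<star> x) y))) = \<rho> (\<rho> (\<q> x) * \<rho> (\<rho> (\<beta> y z)))" by metis
  then show "\<beta> ((x \<star> z) \<star> x) y = \<beta> (\<rho> (\<rho> (\<q> x)) \<cdot> z) y"
    by (simp add: beta_scale_left beta_sym[of y z])
qed

lemma star_right_left: "x \<star> (z \<star> x) = \<rho> (\<q> x) \<cdot> z"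
proof (rule beta_nondeg)
  fix y
  have "\<rho> (\<beta> (x \<star> (z \<star> x)) y) = \<rho> (\<beta> y z) * \<rho> (\<rho> (\<q> x))"
    using beta_star1[of y x "z \<star> x"] beta_star_right[of y x z] by simp
  also have "\<dots> = \<rho> (\<beta> (\<rho> (\<q> x) \<cdot> z) y)"
    by (simp add: beta_scale_left beta_sym[of y z])
  finally show "\<beta> (x \<star> (z \<star> x)) y = \<beta> (\<rho> (\<q> x) \<cdot> z) y" by (simp add: rho_inj)
qed

lemma star_left_right_polar: "(x \<star> z) \<star> y + (y \<star> z) \<star> x = \<rho> (\<rho> (\<beta> x y)) \<cdot> z"
  using star_left_right[of "x + y" z]
  by (simp add: star_add_left star_add_right quad_add star_left_right M.scale_left_distrib algebra_simps)

lemma star_right_left_polar: "x \<star> (z \<star> y) + y \<star> (z \<star> x) = \<rho> (\<beta> x y) \<cdot> z"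
  using star_right_left[of "x + y" z]
  by (simp add: star_add_left star_add_right quad_add star_right_left M.scale_left_distrib algebra_simps)

lemma End_iff: "a \<in> End V \<longleftrightarrow> (\<forall>x y. a (x + y) = a x + a y) \<and> (\<forall>l x. a (l \<cdot> x) = l \<cdot> a x)"
  by (simp add: End_def module_hom_iff module)

lemma EndI:
  assumes "\<And>x y. a (x + y) = a x + a y" "\<And>l x. a (l \<cdot> x) = l \<cdot> a x"
  shows "a \<in> End V"
  using assms by (simp add: End_iff)

lemma End_add: "a \<in> End V \<Longrightarrow> a (x + y) = a x + a y"
  and End_scale_apply: "a \<in> End V \<Longrightarrow> a (l \<cdot> x) = l \<cdot> a x"
  by (simp_all add: End_iff)

lemma End_zero: "a \<in> End V \<Longrightarrow> a 0 = 0"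
  using End_scale_apply[of a 0 0] by simp

lemma End_sum: "a \<in> End V \<Longrightarrow> a (sum g A) = (\<Sum>i\<in>A. a (g i))"
  by (induction A rule: infinite_finite_induct) (simp_all add: End_add End_zero)

lemma End_ring_simps [simp]:
  "carrier (End_ring V) = End V" "a \<otimes>\<^bsub>End_ring V\<^esub> b = a \<circ> b" "\<one>\<^bsub>End_ring V\<^esub> = id"
  "\<zero>\<^bsub>End_ring V\<^esub> = (\<lambda>v. 0)" "a \<oplus>\<^bsub>End_ring V\<^esub> b = (\<lambda>v. a v + b v)"
  by (simp_all add: End_ring_def)

lemma rank_one_End: "rank_one V x y \<in> End V"
  by (rule EndI) (simp_all add: rank_one_def beta_add_right beta_scale_right M.scale_left_distrib)

lemma scalar_End: "End_scale V l id \<in> End V"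
  by (rule EndI) (simp_all add: End_scale_def M.scale_right_distrib mult.commute)

lemma End_scale_End: "a \<in> End V \<Longrightarrow> End_scale V l a \<in> End V"
  by (rule EndI) (simp_all add: End_scale_def End_add End_scale_apply M.scale_right_distrib mult.commute)

lemma End_comp: "a \<in> End V \<Longrightarrow> b \<in> End V \<Longrightarrow> a \<circ> b \<in> End V"
  by (rule EndI) (simp_all add: End_add End_scale_apply)

lemma End_plus: "a \<in> End V \<Longrightarrow> b \<in> End V \<Longrightarrow> (\<lambda>v. a v + b v) \<in> End V"
  by (rule EndI) (simp_all add: End_add End_scale_apply M.scale_right_distrib)

lemma ring_End: "ring (End_ring V)"
proof (rule ringI)
  show "abelian_group (End_ring V)"
  proof (rule abelian_groupI)
    fix a assume "a \<in> carrier (End_ring V)"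
    then have "(\<lambda>v. - a v) \<in> End V"
      by (intro EndI) (simp_all add: End_add End_scale_apply)
    then show "\<exists>b\<in>carrier (End_ring V). b \<oplus>\<^bsub>End_ring V\<^esub> a = \<zero>\<^bsub>End_ring V\<^esub>"
      by (intro bexI[of _ "\<lambda>v. - a v"]) auto
  qed (auto simp: End_plus add.assoc add.commute intro!: EndI)
  show "Group.monoid (End_ring V)"
    by (rule monoidI) (auto simp: End_comp comp_assoc intro!: EndI)
qed (auto simp: End_add fun_eq_iff)

text \<open>Existence of the adjoint comes from representing
  \<open>\<lambda>x. \<beta> (a x) y\<close> as a pairing with a vector, uniqueness from
  nondegeneracy; together they resolve the definite description in \<open>sigma\<close>.\<close>

lemma sigma:
  assumes "a \<in> End V"
  shows "sigma V a \<in> End V" "\<beta> (a x) y = \<beta> x (sigma V a y)"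
    and sigma_eqI: "\<And>a'. a' \<in> End V \<Longrightarrow> (\<And>x y. \<beta> (a x) y = \<beta> x (a' y)) \<Longrightarrow> sigma V a = a'"
proof -
  have "\<exists>z. \<forall>x. \<beta> (a x) y = \<beta> z x" for y
    by (rule beta_represent[of "\<lambda>x. \<beta> (a x) y"])
      (use assms in \<open>auto simp: End_add End_scale_apply beta_add_left beta_scale_left\<close>)
  then obtain a' where a': "\<And>x y. \<beta> (a x) y = \<beta> (a' y) x" by metis
  have End': "a' \<in> End V"
    by (rule EndI; rule beta_nondeg)
      (simp_all add: beta_add_left beta_scale_left beta_add_right beta_scale_right flip: a')
  have unique: "a1 = a2" if "\<And>x y. \<beta> (a x) y = \<beta> x (a1 y)" "\<And>x y. \<beta> (a x) y = \<beta> x (a2 y)" for a1 a2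
    by (rule ext, rule beta_nondeg) (metis that beta_sym)
  have *: "sigma V a \<in> End V \<and> (\<forall>x y. \<beta> (a x) y = \<beta> x (sigma V a y))"
    unfolding sigma_def
    by (rule theI[of _ a']) (use End' a' unique beta_sym in metis)+
  then show "sigma V a \<in> End V" "\<beta> (a x) y = \<beta> x (sigma V a y)" by blast+
  show "sigma V a = a'" if "\<And>x y. \<beta> (a x) y = \<beta> x (a' y)" for a'
    using * that unique by blast
qed

lemma sigma_rank_one: "sigma V (rank_one V x y) = rank_one V y x"
  by (rule sigma_eqI[OF rank_one_End rank_one_End])
    (simp add: rank_one_def beta_scale_left beta_scale_right beta_sym mult.commute)

end

section \<open>The even Clifford algebra\<close>

lemma free_algebra_minus:
  assumes "p \<in> carrier (free_algebra A)" "q \<in> carrier (free_algebra A)"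
  shows "p - q \<in> carrier (free_algebra A)"
  using assms keys_diff[of p q] by (auto simp: carrier_free_algebra)

lemma free_algebra_hom_minus_eq_zero:
  assumes S: "ring S" and h: "h \<in> ring_hom (free_algebra A) S"
    and p: "p \<in> carrier (free_algebra A)" "q \<in> carrier (free_algebra A)" and eq: "h p = h q"
  shows "h (p - q) = \<zero>\<^bsub>S\<^esub>"
proof -
  interpret S: ring S by fact
  have "h (p - q) \<oplus>\<^bsub>S\<^esub> h q = h q"
    using ring_hom_add[OF h free_algebra_minus[OF p] p(2)] eq by simp
  then show ?thesis
    using ring_hom_closed[OF h] p free_algebra_minus[OF p] by (metis S.add.r_cancel_one')
qed

lemma ring_hom_minus_eq_zero:
  assumes R: "ring R" and S: "ring S" and h: "h \<in> ring_hom R S"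
    and x: "x \<in> carrier R" "y \<in> carrier R" and eq: "h x = h y"
  shows "h (x \<ominus>\<^bsub>R\<^esub> y) = \<zero>\<^bsub>S\<^esub>"
proof -
  interpret ring_hom_ring R S h by (intro ring_hom_ringI2) fact+
  show ?thesis using x eq by (simp add: a_minus_def S.r_neg)
qed

lemma ideal_coset_eq:
  assumes I: "ideal I R" and x: "x \<in> carrier R" "y \<in> carrier R" and "x \<ominus>\<^bsub>R\<^esub> y \<in> I"
  shows "I +>\<^bsub>R\<^esub> x = I +>\<^bsub>R\<^esub> y"
proof -
  interpret ideal I R by fact
  have "x \<in> I +>\<^bsub>R\<^esub> y"
    using assms by (simp add: a_rcos_module_minus ideal.axioms(2)[OF I])
  then show ?thesis using a_repr_independence'[of x y] x by simp
qed

lemma carrier_Quot: "carrier (R Quot I) = (\<lambda>x. I +>\<^bsub>R\<^esub> x) ` carrier R"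
  by (auto simp: FactRing_simps)

context cyclic_composition
begin

abbreviation FA where "FA \<equiv> free_algebra (End V) :: (('v \<Rightarrow> 'v) free_monoid \<Rightarrow>\<^sub>0 'l) ring"
abbreviation TI where "TI \<equiv> tensor_ideal (End V) (add (End_ring V)) (End_scale V)"

lemma tensor_relations_closed:
  "{free_var (add (End_ring V) a b) - (free_var a + free_var b) | a b. a \<in> End V \<and> b \<in> End V} \<union>
     {free_var (End_scale V l a) - free_const l * free_var a | l a. a \<in> End V} \<subseteq> carrier FA"
  by (auto intro!: free_algebra_minus ring.ring_simprules(1)[OF ring_free_algebra, simplified]
      ring.ring_simprules(5)[OF ring_free_algebra, simplified] free_var_closed free_const_closed
      End_plus End_scale_End)

lemma tensor_ideal: "ideal TI FA"
  unfolding tensor_ideal_def by (rule ring.genideal_ideal[OF ring_free_algebra tensor_relations_closed])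

lemma ring_End_tensor: "ring (End_tensor V)"
  unfolding tensor_algebra_def by (rule ideal.quotient_is_ring[OF tensor_ideal])

lemma End_tensor_class_hom: "End_tensor_class V \<in> ring_hom FA (End_tensor V)"
  using ideal.rcos_ring_hom[OF tensor_ideal]
  by (simp add: End_tensor_class_def[abs_def] tensor_algebra_def)

lemma tgen_closed: "a \<in> End V \<Longrightarrow> tgen V a \<in> carrier (End_tensor V)"
  unfolding tgen_def by (intro ring_hom_closed[OF End_tensor_class_hom] free_var_closed)

lemma tconst_closed: "tconst V l \<in> carrier (End_tensor V)"
  unfolding tconst_def by (intro ring_hom_closed[OF End_tensor_class_hom] free_const_closed)

abbreviation Cl_relations where
  "Cl_relations \<equiv>
    {tgen V (rank_one V x x) \<ominus>\<^bsub>End_tensor V\<^esub> tconst V (qf V x) | x. True} \<union>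
    {tgen V (rank_one V x y) \<otimes>\<^bsub>End_tensor V\<^esub> tgen V (rank_one V y z)
        \<ominus>\<^bsub>End_tensor V\<^esub> tconst V (qf V y) \<otimes>\<^bsub>End_tensor V\<^esub> tgen V (rank_one V x z) | x y z. True}"

lemma Cl_relations_closed: "Cl_relations \<subseteq> carrier (End_tensor V)"
proof -
  interpret T: ring "End_tensor V" by (rule ring_End_tensor)
  show ?thesis by (auto intro!: tgen_closed tconst_closed rank_one_End)
qed

lemma Cl_ideal: "ideal (Cl_ideal V) (End_tensor V)"
  unfolding Cl_ideal_def by (rule ring.genideal_ideal[OF ring_End_tensor Cl_relations_closed])

lemma ring_Cl: "ring (Cl V)"
  unfolding Cl_def by (rule ideal.quotient_is_ring[OF Cl_ideal])

text \<open>The two quotient maps in one: \<open>kappa\<close> and \<open>cl_const\<close> become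
  the images of the variables and constants of the free algebra, so identities there transfer
  directly.\<close>

definition Cl_class :: "(('v \<Rightarrow> 'v) free_monoid \<Rightarrow>\<^sub>0 'l) \<Rightarrow> (('v \<Rightarrow> 'v) free_monoid \<Rightarrow>\<^sub>0 'l) set set" where
  "Cl_class p = Cl_ideal V +>\<^bsub>End_tensor V\<^esub> End_tensor_class V p"

lemma Cl_proj_hom: "(\<lambda>t. Cl_ideal V +>\<^bsub>End_tensor V\<^esub> t) \<in> ring_hom (End_tensor V) (Cl V)"
  unfolding Cl_def by (rule ideal.rcos_ring_hom[OF Cl_ideal])

lemma Cl_class_hom: "Cl_class \<in> ring_hom FA (Cl V)"
  using ring_hom_trans[OF End_tensor_class_hom Cl_proj_hom] by (simp add: Cl_class_def[abs_def] comp_def)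

lemma kappa_eq: "kappa V a = Cl_class (free_var a)"
  by (simp add: kappa_def tgen_def Cl_class_def)

lemma cl_const_eq: "cl_const V l = Cl_class (free_const l)"
  by (simp add: cl_const_def tconst_def Cl_class_def)

lemma carrier_Cl: "carrier (Cl V) = Cl_class ` carrier FA"
  unfolding Cl_def carrier_Quot
  by (subst (2) tensor_algebra_def) (simp add: carrier_Quot image_image Cl_class_def End_tensor_class_def)

lemma kappa_closed [simp]: "a \<in> End V \<Longrightarrow> kappa V a \<in> carrier (Cl V)"
  unfolding kappa_eq by (intro ring_hom_closed[OF Cl_class_hom] free_var_closed)

lemma cl_const_closed [simp]: "cl_const V l \<in> carrier (Cl V)"
  unfolding cl_const_eq by (intro ring_hom_closed[OF Cl_class_hom] free_const_closed)

lemma cl_const_add: "cl_const V (l + m) = cl_const V l \<oplus>\<^bsub>Cl V\<^esub> cl_const V m"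
  using ring_hom_add[OF Cl_class_hom free_const_closed free_const_closed]
  by (simp add: cl_const_eq free_const_add)

lemma cl_const_mult: "cl_const V (l * m) = cl_const V l \<otimes>\<^bsub>Cl V\<^esub> cl_const V m"
  using ring_hom_mult[OF Cl_class_hom free_const_closed free_const_closed]
  by (simp add: cl_const_eq free_const_mult)

lemma cl_const_one: "cl_const V 1 = \<one>\<^bsub>Cl V\<^esub>"
  using ring_hom_one[OF Cl_class_hom] by (simp add: cl_const_eq)

lemma cl_const_central:
  assumes "a \<in> End V"
  shows "cl_const V l \<otimes>\<^bsub>Cl V\<^esub> kappa V a = kappa V a \<otimes>\<^bsub>Cl V\<^esub> cl_const V l"
  using ring_hom_mult[OF Cl_class_hom free_const_closed free_var_closed[OF assms], of l]
    ring_hom_mult[OF Cl_class_hom free_var_closed[OF assms] free_const_closed, of l]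
  by (simp add: cl_const_eq kappa_eq free_const_commute)

lemma Cl_class_eqI:
  assumes "p \<in> carrier FA" "q \<in> carrier FA" "p - q \<in> TI"
  shows "Cl_class p = Cl_class q"
proof -
  interpret F: ring FA by (rule ring_free_algebra)
  have "\<ominus>\<^bsub>FA\<^esub> q = - q"
    using assms(2) free_algebra_minus[OF F.zero_closed assms(2)] by (intro F.minus_equality) auto
  then have "p \<ominus>\<^bsub>FA\<^esub> q \<in> TI" using assms by (simp add: a_minus_def)
  from ideal_coset_eq[OF tensor_ideal assms(1,2) this] show ?thesis
    by (simp add: Cl_class_def End_tensor_class_def)
qed

lemma genideal_mem: "ring R \<Longrightarrow> X \<subseteq> carrier R \<Longrightarrow> x \<in> X \<Longrightarrow> x \<in> Idl\<^bsub>R\<^esub> X"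
  using ring.genideal_self by blast

lemma kappa_add:
  assumes "a \<in> End V" "b \<in> End V"
  shows "kappa V (\<lambda>v. a v + b v) = kappa V a \<oplus>\<^bsub>Cl V\<^esub> kappa V b"
proof -
  interpret F: ring FA by (rule ring_free_algebra)
  have "free_var (\<lambda>v. a v + b v) - (free_var a + free_var b) \<in> TI"
    unfolding tensor_ideal_def
    by (rule genideal_mem[OF ring_free_algebra tensor_relations_closed]) (use assms in auto)
  then have "Cl_class (free_var (\<lambda>v. a v + b v)) = Cl_class (free_var a + free_var b)"
    using F.a_closed[OF free_var_closed[OF assms(1)] free_var_closed[OF assms(2)]] assms
    by (intro Cl_class_eqI) (auto intro: free_var_closed End_plus)
  then show ?thesis
    using ring_hom_add[OF Cl_class_hom free_var_closed[OF assms(1)] free_var_closed[OF assms(2)]]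
    by (simp add: kappa_eq)
qed

lemma kappa_scale:
  assumes "a \<in> End V"
  shows "kappa V (End_scale V l a) = cl_const V l \<otimes>\<^bsub>Cl V\<^esub> kappa V a"
proof -
  interpret F: ring FA by (rule ring_free_algebra)
  have "free_var (End_scale V l a) - free_const l * free_var a \<in> TI"
    unfolding tensor_ideal_def
    by (rule genideal_mem[OF ring_free_algebra tensor_relations_closed]) (use assms in auto)
  then have "Cl_class (free_var (End_scale V l a)) = Cl_class (free_const l * free_var a)"
    using F.m_closed[OF free_const_closed free_var_closed[OF assms], of l] assms
    by (intro Cl_class_eqI) (auto intro: free_var_closed End_scale_End)
  then show ?thesis
    using ring_hom_mult[OF Cl_class_hom free_const_closed free_var_closed[OF assms]]
    by (simp add: kappa_eq cl_const_eq)
qed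

lemma kappa_square: "kappa V (rank_one V x x) = cl_const V (\<q> x)"
proof -
  have "tgen V (rank_one V x x) \<ominus>\<^bsub>End_tensor V\<^esub> tconst V (qf V x) \<in> Cl_ideal V"
    unfolding Cl_ideal_def by (rule genideal_mem[OF ring_End_tensor Cl_relations_closed]) blast
  from ideal_coset_eq[OF Cl_ideal _ _ this] show ?thesis
    by (simp add: kappa_def cl_const_def tgen_closed tconst_closed rank_one_End)
qed

lemma kappa_mult:
  "kappa V (rank_one V x y) \<otimes>\<^bsub>Cl V\<^esub> kappa V (rank_one V y z)
    = cl_const V (\<q> y) \<otimes>\<^bsub>Cl V\<^esub> kappa V (rank_one V x z)"
proof -
  interpret T: ring "End_tensor V" by (rule ring_End_tensor)
  have "tgen V (rank_one V x y) \<otimes>\<^bsub>End_tensor V\<^esub> tgen V (rank_one V y z)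
        \<ominus>\<^bsub>End_tensor V\<^esub> tconst V (qf V y) \<otimes>\<^bsub>End_tensor V\<^esub> tgen V (rank_one V x z) \<in> Cl_ideal V"
    unfolding Cl_ideal_def by (rule genideal_mem[OF ring_End_tensor Cl_relations_closed]) blast
  from ideal_coset_eq[OF Cl_ideal _ _ this] show ?thesis
    using ring_hom_mult[OF Cl_proj_hom]
    by (simp add: kappa_def cl_const_def tgen_closed tconst_closed rank_one_End)
qed

text \<open>Universal property of the even Clifford algebra. Evaluation on the free algebra factors
  twice: \<open>g_add\<close> and \<open>g_scale\<close> kill the relations of the tensor algebra,
  \<open>g_square\<close> and \<open>g_mult\<close> those of the Clifford ideal.\<close>

lemma Cl_hom_exists:
  fixes c :: "'l \<Rightarrow> 's"
  assumes S: "ring S" and c: "\<And>l. c l \<in> carrier S" "\<And>l m. c (l + m) = c l \<oplus>\<^bsub>S\<^esub> c m"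
    "\<And>l m. c (l * m) = c l \<otimes>\<^bsub>S\<^esub> c m" "c 1 = \<one>\<^bsub>S\<^esub>"
    and g: "\<And>a. a \<in> End V \<Longrightarrow> g a \<in> carrier S"
    and central: "\<And>a l. a \<in> End V \<Longrightarrow> c l \<otimes>\<^bsub>S\<^esub> g a = g a \<otimes>\<^bsub>S\<^esub> c l"
    and g_add: "\<And>a b. a \<in> End V \<Longrightarrow> b \<in> End V \<Longrightarrow> g (\<lambda>v. a v + b v) = g a \<oplus>\<^bsub>S\<^esub> g b"
    and g_scale: "\<And>l a. a \<in> End V \<Longrightarrow> g (End_scale V l a) = c l \<otimes>\<^bsub>S\<^esub> g a"
    and g_square: "\<And>x. g (rank_one V x x) = c (\<q> x)"
    and g_mult: "\<And>x y z. g (rank_one V x y) \<otimes>\<^bsub>S\<^esub> g (rank_one V y z) = c (\<q> y) \<otimes>\<^bsub>S\<^esub> g (rank_one V x z)"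
  obtains h where "h \<in> ring_hom (Cl V) S" "\<And>l. h (cl_const V l) = c l"
    "\<And>a. a \<in> End V \<Longrightarrow> h (kappa V a) = g a"
proof -
  obtain h0 where h0: "h0 \<in> ring_hom FA S" "\<And>l. h0 (free_const l) = c l"
    "\<And>a. a \<in> End V \<Longrightarrow> h0 (free_var a) = g a"
    using free_algebra_hom[of S c "End V" g] S c g central by blast
  interpret F: ring FA by (rule ring_free_algebra)
  interpret T: ring "End_tensor V" by (rule ring_End_tensor)
  have kill0: "h0 p = \<zero>\<^bsub>S\<^esub>" if "p \<in> TI" for p
  proof (rule genideal_kernel[OF ring_free_algebra S h0(1) tensor_relations_closed])
    show "p \<in> Idl\<^bsub>FA\<^esub> ({free_var (add (End_ring V) a b) - (free_var a + free_var b) | a b. a \<in> End V \<and> b \<in> End V} \<union>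
     {free_var (End_scale V l a) - free_const l * free_var a | l a. a \<in> End V})"
      using that by (simp add: tensor_ideal_def)
  next
    fix x assume "x \<in> {free_var (add (End_ring V) a b) - (free_var a + free_var b) | a b. a \<in> End V \<and> b \<in> End V} \<union>
     {free_var (End_scale V l a) - free_const l * free_var a | l a. a \<in> End V}"
    then consider a b where "a \<in> End V" "b \<in> End V" "x = free_var (\<lambda>v. a v + b v) - (free_var a + free_var b)"
      | l a where "a \<in> End V" "x = free_var (End_scale V l a) - free_const l * free_var a"
      by auto
    then show "h0 x = \<zero>\<^bsub>S\<^esub>"
    proof cases
      case (1 a b)
      then show ?thesis
        using ring_hom_add[OF h0(1), of "free_var a" "free_var b"]
          F.a_closed[OF free_var_closed[of a] free_var_closed[of b]]
        by (simp add: free_algebra_hom_minus_eq_zero[OF S h0(1)] free_var_closed End_plus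
            h0 g_add)
    next
      case (2 l a)
      then show ?thesis
        using ring_hom_mult[OF h0(1), of "free_const l" "free_var a"]
          F.m_closed[OF free_const_closed[of l] free_var_closed[of a]]
        by (simp add: free_algebra_hom_minus_eq_zero[OF S h0(1)] free_var_closed free_const_closed
            End_scale_End h0 g_scale)
    qed
  qed
  obtain h1 where h1: "h1 \<in> ring_hom (FA Quot TI) S" "\<And>p. p \<in> carrier FA \<Longrightarrow> h1 (TI +>\<^bsub>FA\<^esub> p) = h0 p"
    using ring_hom_factor_Quot[OF ring_free_algebra S tensor_ideal h0(1) kill0] by blast
  have h1_hom: "h1 \<in> ring_hom (End_tensor V) S" using h1(1) by (simp add: tensor_algebra_def)
  have h1_gen: "h1 (tgen V a) = g a" if "a \<in> End V" for a
    using h1(2)[OF free_var_closed[OF that]] h0(3)[OF that] by (simp add: tgen_def End_tensor_class_def)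
  have h1_const: "h1 (tconst V l) = c l" for l
    using h1(2)[OF free_const_closed[of l]] h0(2) by (simp add: tconst_def End_tensor_class_def)
  have kill1: "h1 t = \<zero>\<^bsub>S\<^esub>" if "t \<in> Cl_ideal V" for t
  proof (rule genideal_kernel[OF ring_End_tensor S h1_hom Cl_relations_closed])
    show "t \<in> Idl\<^bsub>End_tensor V\<^esub> Cl_relations" using that by (simp add: Cl_ideal_def)
  next
    fix x assume "x \<in> Cl_relations"
    then consider v where "x = tgen V (rank_one V v v) \<ominus>\<^bsub>End_tensor V\<^esub> tconst V (qf V v)"
      | u v w where "x = tgen V (rank_one V u v) \<otimes>\<^bsub>End_tensor V\<^esub> tgen V (rank_one V v w)
        \<ominus>\<^bsub>End_tensor V\<^esub> tconst V (qf V v) \<otimes>\<^bsub>End_tensor V\<^esub> tgen V (rank_one V u w)"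
      by blast
    then show "h1 x = \<zero>\<^bsub>S\<^esub>"
    proof cases
      case (1 v)
      then show ?thesis
        by (auto intro!: ring_hom_minus_eq_zero[OF ring_End_tensor S h1_hom] tgen_closed tconst_closed
            simp: rank_one_End h1_gen h1_const g_square)
    next
      case (2 u v w)
      then show ?thesis
        by (auto intro!: ring_hom_minus_eq_zero[OF ring_End_tensor S h1_hom] tgen_closed tconst_closed
            simp: rank_one_End h1_gen h1_const g_mult ring_hom_mult[OF h1_hom] tgen_closed tconst_closed)
    qed
  qed
  obtain h where h: "h \<in> ring_hom (Cl V) S"
    "\<And>t. t \<in> carrier (End_tensor V) \<Longrightarrow> h (Cl_ideal V +>\<^bsub>End_tensor V\<^esub> t) = h1 t"
    using ring_hom_factor_Quot[OF ring_End_tensor S Cl_ideal h1_hom kill1] unfolding Cl_def by blast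
  show ?thesis
    by (rule that[OF h(1)])
      (simp_all add: cl_const_def kappa_def h(2) tgen_closed tconst_closed h1_gen h1_const)
qed

lemma Cl_hom_unique:
  assumes S: "ring S" and h: "h \<in> ring_hom (Cl V) S" "h' \<in> ring_hom (Cl V) S"
    and c: "\<And>l. h (cl_const V l) = h' (cl_const V l)"
    and k: "\<And>a. a \<in> End V \<Longrightarrow> h (kappa V a) = h' (kappa V a)"
    and x: "x \<in> carrier (Cl V)"
  shows "h x = h' x"
proof -
  obtain p where p: "p \<in> carrier FA" "x = Cl_class p" using x by (auto simp: carrier_Cl)
  have "(h \<circ> Cl_class) p = (h' \<circ> Cl_class) p"
    by (rule free_algebra_hom_unique[OF S ring_hom_trans[OF Cl_class_hom h(1)]
          ring_hom_trans[OF Cl_class_hom h(2)] _ _ p(1)])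
      (use c k in \<open>simp_all add: cl_const_eq kappa_eq\<close>)
  then show ?thesis by (simp add: p)
qed

end

section \<open>Dual bases and the map \<open>\<alpha>\<close>\<close>

locale cyclic_composition_rank8 = cyclic_composition V
  for V :: "('f::field, 'l::comm_ring_1, 'v::ab_group_add) cyc" +
  assumes rank8: "has_rank V 8" and char2: "CHAR('f) \<noteq> 2" and char3: "CHAR('f) \<noteq> 3"
begin

lemma numeral_inverse:
  assumes "(numeral n :: 'f) \<noteq> 0"
  shows "numeral n * incl V (1 / numeral n) = 1"
proof -
  have "incl V (numeral n * (1 / numeral n)) = 1" using assms is_ring_homD(3)[OF incl_hom] by simp
  then show ?thesis by (simp only: is_ring_homD(2)[OF incl_hom] is_ring_hom_numeral[OF incl_hom])
qed

lemma CHAR_ne_1: "CHAR('f) \<noteq> Suc 0"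
  using of_nat_eq_0_iff_char_dvd[where 'a = 'f, of 1] by auto

lemma two_inverse: "2 * incl V (1 / 2) = 1"
proof (rule numeral_inverse)
  show "(2::'f) \<noteq> 0"
  proof
    assume "(2::'f) = 0"
    then have d: "CHAR('f) dvd 2" using of_nat_eq_0_iff_char_dvd[where 'a = 'f, of 2] by simp
    then have "CHAR('f) \<le> 2" "CHAR('f) \<noteq> 0" using dvd_imp_le[OF d] by (auto intro: ccontr)
    then show False using char2 CHAR_ne_1 by linarith
  qed
qed

lemma three_inverse: "3 * incl V (1 / 3) = 1"
proof (rule numeral_inverse)
  show "(3::'f) \<noteq> 0"
  proof
    assume "(3::'f) = 0"
    then have d: "CHAR('f) dvd 3" using of_nat_eq_0_iff_char_dvd[where 'a = 'f, of 3] by simp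
    then have "CHAR('f) \<le> 3" "CHAR('f) \<noteq> 0" using dvd_imp_le[OF d] by (auto intro: ccontr)
    moreover have "CHAR('f) \<noteq> 2" using d by auto
    ultimately show False using char3 CHAR_ne_1 by linarith
  qed
qed

lemma unit_cancel: "u * l = 1 \<Longrightarrow> l \<cdot> x = l \<cdot> y \<Longrightarrow> x = y"
  by (metis M.scale_one M.scale_scale)

lemma two_cancel: "2 \<cdot> x = 2 \<cdot> y \<Longrightarrow> x = y"
  using unit_cancel[of "incl V (1 / 2)" 2] two_inverse by (simp add: mult.commute)

lemma three_cancel: "3 \<cdot> x = 3 \<cdot> y \<Longrightarrow> x = y"
  using unit_cancel[of "incl V (1 / 3)" 3] three_inverse by (simp add: mult.commute)

lemma four_cancel: "4 \<cdot> x = 4 \<cdot> y \<Longrightarrow> x = y"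
  using two_cancel[of "2 \<cdot> x" "2 \<cdot> y"] two_cancel[of x y] by simp

lemma ring_two_cancel: "2 * l = 2 * m \<Longrightarrow> l = (m::'l)"
  using two_inverse by (metis mult.assoc mult.commute mult_1)

section \<open>Dual bases for the polar form and their Casimir sums\<close>

definition basis :: "'v set" where
  "basis = (SOME B. finite B \<and> card B = 8 \<and> module_basis (scl V) B)"

lemma basis: "finite basis" "card basis = 8" "M.independent basis" "M.span basis = UNIV"
proof -
  have "finite basis \<and> card basis = 8 \<and> module_basis (scl V) basis"
    unfolding basis_def by (rule someI_ex) (use rank8 in \<open>simp add: has_rank_def\<close>)
  then show "finite basis" "card basis = 8" "M.independent basis" "M.span basis = UNIV"
    by (auto simp: module_basis_def)
qed

text \<open>The vector representing the coordinate functional of \<open>e\<close>; on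
  \<open>basis\<close> these vectors form the dual basis with respect to \<beta>.\<close>

definition dual :: "'v \<Rightarrow> 'v" where
  "dual e = (SOME d. \<forall>x. M.representation basis x e = \<beta> d x)"

lemma dual: "\<beta> (dual e) x = M.representation basis x e"
proof -
  have "\<exists>d. \<forall>x. M.representation basis x e = \<beta> d x"
    by (rule beta_represent[of "\<lambda>x. M.representation basis x e"])
      (use basis in \<open>auto simp: M.representation_add M.representation_scale\<close>)
  then have "\<forall>x. M.representation basis x e = \<beta> (dual e) x"
    unfolding dual_def by (rule someI_ex)
  then show ?thesis by simp
qed

lemma basis_expand: "(\<Sum>e\<in>basis. \<beta> (dual e) x \<cdot> e) = x"
  using M.sum_representation_eq[of basis x basis] basis by (simp add: dual)

lemma beta_dual_basis: "e \<in> basis \<Longrightarrow> \<beta> (dual e) e = 1"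
  using M.representation_basis[of basis e] basis by (simp add: dual)

lemma dual_expand: "(\<Sum>e\<in>basis. \<beta> e x \<cdot> dual e) = x"
proof (rule beta_nondeg)
  fix z
  have "\<beta> x z = \<beta> x (\<Sum>e\<in>basis. \<beta> (dual e) z \<cdot> e)" by (simp add: basis_expand)
  also have "\<dots> = (\<Sum>e\<in>basis. \<beta> (dual e) z * \<beta> x e)" by (simp add: beta_sum beta_scale_right)
  also have "\<dots> = \<beta> (\<Sum>e\<in>basis. \<beta> e x \<cdot> dual e) z"
    by (simp add: beta_sum beta_scale_left beta_sym[of x] mult.commute)
  finally show "\<beta> (\<Sum>e\<in>basis. \<beta> e x \<cdot> dual e) z = \<beta> x z" by simp
qed

text \<open>The trace of the identity, through which the numerical value of the rank enters the
  identities for products.\<close>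

lemma sum_beta_dual: "(\<Sum>e\<in>basis. \<beta> e (dual e)) = 8"
  by (simp add: beta_sym[of _ "dual _"] beta_dual_basis basis)

text \<open>The Casimir tensor, the sum of \<open>e\<close> tensor \<open>dual e\<close>, is
  symmetric because \<beta> is: expand \<open>dual e\<close> in the basis, move the symmetric
  coefficient across, and sum over \<open>e\<close> first. Only a balanced biadditive
  \<open>F\<close> is needed, so it also applies to products that are merely semilinear.\<close>

lemma dual_basis_symmetric:
  assumes add1: "\<And>x y z. F (x + y) z = F x z + F y z" and add2: "\<And>x y z. F x (y + z) = F x y + F x z"
    and balanced: "\<And>l x y. F (l \<cdot> x) y = F x (l \<cdot> y)"
  shows "(\<Sum>e\<in>basis. F e (dual e)) = (\<Sum>e\<in>basis. F (dual e) e :: 'c::ab_group_add)"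
proof -
  have zero: "F 0 x = 0" "F x 0 = 0" for x using add1[of 0 0] add2[of _ 0 0] by simp_all
  have sum1: "F (sum g A) x = (\<Sum>a\<in>A. F (g a) x)" and sum2: "F x (sum g A) = (\<Sum>a\<in>A. F x (g a))"
    for g x and A :: "'v set"
    by (induction A rule: infinite_finite_induct) (simp_all add: zero add1 add2)
  have "(\<Sum>e\<in>basis. F e (dual e)) = (\<Sum>e\<in>basis. F e (\<Sum>d\<in>basis. \<beta> (dual d) (dual e) \<cdot> d))"
    by (simp add: basis_expand)
  also have "\<dots> = (\<Sum>e\<in>basis. \<Sum>d\<in>basis. F (\<beta> (dual e) (dual d) \<cdot> e) d)"
    by (simp add: sum2 balanced beta_sym)
  also have "\<dots> = (\<Sum>d\<in>basis. \<Sum>e\<in>basis. F (\<beta> (dual e) (dual d) \<cdot> e) d)"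
    by (rule sum.swap)
  also have "\<dots> = (\<Sum>d\<in>basis. F (dual d) d)"
    by (simp add: basis_expand flip: sum1)
  finally show ?thesis .
qed

text \<open>The sum and its mirror image agree by \<open>dual_basis_symmetric\<close>, and the
  polarized identity makes them add up to the trace 8 times \<open>v\<close>; each is therefore 4
  times \<open>v\<close>, as 2 can be cancelled.\<close>

lemma sum_left_right: "(\<Sum>e\<in>basis. (e \<star> v) \<star> dual e) = 4 \<cdot> v"
  and sum_left_right': "(\<Sum>e\<in>basis. (dual e \<star> v) \<star> e) = 4 \<cdot> v"
proof -
  have sym: "(\<Sum>e\<in>basis. (e \<star> v) \<star> dual e) = (\<Sum>e\<in>basis. (dual e \<star> v) \<star> e)"
    by (rule dual_basis_symmetric)
      (simp_all add: star_add_left star_add_right star_scale_left star_scale_right)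
  have "(\<Sum>e\<in>basis. (e \<star> v) \<star> dual e) + (\<Sum>e\<in>basis. (dual e \<star> v) \<star> e)
      = (\<Sum>e\<in>basis. \<rho> (\<rho> (\<beta> e (dual e))) \<cdot> v)"
    by (simp add: star_left_right_polar flip: sum.distrib)
  also have "\<dots> = \<rho> (\<rho> (\<Sum>e\<in>basis. \<beta> e (dual e))) \<cdot> v"
    by (simp add: M.scale_sum_left)
  also have "\<dots> = 2 \<cdot> (4 \<cdot> v)"
    by (simp only: sum_beta_dual rho_simps M.scale_scale) simp
  finally have "2 \<cdot> (\<Sum>e\<in>basis. (e \<star> v) \<star> dual e) = 2 \<cdot> (4 \<cdot> v)"
    using M.scale_left_distrib[of 1 1 "\<Sum>e\<in>basis. (e \<star> v) \<star> dual e"] sym by simp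
  then show "(\<Sum>e\<in>basis. (e \<star> v) \<star> dual e) = 4 \<cdot> v" by (rule two_cancel)
  then show "(\<Sum>e\<in>basis. (dual e \<star> v) \<star> e) = 4 \<cdot> v" using sym by simp
qed

lemma sum_right_left: "(\<Sum>e\<in>basis. e \<star> (v \<star> dual e)) = 4 \<cdot> v"
  and sum_right_left': "(\<Sum>e\<in>basis. dual e \<star> (v \<star> e)) = 4 \<cdot> v"
proof -
  have sym: "(\<Sum>e\<in>basis. e \<star> (v \<star> dual e)) = (\<Sum>e\<in>basis. dual e \<star> (v \<star> e))"
    by (rule dual_basis_symmetric)
      (simp_all add: star_add_left star_add_right star_scale_left star_scale_right)
  have "(\<Sum>e\<in>basis. e \<star> (v \<star> dual e)) + (\<Sum>e\<in>basis. dual e \<star> (v \<star> e))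
      = (\<Sum>e\<in>basis. \<rho> (\<beta> e (dual e)) \<cdot> v)"
    by (simp add: star_right_left_polar flip: sum.distrib)
  also have "\<dots> = \<rho> (\<Sum>e\<in>basis. \<beta> e (dual e)) \<cdot> v"
    by (simp add: M.scale_sum_left)
  also have "\<dots> = 2 \<cdot> (4 \<cdot> v)"
    by (simp only: sum_beta_dual rho_simps M.scale_scale) simp
  finally have "2 \<cdot> (\<Sum>e\<in>basis. e \<star> (v \<star> dual e)) = 2 \<cdot> (4 \<cdot> v)"
    using M.scale_left_distrib[of 1 1 "\<Sum>e\<in>basis. e \<star> (v \<star> dual e)"] sym by simp
  then show "(\<Sum>e\<in>basis. e \<star> (v \<star> dual e)) = 4 \<cdot> v" by (rule two_cancel)
  then show "(\<Sum>e\<in>basis. dual e \<star> (v \<star> e)) = 4 \<cdot> v" using sym by simp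
qed

text \<open>The Casimir sum recovers 4 times a vector from its products with the basis on the
  left.\<close>

lemma star_left_inj: "(\<And>x. x \<star> u = x \<star> v) \<Longrightarrow> u = v"
  using sum_left_right[of u] sum_left_right[of v] four_cancel by auto

lemma End_expand:
  assumes "a \<in> End V"
  shows "a v = (\<Sum>e\<in>basis. rank_one V (a e) (dual e) v)"
proof -
  have "a v = a (\<Sum>e\<in>basis. \<beta> (dual e) v \<cdot> e)" by (simp add: basis_expand)
  then show ?thesis using assms by (simp add: End_sum End_scale_apply rank_one_def)
qed

text \<open>The linear extension of \<open>x \<beta>(y, _)\<close> to the operator
  \<open>l_x r_y\<close>, written through the expansion of \<open>a\<close> as the sum of
  \<open>rank_one V (a e) (dual e)\<close>. Fixing a basis avoids any question of well-definedness.
  \<open>alpha2\<close> does the same for \<open>r_x l_y\<close>.\<close>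

definition alpha1 :: "('v \<Rightarrow> 'v) \<Rightarrow> 'v \<Rightarrow> 'v" where
  "alpha1 a v = (\<Sum>e\<in>basis. a e \<star> (v \<star> dual e))"

definition alpha2 :: "('v \<Rightarrow> 'v) \<Rightarrow> 'v \<Rightarrow> 'v" where
  "alpha2 a v = (\<Sum>e\<in>basis. (dual e \<star> v) \<star> a e)"

lemma alpha12_End: "alpha1 a \<in> End V" "alpha2 a \<in> End V"
  by (rule EndI; simp add: alpha1_def alpha2_def star_add_left star_add_right star_scale_left
      star_scale_right sum.distrib M.scale_sum_right)+

lemma alpha12_add:
  "alpha1 (\<lambda>v. a v + b v) = (\<lambda>v. alpha1 a v + alpha1 b v)"
  "alpha2 (\<lambda>v. a v + b v) = (\<lambda>v. alpha2 a v + alpha2 b v)"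
  by (simp_all add: alpha1_def alpha2_def fun_eq_iff star_add_left star_add_right sum.distrib)

lemma alpha12_scale:
  "alpha1 (End_scale V l a) = End_scale V (\<rho> l) (alpha1 a)"
  "alpha2 (End_scale V l a) = End_scale V (\<rho> (\<rho> l)) (alpha2 a)"
  by (simp_all add: alpha1_def alpha2_def End_scale_def fun_eq_iff star_scale_left star_scale_right
      M.scale_sum_right)

lemma alpha12_rank_one:
  "alpha1 (rank_one V x y) = (\<lambda>v. x \<star> (v \<star> y))"
  "alpha2 (rank_one V x y) = (\<lambda>v. (y \<star> v) \<star> x)"
proof -
  have "alpha1 (rank_one V x y) v = x \<star> (v \<star> (\<Sum>e\<in>basis. \<beta> e y \<cdot> dual e))" for v
    unfolding alpha1_def rank_one_def star_sum
    by (simp add: star_scale_left star_scale_right beta_sym)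
  then show "alpha1 (rank_one V x y) = (\<lambda>v. x \<star> (v \<star> y))" by (simp add: dual_expand fun_eq_iff)
  have "alpha2 (rank_one V x y) v = ((\<Sum>e\<in>basis. \<beta> e y \<cdot> dual e) \<star> v) \<star> x" for v
    unfolding alpha2_def rank_one_def star_sum
    by (simp add: star_scale_left star_scale_right beta_sym)
  then show "alpha2 (rank_one V x y) = (\<lambda>v. (y \<star> v) \<star> x)" by (simp add: dual_expand fun_eq_iff)
qed

lemma RDirProd_End_simps [simp]:
  "carrier (RDirProd (End_ring V) (End_ring V)) = End V \<times> End V"
  "p \<otimes>\<^bsub>RDirProd (End_ring V) (End_ring V)\<^esub> q = (fst p \<circ> fst q, snd p \<circ> snd q)"
  "p \<oplus>\<^bsub>RDirProd (End_ring V) (End_ring V)\<^esub> q = (\<lambda>v. fst p v + fst q v, \<lambda>v. snd p v + snd q v)"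
  "\<one>\<^bsub>RDirProd (End_ring V) (End_ring V)\<^esub> = (id, id)"
  by (cases p; cases q; simp add: RDirProd_def DirProd_def monoid.defs)+

text \<open>Rank one operators span \<open>E\<close> by \<open>End_expand\<close>, and
  \<open>kappa\<close> is additive, so agreement on them propagates to all of
  \<open>kappa\<close>.\<close>

lemma Cl_hom_unique_rank_one:
  assumes S: "ring S" and h: "h \<in> ring_hom (Cl V) S" "h' \<in> ring_hom (Cl V) S"
    and c: "\<And>l. h (cl_const V l) = h' (cl_const V l)"
    and k: "\<And>x y. h (kappa V (rank_one V x y)) = h' (kappa V (rank_one V x y))"
    and x: "x \<in> carrier (Cl V)"
  shows "h x = h' x"
proof (rule Cl_hom_unique[OF S h c _ x])
  fix a assume a: "a \<in> End V"
  \<comment> \<open>Partial sums of the expansion of \<open>a\<close>: additivity of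
    \<open>kappa\<close> is available for two summands only, so the sum is built up by
    induction.\<close>
  define r where "r A v = (\<Sum>e\<in>A. rank_one V (a e) (dual e) v)" for A v
  have kzero: "h (kappa V (\<lambda>v. 0)) = h' (kappa V (\<lambda>v. 0))"
    using k[of 0 0] by (simp add: rank_one_def)
  have "r A \<in> End V \<and> h (kappa V (r A)) = h' (kappa V (r A))" if "finite A" for A
    using that
  proof (induction A)
    case empty
    then show ?case using kzero by (auto simp: r_def intro!: EndI)
  next
    case (insert e A)
    have r: "r (insert e A) = (\<lambda>v. rank_one V (a e) (dual e) v + r A v)"
      using insert by (auto simp: r_def)
    show ?case
      using insert k ring_hom_add[OF h(1)] ring_hom_add[OF h(2)]
      by (simp add: r kappa_add rank_one_End End_plus)
  qed
  moreover have "r basis = a" unfolding r_def by (rule ext) (rule End_expand[OF a, symmetric])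
  ultimately show "h (kappa V a) = h' (kappa V a)" using basis(1) by metis
qed

text \<open>Existence for the definite description comes from \<open>alpha1\<close> and
  \<open>alpha2\<close> via the universal property, uniqueness from
  \<open>Cl_hom_unique_rank_one\<close>. The uniqueness is kept as \<open>alpha_eqI\<close>, which
  later identifies \<alpha> of the opposite.\<close>

lemma alpha_properties:
  shows alpha_hom: "alpha V \<in> ring_hom (Cl V) (RDirProd (End_ring V) (End_ring V))"
    and alpha_const: "alpha V (cl_const V l) = (End_scale V (\<rho> l) id, End_scale V (\<rho> (\<rho> l)) id)"
    and alpha_kappa: "alpha V (kappa V (rank_one V x y)) = (\<lambda>v. x \<star> (v \<star> y), \<lambda>v. (y \<star> v) \<star> x)"
    and alpha_eqI: "\<And>h. h \<in> extensional (carrier (Cl V)) \<Longrightarrow>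
      h \<in> ring_hom (Cl V) (RDirProd (End_ring V) (End_ring V)) \<Longrightarrow>
      (\<And>l. h (cl_const V l) = (End_scale V (\<rho> l) id, End_scale V (\<rho> (\<rho> l)) id)) \<Longrightarrow>
      (\<And>x y. h (kappa V (rank_one V x y)) = (\<lambda>v. x \<star> (v \<star> y), \<lambda>v. (y \<star> v) \<star> x)) \<Longrightarrow> alpha V = h"
proof -
  let ?S = "RDirProd (End_ring V) (End_ring V)"
  have S: "ring ?S" by (intro RDirProd_ring ring_End)
  let ?P = "\<lambda>h. h \<in> extensional (carrier (Cl V)) \<and> h \<in> ring_hom (Cl V) ?S \<and>
    (\<forall>l. h (cl_const V l) = (End_scale V (\<rho> l) id, End_scale V (\<rho> (\<rho> l)) id)) \<and>
    (\<forall>x y. h (kappa V (rank_one V x y)) = (\<lambda>v. x \<star> (v \<star> y), \<lambda>v. (y \<star> v) \<star> x))"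
  obtain h0 where h0: "h0 \<in> ring_hom (Cl V) ?S"
    "\<And>l. h0 (cl_const V l) = (End_scale V (\<rho> l) id, End_scale V (\<rho> (\<rho> l)) id)"
    "\<And>a. a \<in> End V \<Longrightarrow> h0 (kappa V a) = (alpha1 a, alpha2 a)"
  proof (rule Cl_hom_exists[OF S, of "\<lambda>l. (End_scale V (\<rho> l) id, End_scale V (\<rho> (\<rho> l)) id)"
        "\<lambda>a. (alpha1 a, alpha2 a)"])
    show "(alpha1 (rank_one V x x), alpha2 (rank_one V x x))
        = (End_scale V (\<rho> (\<q> x)) id, End_scale V (\<rho> (\<rho> (\<q> x))) id)" for x
      by (simp add: alpha12_rank_one star_right_left star_left_right End_scale_def)
  qed (auto simp: scalar_End[unfolded End_scale_def id_apply] alpha12_End alpha12_add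
      alpha12_scale[unfolded End_scale_def] alpha12_rank_one fun_eq_iff
      star_right_left star_left_right star_scale_left star_scale_right
      End_scale_def M.scale_left_distrib End_scale_apply[OF alpha12_End(1)]
      End_scale_apply[OF alpha12_End(2)])
  let ?h = "restrict h0 (carrier (Cl V))"
  interpret Cl: ring "Cl V" by (rule ring_Cl)
  have ex: "?P ?h"
    using h0 Cl.ring_hom_restrict[OF h0(1), of ?h] by (simp add: rank_one_End alpha12_rank_one)
  have unique: "h = h'" if "?P h" "?P h'" for h h'
  proof (rule extensionalityI)
    show "h \<in> extensional (carrier (Cl V))" "h' \<in> extensional (carrier (Cl V))" using that by blast+
    fix x assume x: "x \<in> carrier (Cl V)"
    show "h x = h' x"
    proof (rule Cl_hom_unique_rank_one[OF S _ _ _ _ x])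
      show "h \<in> ring_hom (Cl V) ?S" "h' \<in> ring_hom (Cl V) ?S" using that by blast+
      show "h (cl_const V l) = h' (cl_const V l)" for l using that by metis
      show "h (kappa V (rank_one V x y)) = h' (kappa V (rank_one V x y))" for x y using that by metis
    qed
  qed
  have "?P (alpha V)"
    unfolding alpha_def by (rule theI[of ?P, OF ex]) (rule unique[OF _ ex])
  then show "alpha V \<in> ring_hom (Cl V) ?S"
    "alpha V (cl_const V l) = (End_scale V (\<rho> l) id, End_scale V (\<rho> (\<rho> l)) id)"
    "alpha V (kappa V (rank_one V x y)) = (\<lambda>v. x \<star> (v \<star> y), \<lambda>v. (y \<star> v) \<star> x)"
    by blast+
  show "alpha V = h" if "h \<in> extensional (carrier (Cl V))"
      "h \<in> ring_hom (Cl V) (RDirProd (End_ring V) (End_ring V))"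
      "\<And>l. h (cl_const V l) = (End_scale V (\<rho> l) id, End_scale V (\<rho> (\<rho> l)) id)"
      "\<And>x y. h (kappa V (rank_one V x y)) = (\<lambda>v. x \<star> (v \<star> y), \<lambda>v. (y \<star> v) \<star> x)" for h
    by (rule unique[OF \<open>?P (alpha V)\<close>]) (use that in blast)
qed

section \<open>Rigidity: products with proportional triple products are themselves
  proportional\<close>

lemma scale_two: "2 \<cdot> x = x + x"
  using M.scale_left_distrib[of 1 1 x] by simp

lemma scalar_faithful:
  assumes "\<And>v. l \<cdot> v = m \<cdot> v"
  shows "l = m"
proof -
  obtain e where e: "e \<in> basis" using basis(2) by fastforce
  have "\<beta> (dual e) (l \<cdot> e) = \<beta> (dual e) (m \<cdot> e)" using assms by simp
  then show ?thesis using beta_dual_basis[OF e] by (simp add: beta_scale_right)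
qed

text \<open>A Clifford algebra computation: \<open>dual d\<close> is moved leftwards past
  \<open>p\<close> and \<open>u\<close>, each move costing a polar term that collapses by
  \<open>basis_expand\<close>, until \<open>d\<close> and \<open>dual d\<close> enclose
  \<open>v\<close> alone. The coefficient 2 is 4 - 1 - 1, with 4 from
  \<open>sum_left_right\<close>.\<close>

lemma casimir_grade_two:
  "(\<Sum>d\<in>basis. (p \<star> ((d \<star> v) \<star> u)) \<star> dual d) = \<rho> (\<rho> (\<beta> p u)) \<cdot> v + 2 \<cdot> ((u \<star> v) \<star> p)"
proof -
  have summand: "(p \<star> ((d \<star> v) \<star> u)) \<star> dual d = ((\<beta> (dual d) p \<cdot> d) \<star> v) \<star> u
      - ((\<beta> (dual d) u \<cdot> d) \<star> v) \<star> p + (u \<star> ((d \<star> v) \<star> dual d)) \<star> p" for d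
  proof -
    have "(p \<star> ((d \<star> v) \<star> u)) \<star> dual d
        = \<rho> (\<rho> (\<beta> (dual d) p)) \<cdot> ((d \<star> v) \<star> u) - (dual d \<star> ((d \<star> v) \<star> u)) \<star> p"
      using star_left_right_polar[of p "(d \<star> v) \<star> u" "dual d"]
      by (simp add: beta_sym algebra_simps)
    also have "dual d \<star> ((d \<star> v) \<star> u) = \<rho> (\<beta> (dual d) u) \<cdot> (d \<star> v) - u \<star> ((d \<star> v) \<star> dual d)"
      using star_right_left_polar[of "dual d" "d \<star> v" u] by (simp add: algebra_simps)
    finally show ?thesis by (simp add: star_diff star_scale_left)
  qed
  have "(\<Sum>d\<in>basis. (p \<star> ((d \<star> v) \<star> u)) \<star> dual d) = (p \<star> v) \<star> u - (u \<star> v) \<star> p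
      + (u \<star> (4 \<cdot> v)) \<star> p"
    unfolding summand sum.distrib sum_subtractf
    by (simp only: basis_expand sum_left_right flip: star_sum)
  also have "(p \<star> v) \<star> u = \<rho> (\<rho> (\<beta> p u)) \<cdot> v - (u \<star> v) \<star> p"
    using star_left_right_polar[of p v u] by (simp add: algebra_simps)
  also have "(u \<star> (4 \<cdot> v)) \<star> p = 2 \<cdot> (2 \<cdot> ((u \<star> v) \<star> p))"
    by (simp add: star_scale_right star_scale_left)
  finally show ?thesis by (simp add: scale_two)
qed

text \<open>
  Rank 8 enters through \<open>\<Sum> e \<star> (v \<star> e\<^sup>*) = 4 v\<close>.  Let \<open>K v = \<Sum> (S e\<^sup>* \<star> v) \<star> e\<close>.  Evaluating
  \<open>\<Sum> T (d \<star> v) \<star> d\<^sup>*\<close> in two ways, once with \<open>4 T v = \<Sum> e \<star> (v \<star> S e\<^sup>*)\<close> inserted, shows that \<open>K\<close>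
  is a scalar.  Computing \<open>K (v \<star> x)\<close> then gives \<open>2 S' + 6 S = tr S\<close> for the adjoint \<open>S'\<close> of \<open>S\<close>, and
  comparing with the adjoint equation yields \<open>S = S'\<close>.  (In rank 4 one only gets \<open>2 S' + 2 S = tr S\<close>
  here, and the statement fails.)
\<close>

lemma related_imp_scalar:
  assumes S: "S \<in> End V" and T: "T \<in> End V" and related: "\<And>x y. T x \<star> y = x \<star> S y"
  obtains t where "\<And>x. S x = t \<cdot> x"
proof -
  define tr where "tr = (\<Sum>e\<in>basis. \<beta> e (S (dual e)))"
  define K where "K v = (\<Sum>e\<in>basis. (S (dual e) \<star> v) \<star> e)" for v
  \<comment> \<open>The adjoint of \<open>S\<close>, written in the basis because this is the form
    in which it arises from \<open>K\<close>.\<close>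
  define S' where "S' x = (\<Sum>e\<in>basis. \<beta> (S (dual e)) x \<cdot> e)" for x
  have T4: "4 \<cdot> T v = (\<Sum>e\<in>basis. e \<star> (v \<star> S (dual e)))" for v
    using sum_right_left[of "T v"] by (simp add: related)
  have K: "\<rho> (\<rho> tr) \<cdot> v = 2 \<cdot> K v" for v
  proof (rule three_cancel)
    define A where "A = (\<Sum>d\<in>basis. T (d \<star> v) \<star> dual d)"
    have A1: "A = \<rho> (\<rho> tr) \<cdot> v - K v"
    proof -
      have "T (d \<star> v) \<star> dual d = \<rho> (\<rho> (\<beta> d (S (dual d)))) \<cdot> v - (S (dual d) \<star> v) \<star> d" for d
        using star_left_right_polar[of d v "S (dual d)"] by (simp add: related algebra_simps)
      then show ?thesis
        by (simp add: A_def tr_def K_def sum_subtractf M.scale_sum_left)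
    qed
    have "4 \<cdot> A = (\<Sum>d\<in>basis. (4 \<cdot> T (d \<star> v)) \<star> dual d)"
      by (simp add: A_def M.scale_sum_right star_scale_left)
    also have "\<dots> = (\<Sum>d\<in>basis. \<Sum>e\<in>basis. (e \<star> ((d \<star> v) \<star> S (dual e))) \<star> dual d)"
      by (simp add: T4 star_sum)
    also have "\<dots> = (\<Sum>e\<in>basis. \<Sum>d\<in>basis. (e \<star> ((d \<star> v) \<star> S (dual e))) \<star> dual d)"
      by (rule sum.swap)
    also have "\<dots> = \<rho> (\<rho> tr) \<cdot> v + 2 \<cdot> K v"
      by (simp add: casimir_grade_two sum.distrib tr_def K_def M.scale_sum_left M.scale_sum_right)
    \<comment> \<open>With \<open>A1\<close>, this leaves three times the trace term on one side and
      \<open>6 \<cdot> K v\<close> on the other; cancelling 3 uses that the characteristic is not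
      3.\<close>
    finally have A2: "4 \<cdot> (\<rho> (\<rho> tr) \<cdot> v - K v) = \<rho> (\<rho> tr) \<cdot> v + 2 \<cdot> K v" by (simp add: A1)
    have n3: "3 \<cdot> x = x + x + x" and n4: "4 \<cdot> x = x + x + x + x" for x
      using M.scale_left_distrib[of 2 1 x] M.scale_left_distrib[of 3 1 x] by (simp_all add: scale_two)
    show "3 \<cdot> (\<rho> (\<rho> tr) \<cdot> v) = 3 \<cdot> (2 \<cdot> K v)"
      using A2 unfolding n3 n4 scale_two by (simp add: algebra_simps del: M.scale_scale)
  qed
  have K_star: "K (v \<star> x) = v \<star> S' x + 3 \<cdot> (v \<star> S x)" for v x
  proof -
    have summand: "(S (dual e) \<star> (v \<star> x)) \<star> e = v \<star> (\<beta> (S (dual e)) x \<cdot> e)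
        - v \<star> S (\<beta> e x \<cdot> dual e) + (e \<star> (v \<star> S (dual e))) \<star> x" for e
    proof -
      have "S (dual e) \<star> (v \<star> x) = \<rho> (\<beta> (S (dual e)) x) \<cdot> v - x \<star> (v \<star> S (dual e))"
        using star_right_left_polar[of "S (dual e)" v x] by (simp add: algebra_simps)
      moreover have "(x \<star> (v \<star> S (dual e))) \<star> e
          = \<rho> (\<rho> (\<beta> e x)) \<cdot> (v \<star> S (dual e)) - (e \<star> (v \<star> S (dual e))) \<star> x"
        using star_left_right_polar[of x "v \<star> S (dual e)" e] by (simp add: beta_sym algebra_simps)
      ultimately show ?thesis
        by (simp add: star_diff star_scale_left star_scale_right End_scale_apply[OF S])
    qed
    have "K (v \<star> x) = v \<star> S' x - v \<star> S x + (4 \<cdot> T v) \<star> x"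
      unfolding K_def summand sum.distrib sum_subtractf S'_def
      by (simp only: dual_expand T4 star_sum(1) flip: star_sum(2) End_sum[OF S])
    also have "(4 \<cdot> T v) \<star> x = v \<star> S x + 3 \<cdot> (v \<star> S x)"
      using M.scale_left_distrib[of 1 3 "v \<star> S x"] by (simp add: star_scale_left related)
    finally show ?thesis by simp
  qed
  have eq: "tr \<cdot> x = 2 \<cdot> S' x + 6 \<cdot> S x" for x
  proof (rule star_left_inj)
    fix v
    have "v \<star> (tr \<cdot> x) = 2 \<cdot> K (v \<star> x)" by (simp add: star_scale_right K)
    then show "v \<star> (tr \<cdot> x) = v \<star> (2 \<cdot> S' x + 6 \<cdot> S x)"
      by (simp add: K_star M.scale_right_distrib star_add_right star_scale_right)
  qed
  have S': "\<beta> (S' x) z = \<beta> (S z) x" for x z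
  proof -
    have "\<beta> (S' x) z = \<beta> (S (\<Sum>e\<in>basis. \<beta> e z \<cdot> dual e)) x"
      by (simp add: S'_def End_sum[OF S] End_scale_apply[OF S] beta_sum beta_scale_left mult.commute)
    then show ?thesis by (simp add: dual_expand)
  qed
  have b: "tr * \<beta> x z = 2 * \<beta> (S z) x + 6 * \<beta> (S x) z" for x z
    using arg_cong[OF eq[of x], of "\<lambda>y. \<beta> y z"] by (simp add: beta_add_left beta_scale_left S')
  have sym: "\<beta> (S z) x = \<beta> (S x) z" for x z
  proof -
    \<comment> \<open>Exchanging \<open>x\<close> and \<open>z\<close> in \<open>b\<close> fixes its
      left side and swaps the coefficients 2 and 6; the difference is 4 times the asymmetry of
      \<open>S\<close>.\<close>
    have "2 * (2 * \<beta> (S z) x) = 2 * (2 * \<beta> (S x) z)"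
      using b[of x z] b[of z x] by (simp add: beta_sym[of z x] algebra_simps)
    then show ?thesis using ring_two_cancel by blast
  qed
  let ?u = "incl V (1 / 2)"
  show ?thesis
  \<comment> \<open>As \<open>S\<close> is self-adjoint, \<open>eq\<close> reads
    \<open>tr \<cdot> x = 8 \<cdot> S x\<close>, so the scalar is one eighth of the trace.\<close>
  proof (rule that[of "?u * ?u * ?u * tr"], rule beta_nondeg)
    fix x z
    have "2 * (2 * (2 * \<beta> (S x) z)) = tr * \<beta> x z" using b[of x z] sym[of z x] by simp
    also have "\<dots> = (2 * ?u) * (2 * ?u) * (2 * ?u) * (tr * \<beta> x z)" by (simp add: two_inverse)
    also have "\<dots> = 2 * (2 * (2 * \<beta> ((?u * ?u * ?u * tr) \<cdot> x) z))"
      by (simp only: beta_scale_left mult.assoc mult.left_commute)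
    finally show "\<beta> (S x) z = \<beta> ((?u * ?u * ?u * tr) \<cdot> x) z" using ring_two_cancel by blast
  qed
qed

text \<open>The triple product identities and the Casimir sums show that the new product is the old
  one with a linear map \<open>S\<close> applied to the right factor, and also with a linear map
  \<open>T\<close> applied to the left factor. Then \<open>T x \<star> y = x \<star> S y\<close>,
  which makes \<open>S\<close> scalar by \<open>related_imp_scalar\<close>.\<close>

lemma products_scalar_multiple:
  fixes circ :: "'v \<Rightarrow> 'v \<Rightarrow> 'v" (infixl \<open>\<odot>\<close> 70)
  assumes add: "\<And>x y z. (x + y) \<odot> z = x \<odot> z + y \<odot> z" "\<And>x y z. x \<odot> (y + z) = x \<odot> y + x \<odot> z"
    and scale: "\<And>l x y. (l \<cdot> x) \<odot> y = \<rho> l \<cdot> (x \<odot> y)" "\<And>l x y. x \<odot> (l \<cdot> y) = \<rho> (\<rho> l) \<cdot> (x \<odot> y)"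
    and right: "\<And>x v y. x \<odot> (v \<odot> y) = \<rho> \<mu> \<cdot> (x \<star> (v \<star> y))"
    and left: "\<And>x v y. (y \<odot> v) \<odot> x = \<rho> (\<rho> \<mu>) \<cdot> ((y \<star> v) \<star> x)"
    and unit: "\<mu> * \<mu>' = 1"
  obtains \<nu> where "\<And>x y. x \<odot> y = \<nu> \<cdot> (x \<star> y)" "\<rho> \<mu> = \<nu> * \<rho> (\<rho> \<nu>)"
proof -
  have zero: "0 \<odot> x = 0" "x \<odot> 0 = 0" for x
    using add(1)[of 0 0] add(2)[of _ 0 0] by simp_all
  have sum: "sum g A \<odot> x = (\<Sum>a\<in>A. g a \<odot> x)" "x \<odot> sum g A = (\<Sum>a\<in>A. x \<odot> g a)" for g x and A :: "'v set"
    by (induction A rule: infinite_finite_induct) (simp_all add: zero add)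
  have cancel: "x = y" if "\<rho> \<mu> \<cdot> x = \<rho> \<mu> \<cdot> y" for x y
    using unit_cancel[of "\<rho> \<mu>'" "\<rho> \<mu>" x y] that arg_cong[OF unit, of \<rho>] by (simp add: mult.commute)
  have cancel': "x = y" if "\<rho> (\<rho> \<mu>) \<cdot> x = \<rho> (\<rho> \<mu>) \<cdot> y" for x y
    using unit_cancel[of "\<rho> (\<rho> \<mu>')" "\<rho> (\<rho> \<mu>)" x y] that arg_cong[OF unit, of "\<lambda>l. \<rho> (\<rho> l)"]
    by (simp add: mult.commute)
  let ?u = "incl V (1 / 2)"
  have quarter: "(?u * ?u) \<cdot> (4 \<cdot> x) = x" for x
  proof -
    have "?u * ?u * 4 = (2 * ?u) * (2 * ?u)" by simp
    then show ?thesis by (simp add: two_inverse)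
  qed
  \<comment> \<open>Up to the unit \<mu>, \<open>4 \<cdot> v\<close> is the sum of
    \<open>(dual e \<odot> v) \<odot> e\<close>. Multiplying by \<open>x\<close> on the left and
    applying \<open>right\<close> trades both outer products for the old ones, leaving
    \<open>x\<close> times this \<open>S v\<close>; \<open>T\<close> is the mirror image. The factor
    \<open>?u * ?u\<close> is one quarter.\<close>
  define S where "S v = (?u * ?u) \<cdot> (\<Sum>e\<in>basis. (dual e \<odot> v) \<star> e)" for v
  define T where "T v = (?u * ?u) \<cdot> (\<Sum>e\<in>basis. e \<star> (v \<odot> dual e))" for v
  have S: "S \<in> End V"
    by (rule EndI) (simp_all add: S_def add scale star_add_left star_scale_left sum.distrib
        M.scale_right_distrib M.scale_sum_right mult.commute)
  have T: "T \<in> End V"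
    by (rule EndI) (simp_all add: T_def add scale star_add_right star_scale_right sum.distrib
        M.scale_right_distrib M.scale_sum_right mult.commute)
  have xS: "x \<odot> v = x \<star> S v" for x v
  proof -
    have "\<rho> \<mu> \<cdot> (4 \<cdot> (x \<odot> v)) = x \<odot> (\<rho> (\<rho> \<mu>) \<cdot> (4 \<cdot> v))" by (simp add: scale mult.commute)
    also have "\<dots> = x \<odot> (\<Sum>e\<in>basis. (dual e \<odot> v) \<odot> e)"
      by (simp only: left sum_left_right' flip: M.scale_sum_right)
    also have "\<dots> = \<rho> \<mu> \<cdot> (x \<star> (\<Sum>e\<in>basis. (dual e \<odot> v) \<star> e))"
      unfolding sum star_sum M.scale_sum_right by (simp only: right)
    finally have "4 \<cdot> (x \<odot> v) = x \<star> (\<Sum>e\<in>basis. (dual e \<odot> v) \<star> e)" by (rule cancel)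
    then have "(?u * ?u) \<cdot> (4 \<cdot> (x \<odot> v)) = x \<star> S v" by (simp add: S_def star_scale_right)
    then show ?thesis by (simp only: quarter)
  qed
  have xT: "v \<odot> x = T v \<star> x" for x v
  proof -
    have "\<rho> (\<rho> \<mu>) \<cdot> (4 \<cdot> (v \<odot> x)) = (\<rho> \<mu> \<cdot> (4 \<cdot> v)) \<odot> x" by (simp add: scale mult.commute)
    also have "\<dots> = (\<Sum>e\<in>basis. e \<odot> (v \<odot> dual e)) \<odot> x"
      by (simp only: right sum_right_left flip: M.scale_sum_right)
    also have "\<dots> = \<rho> (\<rho> \<mu>) \<cdot> ((\<Sum>e\<in>basis. e \<star> (v \<odot> dual e)) \<star> x)"
      unfolding sum star_sum M.scale_sum_right by (simp only: left)
    finally have "4 \<cdot> (v \<odot> x) = (\<Sum>e\<in>basis. e \<star> (v \<odot> dual e)) \<star> x" by (rule cancel')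
    then have "(?u * ?u) \<cdot> (4 \<cdot> (v \<odot> x)) = T v \<star> x" by (simp add: T_def star_scale_left)
    then show ?thesis by (simp only: quarter)
  qed
  obtain t where t: "\<And>x. S x = t \<cdot> x" using related_imp_scalar[OF S T] xS xT by metis
  \<comment> \<open>The scalar sits in the second factor, where the product is semilinear for the
    square of \<rho>.\<close>
  let ?l = "\<rho> (\<rho> t)"
  have circ: "x \<odot> y = ?l \<cdot> (x \<star> y)" for x y by (simp add: xS t star_scale_right)
  have "\<rho> \<mu> = ?l * \<rho> (\<rho> ?l)"
  \<comment> \<open>Both scalars are compared on triple products only; the Casimir sum of these is 4
    times an arbitrary vector, so the comparison is faithful.\<close>
  proof (rule scalar_faithful, rule four_cancel)
    fix v
    have "\<rho> \<mu> \<cdot> (e \<star> (v \<star> dual e)) = (?l * \<rho> (\<rho> ?l)) \<cdot> (e \<star> (v \<star> dual e))" for e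
      using right[of e v "dual e"] by (simp add: circ star_scale_right)
    then have "(\<Sum>e\<in>basis. \<rho> \<mu> \<cdot> (e \<star> (v \<star> dual e))) = (\<Sum>e\<in>basis. (?l * \<rho> (\<rho> ?l)) \<cdot> (e \<star> (v \<star> dual e)))"
      by simp
    then have "\<rho> \<mu> \<cdot> (4 \<cdot> v) = (?l * \<rho> (\<rho> ?l)) \<cdot> (4 \<cdot> v)"
      by (simp only: sum_right_left flip: M.scale_sum_right)
    then show "4 \<cdot> (\<rho> \<mu> \<cdot> v) = 4 \<cdot> ((?l * \<rho> (\<rho> ?l)) \<cdot> v)"
      by (simp add: mult.commute)
  qed
  with circ that show ?thesis by blast
qed

end

section \<open>Type III gradings\<close>

lemma vs_gradingD:
  assumes s: "Modules.module s" and G: "vs_grading s \<Gamma>"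
  shows vs_grading_zero: "0 \<in> \<Gamma> g"
    and vs_grading_add: "x \<in> \<Gamma> g \<Longrightarrow> y \<in> \<Gamma> g \<Longrightarrow> x + y \<in> \<Gamma> g"
    and vs_grading_scale: "x \<in> \<Gamma> g \<Longrightarrow> s c x \<in> \<Gamma> g"
    and vs_grading_diff: "x \<in> \<Gamma> g \<Longrightarrow> y \<in> \<Gamma> g \<Longrightarrow> x - y \<in> \<Gamma> g"
  using module.subspace_0[OF s] module.subspace_add[OF s] module.subspace_scale[OF s]
    module.subspace_diff[OF s] G unfolding vs_grading_def by blast+

lemma vs_grading_decompose:
  assumes "vs_grading s \<Gamma>"
  obtains A c where "finite A" "\<And>g. c g \<in> \<Gamma> g" "x = (\<Sum>g\<in>A. c g)" "\<And>g. g \<notin> A \<Longrightarrow> c g = 0"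
proof -
  obtain c where c: "finite {g. c g \<noteq> 0}" "\<And>g. c g \<in> \<Gamma> g" "x = (\<Sum>g | c g \<noteq> 0. c g)"
    using assms unfolding vs_grading_def by metis
  show ?thesis by (rule that[OF c]) simp
qed

text \<open>A decomposition of a homogeneous element is compared with the one concentrated in its
  own degree; uniqueness forces them to agree.\<close>

lemma vs_grading_component:
  assumes s: "Modules.module s" and G: "vs_grading s \<Gamma>"
    and A: "finite A" "\<And>g. g \<in> A \<Longrightarrow> c g \<in> \<Gamma> g" and x: "x = (\<Sum>g\<in>A. c g)" "x \<in> \<Gamma> k"
  shows "x = (if k \<in> A then c k else 0)"
proof -
  define c1 where "c1 g = (if g \<in> A then c g else 0)" for g
  define c2 where "c2 g = (if g = k then x else 0)" for g
  have "\<exists>!c. finite {g. c g \<noteq> 0} \<and> (\<forall>g. c g \<in> \<Gamma> g) \<and> x = (\<Sum>g | c g \<noteq> 0. c g)"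
    using G unfolding vs_grading_def by blast
  moreover have "finite {g. c1 g \<noteq> 0} \<and> (\<forall>g. c1 g \<in> \<Gamma> g) \<and> x = (\<Sum>g | c1 g \<noteq> 0. c1 g)"
  proof (intro conjI allI)
    have sub: "{g. c1 g \<noteq> 0} \<subseteq> A" by (auto simp: c1_def)
    then show "finite {g. c1 g \<noteq> 0}" using A(1) by (rule finite_subset)
    show "c1 g \<in> \<Gamma> g" for g using A vs_grading_zero[OF s G] by (simp add: c1_def)
    have "(\<Sum>g | c1 g \<noteq> 0. c1 g) = (\<Sum>g\<in>A. c1 g)"
      using sub A(1) by (intro sum.mono_neutral_left) auto
    then show "x = (\<Sum>g | c1 g \<noteq> 0. c1 g)" by (simp add: x c1_def)
  qed
  moreover have "finite {g. c2 g \<noteq> 0} \<and> (\<forall>g. c2 g \<in> \<Gamma> g) \<and> x = (\<Sum>g | c2 g \<noteq> 0. c2 g)"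
  proof (intro conjI allI)
    have sub: "{g. c2 g \<noteq> 0} \<subseteq> {k}" by (auto simp: c2_def)
    then show "finite {g. c2 g \<noteq> 0}" by (rule finite_subset) simp
    show "c2 g \<in> \<Gamma> g" for g using x vs_grading_zero[OF s G] by (simp add: c2_def)
    have "(\<Sum>g | c2 g \<noteq> 0. c2 g) = (\<Sum>g\<in>{k}. c2 g)"
      using sub by (intro sum.mono_neutral_left) auto
    then show "x = (\<Sum>g | c2 g \<noteq> 0. c2 g)" by (simp add: c2_def)
  qed
  ultimately have "c1 = c2" by blast
  then have "c1 k = c2 k" by simp
  then show ?thesis by (simp add: c1_def c2_def)
qed

locale graded_cyclic_composition = cyclic_composition_rank8 V
  for V :: "('f::field, 'l::comm_ring_1, 'v::ab_group_add) cyc" +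
  fixes \<Gamma>V :: "'g::ab_group_add \<Rightarrow> 'v set" and \<Gamma>L :: "'g \<Rightarrow> 'l set"
  assumes type_III: "type_III V \<Gamma>V \<Gamma>L"
begin

lemma cyc_grading: "cyc_grading V \<Gamma>V \<Gamma>L"
  using type_III by (simp add: type_III_def)

lemma grading_V: "vs_grading (\<lambda>c. scl V (incl V c)) \<Gamma>V"
  and grading_L: "vs_grading (\<lambda>c l. incl V c * l) \<Gamma>L"
  and star_graded: "x \<in> \<Gamma>V a \<Longrightarrow> y \<in> \<Gamma>V b \<Longrightarrow> x \<star> y \<in> \<Gamma>V (a + b)"
  and mult_graded: "l \<in> \<Gamma>L a \<Longrightarrow> m \<in> \<Gamma>L b \<Longrightarrow> l * m \<in> \<Gamma>L (a + b)"
  and rho_graded: "l \<in> \<Gamma>L a \<Longrightarrow> \<rho> l \<in> \<Gamma>L a"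
  and scale_graded: "l \<in> \<Gamma>L a \<Longrightarrow> x \<in> \<Gamma>V b \<Longrightarrow> l \<cdot> x \<in> \<Gamma>V (a + b)"
  and beta_graded: "x \<in> \<Gamma>V a \<Longrightarrow> y \<in> \<Gamma>V b \<Longrightarrow> \<beta> x y \<in> \<Gamma>L (a + b)"
  using cyc_grading unfolding cyc_grading_def by blast+

lemma module_FV: "Modules.module (\<lambda>c. scl V (incl V c))"
  by unfold_locales
    (simp_all add: is_ring_homD[OF incl_hom] M.scale_right_distrib M.scale_left_distrib)

lemma module_FL: "Modules.module (\<lambda>c l. incl V c * l)"
  by unfold_locales (simp_all add: is_ring_homD[OF incl_hom] algebra_simps)

lemmas GL_simps = vs_gradingD[OF module_FL grading_L]
lemmas GL_component = vs_grading_component[OF module_FL grading_L]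

lemma L_nonzero: "(1::'l) \<noteq> 0"
proof
  assume "(1::'l) = 0"
  then have "x = 0" for x :: 'v by (metis M.scale_one M.scale_zero_left)
  then have "basis \<subseteq> {0}" by auto
  then have "card basis \<le> 1" by (metis card.empty card_insert_disjoint card_mono finite.emptyI
        finite_insert One_nat_def empty_iff)
  then show False using basis(2) by simp
qed

text \<open>The degree zero component of 1 acts as the identity on every homogeneous element, by
  comparing degrees in \<open>1 * l\<close>. Applied to the components of 1 itself, this shows that
  it equals 1.\<close>

lemma one_graded: "1 \<in> \<Gamma>L 0"
proof -
  obtain A c where c: "finite A" "\<And>g. c g \<in> \<Gamma>L g" "1 = (\<Sum>g\<in>A. c g)" "\<And>g. g \<notin> A \<Longrightarrow> c g = 0"
    using vs_grading_decompose[OF grading_L, of 1] by metis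
  have hom: "c 0 * l = l" if l: "l \<in> \<Gamma>L a" for a l
  proof -
    have "l = (\<Sum>g\<in>A. c g) * l" using c(3) by simp
    also have "\<dots> = (\<Sum>g\<in>A. c g * l)" by (rule sum_distrib_right)
    \<comment> \<open>Reindexed by the degree of the product, as the uniqueness of components
      requires.\<close>
    also have "\<dots> = (\<Sum>k\<in>(\<lambda>g. g + a) ` A. c (k - a) * l)"
      by (subst sum.reindex) (auto simp: inj_on_def)
    finally have "l = (if a \<in> (\<lambda>g. g + a) ` A then c (a - a) * l else 0)"
      using c(1) mult_graded[OF c(2) l] by (intro GL_component[OF _ _ _ l]) auto
    then show ?thesis using c(4)[of 0] by (auto split: if_splits)
  qed
  have "c 0 * 1 = (\<Sum>g\<in>A. c 0 * c g)" by (subst c(3)) (rule sum_distrib_left)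
  also have "\<dots> = 1" by (simp add: hom[OF c(2)] flip: c(3))
  finally show ?thesis using c(2)[of 0] by simp
qed

lemma type_III_degrees:
  obtains h where "h \<noteq> 0" "h + h + h = 0"
    "\<And>g. g \<in> {0, h, h + h} \<Longrightarrow> \<exists>u. u \<noteq> 0 \<and> \<Gamma>L g = range (\<lambda>c. incl V c * u)"
    "\<And>g. g \<notin> {0, h, h + h} \<Longrightarrow> \<Gamma>L g = {0}"
  using type_III unfolding type_III_def by blast

text \<open>The component of degree zero is a line that contains 1.\<close>

lemma GL_zero: "\<Gamma>L 0 = range (incl V)"
proof -
  obtain u where u: "\<Gamma>L 0 = range (\<lambda>c. incl V c * u)" using type_III_degrees by (metis insertI1)
  then obtain d where d: "1 = incl V d * u" using one_graded by auto
  have "d \<noteq> 0" using d L_nonzero is_ring_homD(4)[OF incl_hom] by auto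
  then have "incl V (1 / d) * incl V d = 1"
    using is_ring_homD(2,3)[OF incl_hom] by (metis nonzero_divide_eq_eq)
  then have u': "u = incl V (1 / d)" using d by (metis mult.assoc mult.commute mult_1)
  have "incl V c = incl V (c * d) * u" "incl V c * u = incl V (c / d)" for c
    using u' \<open>d \<noteq> 0\<close> by (simp_all flip: is_ring_homD(2)[OF incl_hom])
  then have "x \<in> range (incl V) \<longleftrightarrow> x \<in> range (\<lambda>c. incl V c * u)" for x
    by (metis (no_types, lifting) rangeE rangeI)
  then show ?thesis unfolding u by blast
qed

lemma incl_unit: "c \<noteq> 0 \<Longrightarrow> incl V (1 / c) * incl V c = 1"
  using is_ring_homD(2,3)[OF incl_hom] by (metis nonzero_divide_eq_eq)

text \<open>If the components of degrees \<open>h\<close> and \<open>2h\<close> annihilated each other, their sum would contain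
  all \<open>x (y - \<rho> y)\<close>; but by the Galois condition such products add up to 1.\<close>

lemma homogeneous_product_nonzero:
  assumes h: "h \<noteq> 0" "h + h + h = 0"
    and u: "\<Gamma>L h = range (\<lambda>c. incl V c * u)" and w: "\<Gamma>L (h + h) = range (\<lambda>c. incl V c * w)"
    and out: "\<And>g. g \<notin> {0, h, h + h} \<Longrightarrow> \<Gamma>L g = {0}"
  shows "u * w \<noteq> 0"
proof
  assume uw: "u * w = 0"
  have h2: "h + h \<noteq> 0" "h \<noteq> h + h" "h + h + h + h = h" using h by (auto simp: add.assoc)
  have prod0: "x * y = 0" if xy: "x \<in> \<Gamma>L h" "y \<in> \<Gamma>L (h + h)" for x y
  proof -
    obtain c d where "x = incl V c * u" "y = incl V d * w" using xy unfolding u w by auto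
    then have "x * y = incl V c * incl V d * (u * w)" by (simp add: ac_simps)
    then show ?thesis using uw by simp
  qed
  have decomp: "\<exists>x0\<in>\<Gamma>L 0. \<exists>x1\<in>\<Gamma>L h. \<exists>x2\<in>\<Gamma>L (h + h). x = x0 + x1 + x2" for x
  proof -
    obtain A c where c: "finite A" "\<And>g. c g \<in> \<Gamma>L g" "x = (\<Sum>g\<in>A. c g)" "\<And>g. g \<notin> A \<Longrightarrow> c g = 0"
      using vs_grading_decompose[OF grading_L, of x] by metis
    have "(\<Sum>g\<in>A. c g) = (\<Sum>g\<in>A \<union> {0, h, h + h}. c g)"
      using c(1,4) by (intro sum.mono_neutral_left) auto
    also have "\<dots> = (\<Sum>g\<in>{0, h, h + h}. c g)"
      using c(1) out c(2) by (intro sum.mono_neutral_right) auto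
    also have "\<dots> = c 0 + c h + c (h + h)" using h h2 by (simp add: add.assoc)
    finally show ?thesis using c by blast
  qed
  define N where "N = {x + y | x y. x \<in> \<Gamma>L h \<and> y \<in> \<Gamma>L (h + h)}"
  have N_add: "x + y \<in> N" if xy: "x \<in> N" "y \<in> N" for x y
  proof -
    obtain x1 x2 y1 y2 where "x = x1 + x2" "y = y1 + y2" "x1 \<in> \<Gamma>L h" "y1 \<in> \<Gamma>L h"
      "x2 \<in> \<Gamma>L (h + h)" "y2 \<in> \<Gamma>L (h + h)" using xy unfolding N_def by blast
    moreover from this have "x1 + x2 + (y1 + y2) = (x1 + y1) + (x2 + y2)" by (simp add: algebra_simps)
    ultimately show ?thesis unfolding N_def using GL_simps(2) by blast
  qed
  have N_zero: "0 \<in> N" unfolding N_def using GL_simps(1) by (metis (mono_tags, lifting) CollectI add_0)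
  have N_prod: "x * (y - \<rho> y) \<in> N" for x y
  proof -
    obtain x0 x1 x2 where x: "x0 \<in> \<Gamma>L 0" "x1 \<in> \<Gamma>L h" "x2 \<in> \<Gamma>L (h + h)" "x = x0 + x1 + x2"
      using decomp by blast
    obtain y0 y1 y2 where y: "y0 \<in> \<Gamma>L 0" "y1 \<in> \<Gamma>L h" "y2 \<in> \<Gamma>L (h + h)" "y = y0 + y1 + y2"
      using decomp by blast
    define z1 z2 where "z1 = y1 - \<rho> y1" and "z2 = y2 - \<rho> y2"
    have z: "z1 \<in> \<Gamma>L h" "z2 \<in> \<Gamma>L (h + h)"
      unfolding z1_def z2_def using y rho_graded GL_simps(4) by blast+
    \<comment> \<open>The degree zero part lies in \<open>F\<close> and is fixed, so
      \<open>y - \<rho> y\<close> has only parts of degrees \<open>h\<close> and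
      \<open>h + h\<close>; in its product with \<open>x\<close>, the terms of degree zero are those
      that vanish by assumption.\<close>
    have "\<rho> y0 = y0" using y(1) GL_zero rho_fixed by blast
    then have yz: "y - \<rho> y = z1 + z2" by (simp add: y(4) z1_def z2_def)
    have "x * (y - \<rho> y) = (x0 * z1 + x2 * z2) + (x0 * z2 + x1 * z1) + (x1 * z2 + z1 * x2)"
      unfolding yz x(4) by (simp add: algebra_simps)
    also have "\<dots> = (x0 * z1 + x2 * z2) + (x0 * z2 + x1 * z1)"
      using prod0[OF x(2) z(2)] prod0[OF z(1) x(3)] by simp
    finally have e: "x * (y - \<rho> y) = (x0 * z1 + x2 * z2) + (x0 * z2 + x1 * z1)" .
    have "x0 * z1 \<in> \<Gamma>L h" "x2 * z2 \<in> \<Gamma>L h" "x0 * z2 \<in> \<Gamma>L (h + h)" "x1 * z1 \<in> \<Gamma>L (h + h)"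
      using mult_graded[OF x(1) z(1)] mult_graded[OF x(3) z(2)] mult_graded[OF x(1) z(2)]
        mult_graded[OF x(2) z(1)] h2(3) by (simp_all add: add.assoc)
    then show ?thesis unfolding e N_def using GL_simps(2) by blast
  qed
  obtain n :: nat and x y where xy: "(\<Sum>i<n. x i * y i) = 1" "(\<Sum>i<n. x i * \<rho> (y i)) = 0"
    using galois unfolding cyclic_cubic_galois_def by blast
  have "(\<Sum>i<n. x i * (y i - \<rho> (y i))) \<in> N" for n :: nat
    by (induction n) (simp_all add: N_zero N_add N_prod)
  moreover have "(\<Sum>i<n. x i * (y i - \<rho> (y i))) = 1"
    using xy by (simp add: right_diff_distrib sum_subtractf)
  ultimately have "1 \<in> N" by metis
  then obtain a b where ab: "1 = a + b" "a \<in> \<Gamma>L h" "b \<in> \<Gamma>L (h + h)" unfolding N_def by auto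
  have "1 = (if 0 \<in> {h, h + h} then if 0 = h then a else b else 0)"
    by (rule GL_component[where c = "\<lambda>g. if g = h then a else b", OF _ _ _ one_graded])
      (use ab h2 in auto)
  then show False using h h2 L_nonzero by auto
qed

section \<open>Homogeneous scalars as units, and homogeneous dual vectors\<close>

lemma generator_mem: "u \<in> range (\<lambda>c. incl V c * u)"
  by (rule range_eqI[of _ _ 1]) (simp add: is_ring_homD[OF incl_hom])

text \<open>Components are lines, and generators of opposite degrees have a nonzero product by
  \<open>homogeneous_product_nonzero\<close>. So \<open>l\<close> times a generator of the opposite
  degree is a nonzero element of degree zero, that is, a nonzero element of the field
  \<open>F\<close>.\<close>

lemma homogeneous_unit:
  assumes l: "l \<in> \<Gamma>L g" "l \<noteq> 0"
  obtains m where "m \<in> \<Gamma>L (- g)" "l * m = 1"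
proof -
  obtain h where h: "h \<noteq> 0" "h + h + h = 0"
    "\<And>g. g \<in> {0, h, h + h} \<Longrightarrow> \<exists>u. u \<noteq> 0 \<and> \<Gamma>L g = range (\<lambda>c. incl V c * u)"
    "\<And>g. g \<notin> {0, h, h + h} \<Longrightarrow> \<Gamma>L g = {0}"
    using type_III_degrees by metis
  obtain u where u: "\<Gamma>L h = range (\<lambda>c. incl V c * u)" using h(3) by blast
  obtain w where w: "\<Gamma>L (h + h) = range (\<lambda>c. incl V c * w)" using h(3) by blast
  have uw: "u * w \<noteq> 0" using homogeneous_product_nonzero h(1,2,4) u w by blast
  have mem: "u \<in> \<Gamma>L h" "w \<in> \<Gamma>L (h + h)"
    unfolding u w by (rule generator_mem)+
  have neg: "- h = h + h" "- (h + h) = h" using h(2) by (auto simp: minus_unique add.assoc)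
  have step: thesis if gp: "\<Gamma>L g = range (\<lambda>c. incl V c * p)" and q: "q \<in> \<Gamma>L (- g)" "p * q \<noteq> 0" for p q
  proof -
    obtain c where c: "l = incl V c * p" using l unfolding gp by auto
    have p: "p \<in> \<Gamma>L g" unfolding gp by (rule generator_mem)
    have "c \<noteq> 0" using c l(2) is_ring_homD(4)[OF incl_hom] by auto
    have lq: "l * q = incl V c * (p * q)" using c by (simp add: mult.assoc)
    have "l * q \<noteq> 0"
    proof
      assume "l * q = 0"
      then have "incl V (1 / c) * incl V c * (p * q) = 0" using lq by (simp add: mult.assoc)
      then show False using incl_unit[OF \<open>c \<noteq> 0\<close>] q(2) by simp
    qed
    moreover have "l * q \<in> \<Gamma>L 0" using mult_graded[OF l(1) q(1)] by simp
    ultimately obtain t where t1: "l * q = incl V t" and "incl V t \<noteq> 0"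
      using GL_zero by auto
    then have t2: "t \<noteq> 0" using is_ring_homD(4)[OF incl_hom] by auto
    show thesis
    proof (rule \<open>\<And>m. m \<in> \<Gamma>L (- g) \<Longrightarrow> l * m = 1 \<Longrightarrow> thesis\<close>)
      show "incl V (1 / t) * q \<in> \<Gamma>L (- g)" using GL_simps(3)[OF q(1)] .
      show "l * (incl V (1 / t) * q) = 1" using t1 incl_unit[OF t2] by (metis mult.left_commute)
    qed
  qed
  have "g \<in> {0, h, h + h}" using l h(4) by blast
  then consider "g = 0" | "g = h" | "g = h + h" by blast
  then show thesis
  proof cases
    case 1
    show thesis
      by (rule step[of 1 1]) (use 1 GL_zero one_graded L_nonzero in auto)
  next
    case 2
    then show thesis using step[of u w] u mem uw neg by simp
  next
    case 3
    have "u \<in> \<Gamma>L (- g)" using mem(1) neg(2) 3 by metis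
    moreover have "\<Gamma>L g = range (\<lambda>c. incl V c * w)" using w 3 by metis
    ultimately show thesis using step uw by (metis mult.commute)
  qed
qed

text \<open>\<rho> preserves the line through \<open>l\<close>, so \<open>\<rho> l = c * l\<close>
  with \<open>c\<close> in \<open>F\<close>. Applying \<rho> three times gives
  \<open>c * c * c * l = l\<close>, which removes \<open>c\<close> from the product. Thus the norm
  of \<open>l\<close> is its cube.\<close>

lemma homogeneous_norm:
  assumes l: "l \<in> \<Gamma>L g"
  shows "\<rho> l * \<rho> (\<rho> l) = l * l"
proof (cases "l = 0")
  case False
  obtain h where h: "\<And>g. g \<in> {0, h, h + h} \<Longrightarrow> \<exists>u. u \<noteq> 0 \<and> \<Gamma>L g = range (\<lambda>c. incl V c * u)"
    "\<And>g. g \<notin> {0, h, h + h} \<Longrightarrow> \<Gamma>L g = {0}"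
    using type_III_degrees by metis
  have "g \<in> {0, h, h + h}" using l False h(2) by blast
  then obtain u where u: "\<Gamma>L g = range (\<lambda>c. incl V c * u)" using h(1) by blast
  obtain a where a: "l = incl V a * u" using l u by auto
  obtain b where b: "\<rho> l = incl V b * u" using rho_graded[OF l] u by auto
  have "a \<noteq> 0" using a False is_ring_homD(4)[OF incl_hom] by auto
  define c where "c = incl V (b / a)"
  have "c * incl V a = incl V b"
    using \<open>a \<noteq> 0\<close> by (simp add: c_def flip: is_ring_homD(2)[OF incl_hom])
  then have c: "\<rho> l = c * l" "\<rho> c = c"
    unfolding b by (simp_all add: a c_def flip: mult.assoc)
  have "c * c * c * l = l" using rho3[of l] by (simp add: c mult.assoc)
  then show ?thesis by (simp add: c) (metis mult.assoc mult.commute)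
qed simp

text \<open>Some homogeneous component of a vector pairing nontrivially with \<open>x\<close>
  already pairs nontrivially; that value is homogeneous, hence a unit, and can be divided
  out.\<close>

lemma homogeneous_dual:
  assumes x: "x \<in> \<Gamma>V k" "x \<noteq> 0"
  obtains y where "y \<in> \<Gamma>V (- k)" "\<beta> x y = 1"
proof -
  obtain z where z: "\<beta> x z \<noteq> 0" using beta_nondeg[of x 0] x(2) by auto
  obtain A c where c: "\<And>g. c g \<in> \<Gamma>V g" "z = (\<Sum>g\<in>A. c g)"
    using vs_grading_decompose[OF grading_V, of z] by metis
  obtain g where g: "\<beta> x (c g) \<noteq> 0" using z by (auto simp: c(2) beta_sum intro: sum.neutral)
  obtain m where m: "m \<in> \<Gamma>L (- (k + g))" "\<beta> x (c g) * m = 1"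
    using homogeneous_unit[OF beta_graded[OF x(1) c(1)] g] by blast
  show ?thesis
  proof
    show "m \<cdot> c g \<in> \<Gamma>V (- k)" using scale_graded[OF m(1) c(1)[of g]] by simp
    show "\<beta> x (m \<cdot> c g) = 1" using m(2) by (simp add: beta_scale_right mult.commute)
  qed
qed

lemma homogeneous_nonzero:
  obtains k x where "x \<in> \<Gamma>V k" "x \<noteq> 0"
proof (rule ccontr)
  assume "\<not> thesis"
  then have zero: "x = 0" if "x \<in> \<Gamma>V k" for x k using that \<open>\<And>x k. x \<in> \<Gamma>V k \<Longrightarrow> x \<noteq> 0 \<Longrightarrow> thesis\<close> by blast
  have "z = 0" for z :: 'v
  proof -
    obtain A c where c: "\<And>g. c g \<in> \<Gamma>V g" "z = (\<Sum>g\<in>A. c g)"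
      using vs_grading_decompose[OF grading_V, of z] by metis
    then show ?thesis using zero[OF c(1)] by simp
  qed
  then have "(0::'l) = 1" using scalar_faithful[of 0 1] by (metis)
  then show False using L_nonzero by simp
qed

section \<open>Degrees of operators and of homotheties\<close>

lemma End_grading_iff:
  "a \<in> End_grading V \<Gamma>V g \<longleftrightarrow> a \<in> End V \<and> (\<forall>k. \<forall>x\<in>\<Gamma>V k. a x \<in> \<Gamma>V (g + k))"
  by (auto simp: End_grading_def)

lemma rank_one_graded:
  assumes "x \<in> \<Gamma>V a" "y \<in> \<Gamma>V b"
  shows "rank_one V x y \<in> End_grading V \<Gamma>V (a + b)"
  unfolding End_grading_iff
proof (intro conjI ballI allI rank_one_End)
  fix k z assume "z \<in> \<Gamma>V k"
  from scale_graded[OF beta_graded[OF assms(2) this] assms(1)]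
  show "rank_one V x y z \<in> \<Gamma>V (a + b + k)" by (simp add: rank_one_def ac_simps)
qed

text \<open>Pairing \<open>l \<cdot> x\<close> with a homogeneous dual of \<open>x\<close> reads off
  \<open>l\<close> with its degree. The grading of \<open>E\<close> therefore determines that of its
  centre, and a graded isomorphism of \<open>E\<close> automatically preserves degrees of
  scalars.\<close>

lemma scalar_graded_iff: "End_scale V l id \<in> End_grading V \<Gamma>V g \<longleftrightarrow> l \<in> \<Gamma>L g"
proof
  assume l: "l \<in> \<Gamma>L g"
  show "End_scale V l id \<in> End_grading V \<Gamma>V g"
    unfolding End_grading_iff using scalar_End scale_graded[OF l] by (auto simp: End_scale_def)
next
  assume *: "End_scale V l id \<in> End_grading V \<Gamma>V g"
  obtain k x where x: "x \<in> \<Gamma>V k" "x \<noteq> 0" by (rule homogeneous_nonzero)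
  obtain y where y: "y \<in> \<Gamma>V (- k)" "\<beta> x y = 1" using homogeneous_dual[OF x] .
  have "l \<cdot> x \<in> \<Gamma>V (g + k)" using * x by (auto simp: End_grading_iff End_scale_def)
  from beta_graded[OF this y(1)] show "l \<in> \<Gamma>L g" by (simp add: beta_scale_left y)
qed

end

section \<open>Semilinear similitudes\<close>

text \<open>Covers two situations: isomorphisms of composition algebras, with \<mu> = \<mu>' = 1,
  and the semilinear maps produced by Skolem--Noether, where only the involution is known to be
  preserved and a unit multiplier \<mu> remains.\<close>

locale similitude = V: cyclic_composition_rank8 V + V': cyclic_composition_rank8 V'
  for V :: "('f::field, 'l::comm_ring_1, 'v::ab_group_add) cyc"
    and V' :: "('f, 'm::comm_ring_1, 'w::ab_group_add) cyc" +
  fixes \<phi>1 :: "'v \<Rightarrow> 'w" and \<phi>0 :: "'l \<Rightarrow> 'm" and \<mu> \<mu>' :: 'l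
  assumes bij0: "bij \<phi>0" and hom0: "is_ring_hom \<phi>0" and incl0: "\<phi>0 (incl V c) = incl V' c"
    and bij1: "bij \<phi>1" and add1: "\<phi>1 (x + y) = \<phi>1 x + \<phi>1 y"
    and scale1: "\<phi>1 (scl V l x) = scl V' (\<phi>0 l) (\<phi>1 x)"
    and unit: "\<mu> * \<mu>' = 1"
    and multiplier: "qf V' (\<phi>1 x) = \<phi>0 (\<mu> * qf V x)"
begin

lemmas hom0_simps = is_ring_homD[OF hom0]

lemma polar_multiplier: "polar V' (\<phi>1 x) (\<phi>1 y) = \<phi>0 (\<mu> * polar V x y)"
  by (simp add: polar_def multiplier hom0_simps right_diff_distrib flip: add1)

lemma surj1: obtains x where "w = \<phi>1 x"
  using bij1 by (metis bij_pointE)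

lemma inv1 [simp]: "inv_into UNIV \<phi>1 (\<phi>1 x) = x" "\<phi>1 (inv_into UNIV \<phi>1 w) = w"
  using bij1 by (simp_all add: bij_is_inj bij_is_surj surj_f_inv_f)

lemma inj1: "\<phi>1 x = \<phi>1 y \<longleftrightarrow> x = y"
  using bij1 by (metis inv1(1))

lemma inj0: "\<phi>0 l = \<phi>0 m \<longleftrightarrow> l = m"
  using bij0 by (auto simp: bij_def inj_def)

definition conj_map :: "('v \<Rightarrow> 'v) \<Rightarrow> 'w \<Rightarrow> 'w" where
  "conj_map = restrict (\<lambda>a w. \<phi>1 (a (inv_into UNIV \<phi>1 w))) (End V)"

lemma conj_apply: "a \<in> End V \<Longrightarrow> conj_map a (\<phi>1 x) = \<phi>1 (a x)"
  by (simp add: conj_map_def)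

lemma conj_eqI: "a \<in> End V \<Longrightarrow> (\<And>x. \<phi>1 (a x) = b (\<phi>1 x)) \<Longrightarrow> conj_map a = b"
  by (rule ext) (metis conj_apply inv1(2))

lemma conj_End: assumes "a \<in> End V" shows "conj_map a \<in> End V'"
proof (rule V'.EndI)
  fix u w l
  obtain x y where xy: "u = \<phi>1 x" "w = \<phi>1 y" using surj1 by metis
  show "conj_map a (u + w) = conj_map a u + conj_map a w"
    using assms unfolding xy by (simp add: conj_apply V.End_add flip: add1)
  obtain m where m: "l = \<phi>0 m" using bij0 by (metis bij_pointE)
  show "conj_map a (scl V' l w) = scl V' l (conj_map a w)"
    using assms unfolding xy m by (simp add: conj_apply V.End_scale_apply flip: scale1)
qed

lemma conj_comp: "a \<in> End V \<Longrightarrow> b \<in> End V \<Longrightarrow> conj_map (a \<circ> b) = conj_map a \<circ> conj_map b"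
  by (rule conj_eqI) (simp_all add: V.End_comp conj_apply)

lemma conj_add: "a \<in> End V \<Longrightarrow> b \<in> End V \<Longrightarrow> conj_map (\<lambda>v. a v + b v) = (\<lambda>w. conj_map a w + conj_map b w)"
  by (rule conj_eqI) (simp_all add: V.End_plus conj_apply add1)

lemma id_End: "id \<in> End V"
  by (rule V.EndI) simp_all

lemma conj_id: "conj_map id = id"
  by (rule conj_eqI[OF id_End]) simp

lemma conj_scale: "a \<in> End V \<Longrightarrow> conj_map (End_scale V l a) = End_scale V' (\<phi>0 l) (conj_map a)"
  by (rule conj_eqI[OF V.End_scale_End]) (simp_all add: conj_apply End_scale_def scale1)

lemma conj_scalar: "conj_map (End_scale V l id) = End_scale V' (\<phi>0 l) id"
  by (simp add: conj_scale id_End conj_id)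

text \<open>Pairings grow by \<mu> under \<phi>1, so its inverse \<mu>' appears. Carried through
  \<alpha>, this factor becomes the multiplier in the triple product identities.\<close>

lemma conj_rank_one:
  "conj_map (rank_one V x y) = End_scale V' (\<phi>0 \<mu>') (rank_one V' (\<phi>1 x) (\<phi>1 y))"
proof (rule conj_eqI[OF V.rank_one_End])
  fix z
  have "\<mu>' * (\<mu> * polar V y z) = polar V y z" using unit by (metis mult.assoc mult.commute mult_1)
  then have "\<phi>0 \<mu>' * \<phi>0 (\<mu> * polar V y z) = \<phi>0 (polar V y z)" by (metis hom0_simps(2))
  then show "\<phi>1 (rank_one V x y z) = End_scale V' (\<phi>0 \<mu>') (rank_one V' (\<phi>1 x) (\<phi>1 y)) (\<phi>1 z)"
    by (simp add: rank_one_def End_scale_def scale1 polar_multiplier)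
qed

lemma conj_ring_iso: "conj_map \<in> ring_iso (End_ring V) (End_ring V')"
proof -
  have hom: "conj_map \<in> ring_hom (End_ring V) (End_ring V')"
    by (rule ring_hom_memI) (simp_all add: conj_End conj_comp conj_add conj_id)
  have inj: "inj_on conj_map (End V)"
  proof (rule inj_onI, rule ext)
    fix a b x assume "a \<in> End V" "b \<in> End V" "conj_map a = conj_map b"
    then show "a x = b x" by (metis conj_apply inj1)
  qed
  have "conj_map ` End V = End V'"
  proof
    show "conj_map ` End V \<subseteq> End V'" using conj_End by blast
    show "End V' \<subseteq> conj_map ` End V"
    proof
      fix b assume b: "b \<in> End V'"
      have a: "(\<lambda>x. inv_into UNIV \<phi>1 (b (\<phi>1 x))) \<in> End V"
        by (rule V.EndI; subst inj1[symmetric])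
          (simp_all add: add1 scale1 V'.End_add[OF b] V'.End_scale_apply[OF b])
      then have "conj_map (\<lambda>x. inv_into UNIV \<phi>1 (b (\<phi>1 x))) = b" by (rule conj_eqI) simp
      with a show "b \<in> conj_map ` End V" by (metis image_eqI)
    qed
  qed
  with hom inj show ?thesis by (simp add: ring_iso_def bij_betw_def)
qed

text \<open>The multiplier occurs on both sides of the adjoint equation, so similitudes respect the
  involutions just as isometries do.\<close>

lemma conj_sigma:
  assumes a: "a \<in> End V"
  shows "conj_map (sigma V a) = sigma V' (conj_map a)"
proof (rule V'.sigma_eqI[symmetric, OF conj_End[OF a] conj_End[OF V.sigma(1)[OF a]]])
  fix u w
  obtain x y where xy: "u = \<phi>1 x" "w = \<phi>1 y" using surj1 by metis
  show "polar V' (conj_map a u) w = polar V' u (conj_map (sigma V a) w)"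
    unfolding xy by (simp add: conj_apply a V.sigma polar_multiplier)
qed

lemma conj_extensional: "conj_map \<in> extensional (End V)"
  by (simp add: conj_map_def)

lemma conj_involution_iso: "involution_iso V V' conj_map"
  unfolding involution_iso_def
  by (intro conjI allI ballI conj_extensional conj_ring_iso conj_sigma)
    (simp_all add: conj_scale incl0)

lemma centre_map_conj: "centre_map V V' conj_map l = \<phi>0 l"
  unfolding centre_map_def conj_scalar
proof (rule the_equality)
  fix m assume "End_scale V' (\<phi>0 l) id = End_scale V' m id"
  then have "scl V' (\<phi>0 l) v = scl V' m v" for v by (metis End_scale_def id_apply)
  then show "m = \<phi>0 l" using V'.scalar_faithful by metis
qed simp

text \<open>To resolve the definite description, the values \<open>kappa V' (conj_map a)\<close>
  must satisfy the Clifford relations of \<open>V\<close>. They do although \<phi>1 need not be an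
  isometry: the factors \<mu>' from \<open>conj_rank_one\<close> absorb the \<mu> in the quadratic
  form. This reflects that the ideal depends only on the algebra with involution.\<close>

lemma Cl_map_conj:
  shows Cl_map_hom: "Cl_map V V' conj_map \<in> ring_hom (Cl V) (Cl V')"
    and Cl_map_const: "Cl_map V V' conj_map (cl_const V l) = cl_const V' (\<phi>0 l)"
    and Cl_map_kappa: "a \<in> End V \<Longrightarrow> Cl_map V V' conj_map (kappa V a) = kappa V' (conj_map a)"
proof -
  let ?P = "\<lambda>h. h \<in> extensional (carrier (Cl V)) \<and> h \<in> ring_hom (Cl V) (Cl V') \<and>
    (\<forall>l. h (cl_const V l) = cl_const V' (\<phi>0 l)) \<and>
    (\<forall>a\<in>End V. h (kappa V a) = kappa V' (conj_map a))"
  interpret C: ring "Cl V" by (rule V.ring_Cl)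
  interpret C': ring "Cl V'" by (rule V'.ring_Cl)
  have square: "kappa V' (conj_map (rank_one V x x)) = cl_const V' (\<phi>0 (qf V x))" for x
  proof -
    have "kappa V' (conj_map (rank_one V x x)) = cl_const V' (\<phi>0 \<mu>' * qf V' (\<phi>1 x))"
      by (simp add: conj_rank_one V'.kappa_scale V'.rank_one_End V'.kappa_square V'.cl_const_mult)
    also have "\<phi>0 \<mu>' * qf V' (\<phi>1 x) = \<phi>0 (\<mu>' * (\<mu> * qf V x))" by (simp add: multiplier hom0_simps)
    also have "\<mu>' * (\<mu> * qf V x) = qf V x" using unit by (metis mult.assoc mult.commute mult_1)
    finally show ?thesis .
  qed
  have prod: "kappa V' (conj_map (rank_one V x y)) \<otimes>\<^bsub>Cl V'\<^esub> kappa V' (conj_map (rank_one V y z))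
      = cl_const V' (\<phi>0 (qf V y)) \<otimes>\<^bsub>Cl V'\<^esub> kappa V' (conj_map (rank_one V x z))" for x y z
  proof -
    let ?c = "cl_const V' (\<phi>0 \<mu>')"
    let ?k = "\<lambda>x y. kappa V' (rank_one V' (\<phi>1 x) (\<phi>1 y))"
    have "kappa V' (conj_map (rank_one V x y)) \<otimes>\<^bsub>Cl V'\<^esub> kappa V' (conj_map (rank_one V y z))
        = (?c \<otimes>\<^bsub>Cl V'\<^esub> ?k x y) \<otimes>\<^bsub>Cl V'\<^esub> (?c \<otimes>\<^bsub>Cl V'\<^esub> ?k y z)"
      by (simp add: conj_rank_one V'.kappa_scale V'.rank_one_End)
    also have "\<dots> = ?c \<otimes>\<^bsub>Cl V'\<^esub> ((?k x y \<otimes>\<^bsub>Cl V'\<^esub> ?c) \<otimes>\<^bsub>Cl V'\<^esub> ?k y z)"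
      by (simp add: C'.m_assoc V'.rank_one_End)
    also have "?k x y \<otimes>\<^bsub>Cl V'\<^esub> ?c = ?c \<otimes>\<^bsub>Cl V'\<^esub> ?k x y"
      by (rule V'.cl_const_central[symmetric, OF V'.rank_one_End])
    also have "?c \<otimes>\<^bsub>Cl V'\<^esub> ((?c \<otimes>\<^bsub>Cl V'\<^esub> ?k x y) \<otimes>\<^bsub>Cl V'\<^esub> ?k y z)
        = ?c \<otimes>\<^bsub>Cl V'\<^esub> (?c \<otimes>\<^bsub>Cl V'\<^esub> (?k x y \<otimes>\<^bsub>Cl V'\<^esub> ?k y z))"
      by (simp add: C'.m_assoc V'.rank_one_End)
    also have "\<dots> = cl_const V' (\<phi>0 \<mu>' * (\<phi>0 \<mu>' * qf V' (\<phi>1 y))) \<otimes>\<^bsub>Cl V'\<^esub> ?k x z"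
      by (simp add: V'.kappa_mult C'.m_assoc V'.rank_one_End V'.cl_const_mult)
    also have "\<phi>0 \<mu>' * (\<phi>0 \<mu>' * qf V' (\<phi>1 y)) = \<phi>0 (\<mu>' * (\<mu>' * (\<mu> * qf V y)))"
      by (simp add: multiplier hom0_simps)
    \<comment> \<open>One of the two factors \<mu>' cancels \<mu>; the other belongs to the
      remaining rank one operator.\<close>
    also have "\<mu>' * (\<mu>' * (\<mu> * qf V y)) = qf V y * \<mu>'" using unit by (metis mult.assoc mult.commute mult_1)
    also have "cl_const V' (\<phi>0 (qf V y * \<mu>')) \<otimes>\<^bsub>Cl V'\<^esub> ?k x z
        = cl_const V' (\<phi>0 (qf V y)) \<otimes>\<^bsub>Cl V'\<^esub> kappa V' (conj_map (rank_one V x z))"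
      by (simp add: conj_rank_one V'.kappa_scale V'.rank_one_End hom0_simps V'.cl_const_mult C'.m_assoc)
    finally show ?thesis .
  qed
  obtain h0 where h0: "h0 \<in> ring_hom (Cl V) (Cl V')"
    "\<And>l. h0 (cl_const V l) = cl_const V' (\<phi>0 l)"
    "\<And>a. a \<in> End V \<Longrightarrow> h0 (kappa V a) = kappa V' (conj_map a)"
    by (rule V.Cl_hom_exists[OF V'.ring_Cl, of "\<lambda>l. cl_const V' (\<phi>0 l)" "\<lambda>a. kappa V' (conj_map a)"])
      (simp_all add: hom0_simps V'.cl_const_add V'.cl_const_mult V'.cl_const_one conj_End
        V'.cl_const_central conj_add V'.kappa_add conj_scale V'.kappa_scale square prod)
  let ?h = "restrict h0 (carrier (Cl V))"
  have ex: "?P ?h"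
    using h0 C.ring_hom_restrict[OF h0(1), of ?h] by simp
  have unique: "h = h'" if "?P h" "?P h'" for h h'
  proof (rule extensionalityI)
    show "h \<in> extensional (carrier (Cl V))" "h' \<in> extensional (carrier (Cl V))" using that by blast+
    fix x assume x: "x \<in> carrier (Cl V)"
    show "h x = h' x"
    proof (rule V.Cl_hom_unique[OF V'.ring_Cl _ _ _ _ x])
      show "h \<in> ring_hom (Cl V) (Cl V')" "h' \<in> ring_hom (Cl V) (Cl V')" using that by blast+
      show "h (cl_const V l) = h' (cl_const V l)" for l using that by metis
      show "h (kappa V a) = h' (kappa V a)" if "a \<in> End V" for a
        using that \<open>?P h\<close> \<open>?P h'\<close> by metis
    qed
  qed
  have "?P (Cl_map V V' conj_map)"
    unfolding Cl_map_def centre_map_conj by (rule theI[of ?P, OF ex]) (rule unique[OF _ ex])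
  then show "Cl_map V V' conj_map \<in> ring_hom (Cl V) (Cl V')"
    "Cl_map V V' conj_map (cl_const V l) = cl_const V' (\<phi>0 l)"
    "a \<in> End V \<Longrightarrow> Cl_map V V' conj_map (kappa V a) = kappa V' (conj_map a)"
    by blast+
qed

lemma alpha_Cl_map_rank_one:
  "alpha V' (Cl_map V V' conj_map (kappa V (rank_one V x y))) =
    (\<lambda>w. scl V' (rot V' (\<phi>0 \<mu>')) (prd V' (\<phi>1 x) (prd V' w (\<phi>1 y))),
     \<lambda>w. scl V' (rot V' (rot V' (\<phi>0 \<mu>'))) (prd V' (prd V' (\<phi>1 y) w) (\<phi>1 x)))"
  using ring_hom_mult[OF V'.alpha_hom, of "cl_const V' (\<phi>0 \<mu>')" "kappa V' (rank_one V' (\<phi>1 x) (\<phi>1 y))"]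
  by (simp add: Cl_map_kappa V.rank_one_End conj_rank_one V'.kappa_scale V'.rank_one_End
      V'.alpha_const V'.alpha_kappa) (simp add: comp_def End_scale_def)

lemma compatible_conj: "compatible V \<phi>1 conj_map"
  by (simp add: compatible_def conj_apply)

lemma compatible_unique:
  assumes "\<phi> \<in> extensional (End V)" "compatible V \<phi>1 \<phi>"
  shows "\<phi> = conj_map"
proof (rule extensionalityI[OF assms(1)])
  show "conj_map \<in> extensional (End V)" by (rule conj_extensional)
  fix a assume a: "a \<in> End V"
  then show "\<phi> a = conj_map a"
    using assms(2) by (intro conj_eqI[symmetric]) (simp_all add: compatible_def)
qed

end

text \<open>Both sides of the compatibility with \<alpha> are ring homomorphisms on
  \<open>Cl V\<close>, so it suffices to compare them on constants and rank one operators, where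
  multiplicativity of \<phi>1 and \<mu>' = 1 apply. Since \<phi>0 commutes with the rotations, the
  unflipped disjunct holds.\<close>

lemma cyc_iso_trialitarian:
  assumes V: "cyclic_composition_rank8 V" and V': "cyclic_composition_rank8 V'"
    and iso: "cyc_iso V V' \<phi>1 \<phi>0"
  shows "similitude V V' \<phi>1 \<phi>0 1 1" "trialitarian_iso V V' (similitude.conj_map V \<phi>1)"
proof -
  interpret V: cyclic_composition_rank8 V by fact
  interpret V': cyclic_composition_rank8 V' by fact
  show sim: "similitude V V' \<phi>1 \<phi>0 1 1"
    by unfold_locales (use iso in \<open>auto simp: cyc_iso_def\<close>)
  interpret similitude V V' \<phi>1 \<phi>0 1 1 by (rule sim)
  have rot: "\<phi>0 (rot V l) = rot V' (\<phi>0 l)" and prod: "\<phi>1 (prd V x y) = prd V' (\<phi>1 x) (\<phi>1 y)" for l x y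
    using iso by (auto simp: cyc_iso_def)
  let ?S = "RDirProd (End_ring V') (End_ring V')"
  have "(map_prod conj_map conj_map) \<in> ring_hom (RDirProd (End_ring V) (End_ring V)) ?S"
    by (rule ring_hom_memI) (auto simp: conj_End conj_comp conj_add conj_id)
  from ring_hom_trans[OF V.alpha_hom this]
  have h1: "map_prod conj_map conj_map \<circ> alpha V \<in> ring_hom (Cl V) ?S" .
  have h2: "alpha V' \<circ> Cl_map V V' conj_map \<in> ring_hom (Cl V) ?S"
    by (rule ring_hom_trans[OF Cl_map_hom V'.alpha_hom])
  have "(alpha V' \<circ> Cl_map V V' conj_map) c = (map_prod conj_map conj_map \<circ> alpha V) c"
    if c: "c \<in> carrier (Cl V)" for c
  proof (rule V.Cl_hom_unique_rank_one[OF _ h2 h1 _ _ c])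
    show "ring ?S" by (intro RDirProd_ring V'.ring_End)
    show "(alpha V' \<circ> Cl_map V V' conj_map) (cl_const V l) = (map_prod conj_map conj_map \<circ> alpha V) (cl_const V l)" for l
      by (simp add: Cl_map_const V.alpha_const V'.alpha_const conj_scalar rot)
    fix x y
    have "(\<lambda>v. prd V x (prd V v y)) \<in> End V" "(\<lambda>v. prd V (prd V y v) x) \<in> End V"
      by (rule V.EndI; simp add: V.star_add_left V.star_add_right V.star_scale_left V.star_scale_right)+
    then show "(alpha V' \<circ> Cl_map V V' conj_map) (kappa V (rank_one V x y))
        = (map_prod conj_map conj_map \<circ> alpha V) (kappa V (rank_one V x y))"
      by (auto simp: alpha_Cl_map_rank_one V.alpha_kappa hom0_simps prod intro!: conj_eqI[symmetric])
  qed
  then show "trialitarian_iso V V' conj_map"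
    by (auto simp: trialitarian_iso_def conj_involution_iso centre_map_conj rot)
qed

section \<open>The opposite algebra\<close>

lemma opposite_simps [simp]:
  "incl (opposite V) = incl V" "scl (opposite V) = scl V" "qf (opposite V) = qf V"
  "rot (opposite V) = rot V \<circ> rot V" "prd (opposite V) = (\<lambda>x y. prd V y x)"
  by (simp_all add: opposite_def)

lemma opposite_same [simp]:
  "polar (opposite V) = polar V" "End (opposite V) = End V" "End_ring (opposite V) = End_ring V"
  "End_scale (opposite V) = End_scale V" "rank_one (opposite V) = rank_one V"
  "sigma (opposite V) = sigma V" "End_grading (opposite V) = End_grading V"
  by (simp_all add: fun_eq_iff polar_def End_def End_ring_def End_scale_def rank_one_def sigma_def
      End_grading_def)

lemma opposite_tensor [simp]: "tgen (opposite V) = tgen V" "tconst (opposite V) = tconst V"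
  by (simp_all add: fun_eq_iff tgen_def tconst_def End_tensor_class_def)

lemma opposite_Cl [simp]:
  "Cl_ideal (opposite V) = Cl_ideal V" "Cl (opposite V) = Cl V"
  "kappa (opposite V) = kappa V" "cl_const (opposite V) = cl_const V"
  by (simp_all add: fun_eq_iff Cl_ideal_def Cl_def kappa_def cl_const_def)

lemma opposite_maps [simp]:
  "involution_iso (opposite V) V' = involution_iso V V'"
  "centre_map (opposite V) V' = centre_map V V'"
  "Cl_map (opposite V) V' = Cl_map V V'"
  "compatible (opposite V) = compatible V"
  by (simp_all add: fun_eq_iff involution_iso_def centre_map_def Cl_map_def compatible_def)

context cyclic_composition
begin

lemma galois_opposite: "cyclic_cubic_galois (incl V) (\<rho> \<circ> \<rho>)"
proof -
  have "{x. \<rho> (\<rho> x) = x} = range (incl V)" 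
  proof -
    have "\<rho> (\<rho> x) = x \<longleftrightarrow> x \<in> range (incl V)" for x by (metis rho3 rho_fixed)
    then show ?thesis by blast
  qed
  moreover obtain n :: nat and x y where "(\<Sum>i<n. x i * y i) = 1" "(\<Sum>i<n. x i * \<rho> (y i)) = 0"
    "(\<Sum>i<n. x i * \<rho> (\<rho> (y i))) = 0"
    using galois unfolding cyclic_cubic_galois_def by blast
  then have "\<exists>(n::nat) x y. (\<Sum>i<n. x i * y i) = 1 \<and> (\<Sum>i<n. x i * (\<rho> \<circ> \<rho>) (y i)) = 0 \<and>
      (\<Sum>i<n. x i * (\<rho> \<circ> \<rho>) ((\<rho> \<circ> \<rho>) (y i))) = 0"
    by (intro exI[of _ n] exI[of _ x] exI[of _ y]) simp
  moreover have "is_ring_hom (\<rho> \<circ> \<rho>)" by (simp add: is_ring_hom_def)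
  ultimately show ?thesis
    using incl_hom unfolding cyclic_cubic_galois_def by simp
qed

lemma composition_algebra_opposite: "cyclic_composition_algebra (opposite V)"
proof -
  have basis: "\<exists>B. module_basis (scl V) B"
    using cyclic_composition_algebra unfolding cyclic_composition_algebra_def by blast
  have forms: "quadratic_form (opposite V)" "nonsingular (opposite V)"
    using quadratic nonsing by (simp_all add: quadratic_form_def nonsingular_def)
  \<comment> \<open>The two cyclic laws change places; the fourfold \<rho> is the square of the new
    rotation, unfolded so as to match the definition literally.\<close>
  have beta: "\<beta> (y \<star> x) z = \<rho> (\<rho> (\<beta> (z \<star> y) x))"
    "\<beta> (y \<star> x) z = \<rho> (\<rho> (\<rho> (\<rho> (\<beta> (x \<star> z) y))))" for x y z
    using beta_star2[of y x z] beta_star1[of y x z] by (simp_all only: rho3)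
  have quad: "\<q> (y \<star> x) = \<rho> (\<rho> (\<q> x)) * \<rho> (\<rho> (\<rho> (\<rho> (\<q> y))))" for x y
    by (simp add: quad_star mult.commute)
  have scale: "y \<star> (l \<cdot> x) = \<rho> (\<rho> l) \<cdot> (y \<star> x)"
    "(l \<cdot> y) \<star> x = \<rho> (\<rho> (\<rho> (\<rho> l))) \<cdot> (y \<star> x)" for l x y
    by (simp_all only: star_scale_left star_scale_right rho3)
  show ?thesis
    unfolding cyclic_composition_algebra_def opposite_simps opposite_same comp_apply
    by (intro conjI allI galois_opposite[unfolded comp_def] module basis forms star_add_left star_add_right scale beta quad)
qed

end

context cyclic_composition_rank8
begin

lemma rank8_opposite: "cyclic_composition_rank8 (opposite V)"
  by unfold_locales
    (use composition_algebra_opposite rank8 char2 char3 in \<open>simp_all add: has_rank_def\<close>)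

text \<open>Left and right multiplications change places, so \<open>l_x r_y\<close> and
  \<open>r_x l_y\<close> do as well, and so do the actions of scalars on the two factors.\<close>

lemma alpha_opposite:
  assumes "c \<in> carrier (Cl V)"
  shows "alpha (opposite V) c = prod.swap (alpha V c)"
proof -
  interpret op: cyclic_composition_rank8 "opposite V" by (rule rank8_opposite)
  interpret C: ring "Cl V" by (rule ring_Cl)
  let ?S = "RDirProd (End_ring V) (End_ring V)"
  have "prod.swap \<in> ring_hom ?S ?S" by (rule ring_hom_memI) auto
  from ring_hom_trans[OF alpha_hom this]
  have "(prod.swap \<circ> alpha V) \<in> ring_hom (Cl V) ?S" .
  then have hom: "restrict (prod.swap \<circ> alpha V) (carrier (Cl V)) \<in> ring_hom (Cl V) ?S"
    by (rule C.ring_hom_restrict) simp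
  have "alpha (opposite V) = restrict (prod.swap \<circ> alpha V) (carrier (Cl V))"
    by (rule op.alpha_eqI)
      (use hom in \<open>simp_all add: alpha_const alpha_kappa rank_one_End\<close>)
  then show ?thesis using assms by simp
qed

end

text \<open>Passing to the opposite exchanges the two disjuncts in the definition, since the fourth
  power of \<rho> is \<rho>. This reduces the flipped case to the unflipped one.\<close>

lemma trialitarian_iso_opposite:
  assumes V: "cyclic_composition_rank8 V" and V': "cyclic_composition_rank8 V'"
  shows "trialitarian_iso (opposite V) V' \<phi> \<longleftrightarrow> trialitarian_iso V V' \<phi>"
proof -
  interpret V: cyclic_composition_rank8 V by fact
  interpret V': cyclic_composition_rank8 V' by fact
  let ?f = "centre_map V V' \<phi>"
  have 1: "(\<forall>l. ?f (rot V (rot V l)) = rot V' (?f l)) \<longleftrightarrow> (\<forall>l. ?f (rot V l) = rot V' (rot V' (?f l)))"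
    by (metis V.rho3 V'.rho3)
  have 2: "(\<forall>l. ?f (rot V (rot V l)) = rot V' (rot V' (?f l))) \<longleftrightarrow> (\<forall>l. ?f (rot V l) = rot V' (?f l))"
    by (metis V.rho3 V'.rho3)
  show ?thesis
    unfolding trialitarian_iso_def by (auto simp: 1 2 V.alpha_opposite)
qed

lemma (in graded_cyclic_composition) graded_opposite:
  "graded_cyclic_composition (opposite V) \<Gamma>V \<Gamma>L"
proof -
  interpret op: cyclic_composition_rank8 "opposite V" by (rule rank8_opposite)
  have "cyc_grading (opposite V) \<Gamma>V \<Gamma>L"
    unfolding cyc_grading_def opposite_simps opposite_same comp_apply
    by (intro conjI allI ballI grading_V grading_L mult_graded rho_graded scale_graded beta_graded)
      (metis star_graded add.commute)
  then have "type_III (opposite V) \<Gamma>V \<Gamma>L"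
    using type_III unfolding type_III_def by simp
  then show ?thesis by unfold_locales
qed

section \<open>From trialitarian algebras back to composition algebras\<close>

context cyclic_composition_rank8
begin

lemma scalar_eq_iff: "End_scale V l id = End_scale V m id \<longleftrightarrow> l = m"
  using scalar_faithful by (auto simp: End_scale_def fun_eq_iff)

text \<open>Commuting with \<open>rank_one V x (dual e)\<close> and evaluating at \<open>e\<close>
  gives \<open>a x = \<beta> (dual e) (a e) \<cdot> x\<close>.\<close>

lemma central_imp_scalar:
  assumes a: "a \<in> End V" and comm: "\<And>b. b \<in> End V \<Longrightarrow> a \<circ> b = b \<circ> a"
  obtains m where "a = End_scale V m id"
proof -
  obtain e where e: "e \<in> basis" using basis(2) by fastforce
  define m where "m = \<beta> (dual e) (a e)"
  have "a x = m \<cdot> x" for x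
    using fun_cong[OF comm[OF rank_one_End[of x "dual e"]], of e] beta_dual_basis[OF e]
    by (simp add: rank_one_def m_def)
  then have "a = End_scale V m id" by (simp add: End_scale_def fun_eq_iff)
  then show ?thesis by (rule that)
qed

lemma scalar_central: "a \<in> End V \<Longrightarrow> End_scale V l id \<circ> a = a \<circ> End_scale V l id"
  by (simp add: fun_eq_iff End_scale_def End_scale_apply)

lemma beta_self: "\<beta> x x = 2 * \<q> x"
proof -
  have "\<q> (x + x) = 4 * \<q> x" using quad_scale[of 2 x] by (simp add: scale_two power2_eq_square)
  then show ?thesis by (simp add: polar_def)
qed

lemma rank_one_comp: "a \<in> End V \<Longrightarrow> rank_one V (a x) y = a \<circ> rank_one V x y"
  by (simp add: rank_one_def fun_eq_iff End_scale_apply)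

end

context graded_cyclic_composition
begin

text \<open>Otherwise all products vanish, contradicting \<open>star_left_inj\<close>. Such a
  product is the test vector from which the degree of \<nu> is read off.\<close>

lemma homogeneous_star_nonzero:
  obtains x y a b where "x \<in> \<Gamma>V a" "y \<in> \<Gamma>V b" "x \<star> y \<noteq> 0"
proof (rule ccontr)
  assume neg: "\<not> thesis"
  have hom: "x \<star> y = 0" if "x \<in> \<Gamma>V a" "y \<in> \<Gamma>V b" for x y a b
    using neg that \<open>\<And>x a y b. x \<in> \<Gamma>V a \<Longrightarrow> y \<in> \<Gamma>V b \<Longrightarrow> x \<star> y \<noteq> 0 \<Longrightarrow> thesis\<close> by blast
  have zero: "x \<star> y = 0" for x y
  proof -
    obtain A c where c: "\<And>g. c g \<in> \<Gamma>V g" "x = (\<Sum>g\<in>A. c g)"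
      using vs_grading_decompose[OF grading_V, of x] by metis
    obtain B d where d: "\<And>g. d g \<in> \<Gamma>V g" "y = (\<Sum>g\<in>B. d g)"
      using vs_grading_decompose[OF grading_V, of y] by metis
    show ?thesis by (simp add: c(2) d(2) star_sum hom[OF c(1) d(1)])
  qed
  obtain k x where "x \<in> \<Gamma>V k" "x \<noteq> 0" by (rule homogeneous_nonzero)
  moreover have "x = 0" by (rule star_left_inj) (simp add: zero)
  ultimately show False by simp
qed

lemma scalar_graded:
  assumes x: "x \<in> \<Gamma>V k" "x \<noteq> 0" and l: "l \<cdot> x \<in> \<Gamma>V (k + d)"
  shows "l \<in> \<Gamma>L d"
proof -
  obtain y where y: "y \<in> \<Gamma>V (- k)" "\<beta> x y = 1" using homogeneous_dual[OF x] .
  from beta_graded[OF l y(1)] show ?thesis by (simp add: beta_scale_left y)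
qed

lemma rho_nontrivial: "\<exists>l. \<rho> l \<noteq> l"
proof (rule ccontr)
  assume "\<nexists>l. \<rho> l \<noteq> l"
  moreover obtain n :: nat and x y where "(\<Sum>i<n. x i * y i) = 1" "(\<Sum>i<n. x i * \<rho> (y i)) = 0"
    using galois unfolding cyclic_cubic_galois_def by blast
  ultimately show False using L_nonzero by simp
qed

end

text \<open>The images of the components of \<open>x\<close> have distinct degrees, so only the one
  of degree \<open>k\<close> can survive in \<phi> x; injectivity then identifies \<open>x\<close>
  with that component.\<close>

lemma graded_bij_preimage:
  fixes \<phi> :: "'v::ab_group_add \<Rightarrow> 'w::ab_group_add" and d :: "'g::ab_group_add"
  assumes V: "vs_grading s \<Gamma>" and V': "Modules.module s'" "vs_grading s' \<Gamma>'"
    and add: "\<And>x y. \<phi> (x + y) = \<phi> x + \<phi> y" and inj: "inj \<phi>"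
    and shift: "\<And>k x. x \<in> \<Gamma> k \<Longrightarrow> \<phi> x \<in> \<Gamma>' (k + d)"
    and x: "\<phi> x \<in> \<Gamma>' (k + d)"
  shows "x \<in> \<Gamma> k"
proof -
  have zero: "\<phi> 0 = 0" using add[of 0 0] by simp
  have sum: "\<phi> (sum g A) = (\<Sum>a\<in>A. \<phi> (g a))" for g and A :: "'g set"
    by (induction A rule: infinite_finite_induct) (simp_all add: zero add)
  obtain A c where c: "finite A" "\<And>g. c g \<in> \<Gamma> g" "x = (\<Sum>g\<in>A. c g)" "\<And>g. g \<notin> A \<Longrightarrow> c g = 0"
    using vs_grading_decompose[OF V, of x] by metis
  have "\<phi> x = (\<Sum>g\<in>A. \<phi> (c g))" by (simp add: c(3) sum)
  also have "\<dots> = (\<Sum>j\<in>(\<lambda>g. g + d) ` A. \<phi> (c (j - d)))" by (simp add: sum.reindex inj_on_def)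
  finally have "\<phi> x = (if k + d \<in> (\<lambda>g. g + d) ` A then \<phi> (c (k + d - d)) else 0)"
    by (intro vs_grading_component[OF V' _ _ _ x]) (use c(1) shift[OF c(2)] in auto)
  then have "\<phi> x = \<phi> (c k)" using c(4)[of k] zero by (cases "k \<in> A") (auto split: if_splits)
  then show ?thesis using inj c(2)[of k] by (simp add: inj_eq)
qed

section \<open>Conjugation by a graded isomorphism, and uniqueness of compatible pairs\<close>

lemma graded_cyc_iso_imp_trialitarian:
  assumes V: "graded_cyclic_composition V \<Gamma>V \<Gamma>L" and V': "graded_cyclic_composition V' \<Gamma>V' \<Gamma>L'"
    and iso: "graded_cyc_iso V \<Gamma>V \<Gamma>L V' \<Gamma>V' \<Gamma>L' \<phi>1 \<phi>0"
  shows "\<exists>!\<phi>. graded_trialitarian_iso V \<Gamma>V V' \<Gamma>V' \<phi> \<and> compatible V \<phi>1 \<phi>"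
proof -
  interpret V: graded_cyclic_composition V \<Gamma>V \<Gamma>L by fact
  interpret V': graded_cyclic_composition V' \<Gamma>V' \<Gamma>L' by fact
  have cyc: "cyc_iso V V' \<phi>1 \<phi>0" and im: "\<And>g. \<phi>1 ` \<Gamma>V g = \<Gamma>V' g"
    using iso by (auto simp: graded_cyc_iso_def)
  note tri = cyc_iso_trialitarian[OF V.cyclic_composition_rank8_axioms V'.cyclic_composition_rank8_axioms cyc]
  interpret similitude V V' \<phi>1 \<phi>0 1 1 by (rule tri(1))
  have "conj_map ` End_grading V \<Gamma>V g = End_grading V' \<Gamma>V' g" for g
  proof
    show "conj_map ` End_grading V \<Gamma>V g \<subseteq> End_grading V' \<Gamma>V' g"
    proof
      fix b assume "b \<in> conj_map ` End_grading V \<Gamma>V g"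
      then obtain a where a: "a \<in> End V" "\<And>k x. x \<in> \<Gamma>V k \<Longrightarrow> a x \<in> \<Gamma>V (g + k)" "b = conj_map a"
        by (auto simp: V.End_grading_iff)
      have "b w \<in> \<Gamma>V' (g + k)" if w: "w \<in> \<Gamma>V' k" for k w
      proof -
        obtain x where x: "x \<in> \<Gamma>V k" "w = \<phi>1 x" using w unfolding im[symmetric] by blast
        have "b w = \<phi>1 (a x)" by (simp add: a(1,3) x(2) conj_apply)
        then show ?thesis unfolding im[symmetric] using a(2)[OF x(1)] by blast
      qed
      then show "b \<in> End_grading V' \<Gamma>V' g" using a conj_End by (auto simp: V'.End_grading_iff)
    qed
    show "End_grading V' \<Gamma>V' g \<subseteq> conj_map ` End_grading V \<Gamma>V g"
    proof
      fix b assume b: "b \<in> End_grading V' \<Gamma>V' g"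
      then have "b \<in> End V'" by (simp add: V'.End_grading_iff)
      then obtain a where a: "a \<in> End V" "b = conj_map a"
        using conj_ring_iso by (auto simp: ring_iso_def bij_betw_def)
      have "a x \<in> \<Gamma>V (g + k)" if "x \<in> \<Gamma>V k" for k x
      proof -
        have "\<phi>1 (a x) = b (\<phi>1 x)" by (simp add: a conj_apply)
        moreover have "\<phi>1 x \<in> \<Gamma>V' k" using im that by blast
        ultimately have "\<phi>1 (a x) \<in> \<Gamma>V' (g + k)" using b by (simp add: V'.End_grading_iff)
        then show ?thesis using im inj1 by (metis imageE)
      qed
      then have "a \<in> End_grading V \<Gamma>V g" using a by (simp add: V.End_grading_iff)
      then show "b \<in> conj_map ` End_grading V \<Gamma>V g" using a by blast
    qed
  qed
  then have "graded_trialitarian_iso V \<Gamma>V V' \<Gamma>V' conj_map"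
    using tri(2) by (simp add: graded_trialitarian_iso_def)
  moreover have "\<phi> = conj_map" if "graded_trialitarian_iso V \<Gamma>V V' \<Gamma>V' \<phi>" "compatible V \<phi>1 \<phi>" for \<phi>
    using that by (intro compatible_unique)
      (auto simp: graded_trialitarian_iso_def trialitarian_iso_def involution_iso_def)
  ultimately show ?thesis using compatible_conj by blast
qed

text \<open>A compatible \<phi> is conjugation by \<phi>1, which sends the homothety of
  \<open>l\<close> to that of \<phi>0 \<open>l\<close>. So \<phi> alone determines \<phi>0, whether
  it comes from \<open>V\<close> or from its opposite.\<close>

lemma compatible_centre_map:
  assumes V: "cyclic_composition_rank8 V" and V': "cyclic_composition_rank8 V'"
    and iso: "cyc_iso V V' \<phi>1 \<phi>0" and \<phi>: "\<phi> \<in> extensional (End V)" "compatible V \<phi>1 \<phi>"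
  shows "centre_map V V' \<phi> = \<phi>0"
proof -
  interpret similitude V V' \<phi>1 \<phi>0 1 1 using cyc_iso_trialitarian(1)[OF V V' iso] .
  show ?thesis using compatible_unique[OF \<phi>] centre_map_conj by auto
qed

lemma compatible_graded_cyc_iso_unique:
  assumes V: "graded_cyclic_composition V \<Gamma>V \<Gamma>L" and V': "graded_cyclic_composition V' \<Gamma>V' \<Gamma>L'"
    and ext: "\<phi> \<in> extensional (End V)"
    and iso: "graded_cyc_iso V \<Gamma>V \<Gamma>L V' \<Gamma>V' \<Gamma>L' \<phi>1 \<phi>0" "compatible V \<phi>1 \<phi>"
    and iso': "graded_cyc_iso V \<Gamma>V \<Gamma>L V' \<Gamma>V' \<Gamma>L' \<psi>1 \<psi>0" "compatible V \<psi>1 \<phi>"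
  shows "\<psi>1 = \<phi>1 \<and> \<psi>0 = \<phi>0"
proof -
  interpret V: graded_cyclic_composition V \<Gamma>V \<Gamma>L by fact
  interpret V': graded_cyclic_composition V' \<Gamma>V' \<Gamma>L' by fact
  note r = V.cyclic_composition_rank8_axioms V'.cyclic_composition_rank8_axioms
  have cyc: "cyc_iso V V' \<phi>1 \<phi>0" and im: "\<And>g. \<phi>1 ` \<Gamma>V g = \<Gamma>V' g"
    using iso by (auto simp: graded_cyc_iso_def)
  have cyc': "cyc_iso V V' \<psi>1 \<psi>0" and im': "\<And>g. \<psi>1 ` \<Gamma>V g = \<Gamma>V' g"
    using iso' by (auto simp: graded_cyc_iso_def)
  have eq0: "\<psi>0 = \<phi>0"
    using compatible_centre_map[OF r cyc ext iso(2)] compatible_centre_map[OF r cyc' ext iso'(2)] by simp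
  interpret similitude V V' \<phi>1 \<phi>0 1 1 by (rule cyc_iso_trialitarian(1)[OF r cyc])
  have \<psi>: "\<psi>1 (x + y) = \<psi>1 x + \<psi>1 y" "\<psi>1 (scl V l x) = scl V' (\<phi>0 l) (\<psi>1 x)"
    "\<psi>1 (prd V x y) = prd V' (\<psi>1 x) (\<psi>1 y)" for x y l
    using cyc' by (auto simp: cyc_iso_def eq0)
  have prod: "\<phi>1 (prd V x y) = prd V' (\<phi>1 x) (\<phi>1 y)" for x y
    using cyc by (auto simp: cyc_iso_def)
  define T where "T x = inv_into UNIV \<phi>1 (\<psi>1 x)" for x
  have T: "\<phi>1 (T x) = \<psi>1 x" for x by (simp add: T_def)
  have T_End: "T \<in> End V"
    by (rule V.EndI; subst inj1[symmetric]) (simp_all only: T add1 scale1 \<psi>)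
  \<comment> \<open>Compatibility of both maps with the same \<phi> makes their quotient
    \<open>T\<close> commute with \<open>E\<close>, hence a homothety by some \<open>t\<close>. The
    grading then puts \<open>t\<close> in \<open>F\<close>, and multiplicativity makes it
    idempotent.\<close>
  have "T \<circ> a = a \<circ> T" if a: "a \<in> End V" for a
  proof
    fix x
    have "\<phi>1 (T (a x)) = \<phi> a (\<psi>1 x)" using iso'(2) a by (simp add: T compatible_def)
    also have "\<dots> = \<phi>1 (a (T x))" using iso(2) a by (simp add: compatible_def flip: T)
    finally show "(T \<circ> a) x = (a \<circ> T) x" by (simp add: inj1)
  qed
  then obtain t where "T = End_scale V t id" using V.central_imp_scalar[OF T_End] by metis
  then have \<psi>\<phi>: "\<psi>1 x = \<phi>1 (scl V t x)" for x using T[of x] by (simp add: End_scale_def)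
  obtain k x where x: "x \<in> \<Gamma>V k" "x \<noteq> 0" by (rule V.homogeneous_nonzero)
  have "\<phi>1 (scl V t x) \<in> \<phi>1 ` \<Gamma>V k" using x im im' \<psi>\<phi> by (metis imageI)
  then have "scl V t x \<in> \<Gamma>V (k + 0)" using inj1 by auto
  then have "t \<in> \<Gamma>L 0" by (rule V.scalar_graded[OF x])
  then obtain c where c: "t = incl V c" unfolding V.GL_zero by blast
  have "scl V t (prd V x y) = scl V (t * t) (prd V x y)" for x y
    using \<psi>(3)[of x y] by (simp add: \<psi>\<phi> inj1 c V.star_scale_left V.star_scale_right flip: prod)
  \<comment> \<open>The Casimir sum of products is 4 times an arbitrary vector, so the equality of
    \<open>t\<close> and \<open>t * t\<close> on products becomes one of scalars.\<close>
  then have "scl V t (\<Sum>e\<in>V.basis. prd V e (prd V v (V.dual e)))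
      = scl V (t * t) (\<Sum>e\<in>V.basis. prd V e (prd V v (V.dual e)))" for v
    by (simp only: V.M.scale_sum_right)
  then have "scl V 4 (scl V t v) = scl V 4 (scl V (t * t) v)" for v
    by (simp only: V.sum_right_left) (simp add: mult.commute)
  then have tt: "t = t * t" using V.scalar_faithful V.four_cancel by blast
  have "c \<noteq> 0"
  proof
    assume "c = 0"
    then have "\<psi>1 x = \<phi>1 0" using c is_ring_homD(4)[OF V.incl_hom] by (simp add: \<psi>\<phi>)
    moreover have "\<psi>1 0 = \<phi>1 0" by (simp add: \<psi>\<phi>)
    moreover have "inj \<psi>1" using cyc' by (auto simp: cyc_iso_def bij_def)
    ultimately show False using x(2) by (metis injD)
  qed
  then have "incl V (1 / c) * t = 1" using V.incl_unit c by simp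
  then have "t = 1" using tt by (metis mult.assoc mult_1)
  then show ?thesis using \<psi>\<phi> eq0 by auto
qed

text \<open>Both pairs share \<phi>0 by \<open>compatible_centre_map\<close>, so it intertwines the
  rotation of V' with \<rho> and with its square. Then \<rho> is the identity, against the Galois
  condition.\<close>

lemma not_iso_from_both:
  assumes V: "graded_cyclic_composition V \<Gamma>V \<Gamma>L" and V': "cyclic_composition_rank8 V'"
    and ext: "\<phi> \<in> extensional (End V)"
    and iso: "cyc_iso V V' \<phi>1 \<phi>0" "compatible V \<phi>1 \<phi>"
    and iso': "cyc_iso (opposite V) V' \<psi>1 \<psi>0" "compatible V \<psi>1 \<phi>"
  shows False
proof -
  interpret V: graded_cyclic_composition V \<Gamma>V \<Gamma>L by fact
  have "\<psi>0 = \<phi>0"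
    using compatible_centre_map[OF V.cyclic_composition_rank8_axioms V' iso(1) ext iso(2)]
      compatible_centre_map[OF V.rank8_opposite V' iso'(1)] ext iso'(2) by simp
  then have "\<phi>0 (rot V l) = \<phi>0 (rot V (rot V l))" "inj \<phi>0" for l
    using iso(1) iso'(1) by (auto simp: cyc_iso_def bij_def)
  then have "rot V l = rot V (rot V l)" for l by (metis injD)
  then show False using V.rho_nontrivial V.rho_inj by metis
qed

text \<open>A graded Skolem--Noether theorem: choosing a homogeneous rank one idempotent \<open>P\<close> and a
  homogeneous \<open>w\<^sub>0\<close> in the image of \<open>\<phi> P\<close> makes \<open>\<phi>1\<close> homogeneous of some degree \<open>d\<close>.\<close>

lemma graded_Skolem_Noether:
  assumes V: "graded_cyclic_composition V \<Gamma>V \<Gamma>L" and V': "graded_cyclic_composition V' \<Gamma>V' \<Gamma>L'"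
    and \<phi>: "involution_iso V V' \<phi>" and graded: "\<And>g. \<phi> ` End_grading V \<Gamma>V g = End_grading V' \<Gamma>V' g"
  obtains \<phi>1 \<phi>0 \<mu> \<mu>' d where "similitude V V' \<phi>1 \<phi>0 \<mu> \<mu>'" "\<phi> = similitude.conj_map V \<phi>1"
    "\<And>k x. x \<in> \<Gamma>V k \<Longrightarrow> \<phi>1 x \<in> \<Gamma>V' (k + d)"
proof -
  interpret V: graded_cyclic_composition V \<Gamma>V \<Gamma>L by fact
  interpret V': graded_cyclic_composition V' \<Gamma>V' \<Gamma>L' by fact
  have hom: "\<phi> \<in> ring_hom (End_ring V) (End_ring V')" and bij: "bij_betw \<phi> (End V) (End V')"
    and ext: "\<phi> \<in> extensional (End V)"
    and incl: "\<And>c a. a \<in> End V \<Longrightarrow> \<phi> (End_scale V (incl V c) a) = End_scale V' (incl V' c) (\<phi> a)"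
    and sig: "\<And>a. a \<in> End V \<Longrightarrow> \<phi> (sigma V a) = sigma V' (\<phi> a)"
    using \<phi> by (auto simp: involution_iso_def ring_iso_def)
  have closed: "a \<in> End V \<Longrightarrow> \<phi> a \<in> End V'" for a using ring_hom_closed[OF hom] by simp
  have comp: "a \<in> End V \<Longrightarrow> b \<in> End V \<Longrightarrow> \<phi> (a \<circ> b) = \<phi> a \<circ> \<phi> b" for a b
    using ring_hom_mult[OF hom] by simp
  have add: "a \<in> End V \<Longrightarrow> b \<in> End V \<Longrightarrow> \<phi> (\<lambda>v. a v + b v) = (\<lambda>w. \<phi> a w + \<phi> b w)" for a b
    using ring_hom_add[OF hom] by simp
  have one: "\<phi> id = id" using ring_hom_one[OF hom] by simp
  have inj: "a \<in> End V \<Longrightarrow> b \<in> End V \<Longrightarrow> \<phi> a = \<phi> b \<longleftrightarrow> a = b" for a b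
    using bij by (auto simp: bij_betw_def inj_on_def)
  have surj: "\<exists>a\<in>End V. b = \<phi> a" if "b \<in> End V'" for b
    using bij that by (auto simp: bij_betw_def)
  have id_End: "id \<in> End V" by (rule V.EndI) simp_all

  define \<phi>0 where "\<phi>0 l = (SOME m. \<phi> (End_scale V l id) = End_scale V' m id)" for l
  have \<phi>0: "\<phi> (End_scale V l id) = End_scale V' (\<phi>0 l) id" for l
  proof -
    have "\<phi> (End_scale V l id) \<circ> b = b \<circ> \<phi> (End_scale V l id)" if b: "b \<in> End V'" for b
    proof -
      obtain a where a: "a \<in> End V" "b = \<phi> a" using surj[OF b] by blast
      then show ?thesis using V.scalar_central[OF a(1), of l] comp V.scalar_End by metis
    qed
    then obtain m where "\<phi> (End_scale V l id) = End_scale V' m id"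
      using V'.central_imp_scalar[OF closed[OF V.scalar_End]] by metis
    then show ?thesis unfolding \<phi>0_def by (rule someI)
  qed
  have scale: "\<phi> (End_scale V l a) = End_scale V' (\<phi>0 l) (\<phi> a)" if a: "a \<in> End V" for l a
  proof -
    have "End_scale V l a = End_scale V l id \<circ> a" by (simp add: End_scale_def fun_eq_iff)
    then have "\<phi> (End_scale V l a) = End_scale V' (\<phi>0 l) id \<circ> \<phi> a"
      using comp[OF V.scalar_End a] \<phi>0 by metis
    then show ?thesis by (simp add: End_scale_def fun_eq_iff)
  qed
  have inj0: "\<phi>0 l = \<phi>0 m \<longleftrightarrow> l = m" for l m
    using inj[OF V.scalar_End V.scalar_End, of l m] by (simp add: \<phi>0 V.scalar_eq_iff V'.scalar_eq_iff)
  have surj0: "\<exists>l. m = \<phi>0 l" for m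
  proof -
    obtain a where a: "a \<in> End V" "End_scale V' m id = \<phi> a" using surj[OF V'.scalar_End] by blast
    have "a \<circ> b = b \<circ> a" if b: "b \<in> End V" for b
      using V'.scalar_central[OF closed[OF b], of m] a b
        inj[OF V.End_comp[OF a(1) b] V.End_comp[OF b a(1)]] by (simp add: comp)
    then obtain l where "a = End_scale V l id" using V.central_imp_scalar[OF a(1)] by metis
    then have "m = \<phi>0 l" using a(2) \<phi>0 V'.scalar_eq_iff by metis
    then show ?thesis ..
  qed
  have bij0: "bij \<phi>0"
    unfolding bij_def inj_def surj_def using inj0 surj0 by blast
  have hom0: "is_ring_hom \<phi>0"
    unfolding is_ring_hom_def
  proof (intro conjI allI)
    fix l m
    have "End_scale V (l + m) id = (\<lambda>v. End_scale V l id v + End_scale V m id v)"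
      by (simp add: End_scale_def fun_eq_iff V.M.scale_left_distrib)
    then have "End_scale V' (\<phi>0 (l + m)) id = (\<lambda>w. End_scale V' (\<phi>0 l) id w + End_scale V' (\<phi>0 m) id w)"
      using add[OF V.scalar_End V.scalar_End, of l m] \<phi>0 by metis
    also have "\<dots> = End_scale V' (\<phi>0 l + \<phi>0 m) id"
      by (simp add: End_scale_def fun_eq_iff V'.M.scale_left_distrib)
    finally have "End_scale V' (\<phi>0 (l + m)) id = End_scale V' (\<phi>0 l + \<phi>0 m) id" .
    then show "\<phi>0 (l + m) = \<phi>0 l + \<phi>0 m" by (simp add: V'.scalar_eq_iff)
    have "End_scale V (l * m) id = End_scale V l (End_scale V m id)" by (simp add: End_scale_def)
    then have "End_scale V' (\<phi>0 (l * m)) id = End_scale V' (\<phi>0 l) (End_scale V' (\<phi>0 m) id)"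
      using \<phi>0 scale[OF V.scalar_End] by metis
    also have "\<dots> = End_scale V' (\<phi>0 l * \<phi>0 m) id" by (simp add: End_scale_def)
    finally show "\<phi>0 (l * m) = \<phi>0 l * \<phi>0 m" by (simp add: V'.scalar_eq_iff)
  next
    have "End_scale V 1 id = id" by (simp add: End_scale_def fun_eq_iff)
    then have "End_scale V' (\<phi>0 1) id = id" using \<phi>0[of 1] one by simp
    also have "id = End_scale V' 1 id" by (simp add: End_scale_def fun_eq_iff)
    finally show "\<phi>0 1 = 1" by (simp add: V'.scalar_eq_iff)
  qed
  note hom0_simps = is_ring_homD[OF hom0]
  have incl0: "\<phi>0 (incl V c) = incl V' c" for c
    using incl[OF id_End, of c] \<phi>0[of "incl V c"] by (simp add: one V'.scalar_eq_iff)

  obtain k x0 where x0: "x0 \<in> \<Gamma>V k" "x0 \<noteq> 0" by (rule V.homogeneous_nonzero)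
  obtain y0 where y0: "y0 \<in> \<Gamma>V (- k)" "polar V x0 y0 = 1" using V.homogeneous_dual[OF x0] .
  define P where "P = rank_one V x0 y0"
  have P: "P \<in> End V" "P x0 = x0" "P \<circ> P = P"
    using V.rank_one_End y0(2)
    by (simp_all add: P_def) (simp_all add: rank_one_def fun_eq_iff V.beta_scale_right V.beta_sym)
  have zero_End: "(\<lambda>v. 0) \<in> End V" by (rule V.EndI) simp_all
  have zero: "\<phi> (\<lambda>v. 0) = (\<lambda>w. 0)"
    using fun_cong[OF add[OF zero_End zero_End]] by (simp add: fun_eq_iff)
  have "\<phi> P \<noteq> (\<lambda>w. 0)" using inj[OF P(1) zero_End] zero P(2) x0(2) by metis
  then obtain v' where v': "\<phi> P v' \<noteq> 0" by (auto simp: fun_eq_iff)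
  obtain A c where c: "\<And>g. c g \<in> \<Gamma>V' g" "v' = (\<Sum>g\<in>A. c g)"
    using vs_grading_decompose[OF V'.grading_V, of v'] by metis
  obtain m where m: "\<phi> P (c m) \<noteq> 0"
    using v' by (auto simp: c(2) V'.End_sum[OF closed[OF P(1)]] intro: sum.neutral)
  have shift: "\<phi> a w \<in> \<Gamma>V' (g + j)" if "a \<in> End_grading V \<Gamma>V g" "w \<in> \<Gamma>V' j" for a g w j
    using that graded[of g] V'.End_grading_iff by blast
  define w0 where "w0 = \<phi> P (c m)"
  have "P \<in> End_grading V \<Gamma>V 0" using V.rank_one_graded[OF x0(1) y0(1)] by (simp add: P_def)
  from shift[OF this c(1)] have w0: "w0 \<in> \<Gamma>V' m" "w0 \<noteq> 0" using m by (simp_all add: w0_def)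
  obtain y' where y': "polar V' w0 y' = 1" using V'.homogeneous_dual[OF w0] by blast
  have Pw0: "\<phi> P w0 = w0" using fun_cong[OF comp[OF P(1) P(1)], of "c m"] by (simp add: w0_def P(3))

  \<comment> \<open>\<open>V\<close> is identified with the left ideal of operators
    \<open>rank_one V x y0\<close>, and \<phi> makes \<open>E\<close> act on V'; evaluating at
    \<open>w0\<close> is the resulting map of modules, with \<open>x0\<close> going to
    \<open>w0\<close>.\<close>
  define \<phi>1 where "\<phi>1 x = \<phi> (rank_one V x y0) w0" for x
  have \<phi>1x0: "\<phi>1 x0 = w0" using Pw0 by (simp add: \<phi>1_def P_def)
  have compat: "\<phi>1 (a x) = \<phi> a (\<phi>1 x)" if "a \<in> End V" for a x
    by (simp add: \<phi>1_def V.rank_one_comp that comp V.rank_one_End)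
  have add1: "\<phi>1 (x + y) = \<phi>1 x + \<phi>1 y" for x y
  proof -
    have "rank_one V (x + y) y0 = (\<lambda>v. rank_one V x y0 v + rank_one V y y0 v)"
      by (simp add: rank_one_def V.M.scale_right_distrib)
    then show ?thesis by (simp add: \<phi>1_def add V.rank_one_End)
  qed
  have scale1: "\<phi>1 (scl V l x) = scl V' (\<phi>0 l) (\<phi>1 x)" for l x
  proof -
    have "rank_one V (scl V l x) y0 = End_scale V l (rank_one V x y0)"
      by (simp add: rank_one_def End_scale_def mult.commute)
    then show ?thesis by (simp add: \<phi>1_def scale V.rank_one_End) (simp add: End_scale_def)
  qed
  have zero1: "x = 0" if "\<phi>1 x = 0" for x
  proof (rule V.beta_nondeg)
    fix g
    \<comment> \<open>The operator \<open>rank_one V x0 g\<close> moves \<open>x\<close> to a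
      multiple of \<open>x0\<close>; as \<open>w0\<close> pairs to 1 with \<open>y'\<close>, the
      coefficient must vanish.\<close>
    have "scl V' (\<phi>0 (polar V g x)) w0 = 0"
      using compat[OF V.rank_one_End[of x0 g], of x] that V'.End_zero[OF closed[OF V.rank_one_End]]
      by (simp add: rank_one_def scale1 \<phi>1x0)
    then have "\<phi>0 (polar V g x) = \<phi>0 0"
      using y' V'.beta_scale_left[of "\<phi>0 (polar V g x)" w0 y'] by (simp add: hom0_simps)
    then show "polar V x g = polar V 0 g" by (simp add: inj0 V.beta_sym)
  qed
  have bij1: "bij \<phi>1"
    unfolding bij_def
  proof
    show "inj \<phi>1"
    proof (rule injI)
      fix x y assume "\<phi>1 x = \<phi>1 y"
      then have "\<phi>1 (x - y) = 0" using add1[of "x - y" y] by simp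
      then show "x = y" using zero1 by fastforce
    qed
    show "surj \<phi>1"
      unfolding surj_def
    proof
      fix w
      obtain a where a: "a \<in> End V" "rank_one V' w y' = \<phi> a" using surj[OF V'.rank_one_End] by blast
      have "\<phi>1 (a x0) = rank_one V' w y' w0" using compat[OF a(1)] by (simp add: \<phi>1x0 a(2))
      also have "\<dots> = w" using y' by (simp add: rank_one_def V'.beta_sym)
      finally show "\<exists>x. w = \<phi>1 x" by metis
    qed
  qed
  \<comment> \<open>The multiplier is read off at the pair \<open>x0\<close>, \<open>y0\<close>,
    whose pairing is 1.\<close>
  obtain \<mu> where \<mu>: "\<phi>0 \<mu> = polar V' (\<phi>1 x0) (\<phi>1 y0)" using surj0 by metis
  have polar1: "polar V' (\<phi>1 v) (\<phi>1 z) = \<phi>0 (\<mu> * polar V v z)" for v z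
  proof -
    \<comment> \<open>The involution exchanges \<open>rank_one V x0 z\<close> and
      \<open>rank_one V z x0\<close>; moving the first across the form of V' reduces every pairing
      to the one that defines \<mu>.\<close>
    have a: "rank_one V x0 z \<in> End V" by (rule V.rank_one_End)
    have "polar V' (\<phi> (rank_one V x0 z) (\<phi>1 v)) (\<phi>1 y0)
        = polar V' (\<phi>1 v) (\<phi> (rank_one V z x0) (\<phi>1 y0))"
      using V'.sigma(2)[OF closed[OF a], of "\<phi>1 v" "\<phi>1 y0"] sig[OF a] by (simp add: V.sigma_rank_one)
    moreover have "\<phi> (rank_one V x0 z) (\<phi>1 v) = scl V' (\<phi>0 (polar V z v)) (\<phi>1 x0)"
      using compat[OF a, of v] by (simp add: rank_one_def scale1)
    moreover have "\<phi> (rank_one V z x0) (\<phi>1 y0) = \<phi>1 z"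
      using compat[OF V.rank_one_End[of z x0], of y0] by (simp add: rank_one_def y0)
    ultimately have "\<phi>0 (polar V z v) * \<phi>0 \<mu> = polar V' (\<phi>1 v) (\<phi>1 z)"
      by (simp add: V'.beta_scale_left \<mu>)
    then show ?thesis by (simp add: hom0_simps V.beta_sym mult.commute)
  qed
  \<comment> \<open>The preimage of \<open>y'\<close> supplies the inverse of \<mu>: its pairing
    with \<open>x0\<close> is carried to the pairing of \<open>w0\<close> with \<open>y'\<close>,
    which is 1.\<close>
  obtain y1 where y1: "y' = \<phi>1 y1" using bij1 by (metis bij_pointE)
  have unit: "\<mu> * polar V x0 y1 = 1"
    using polar1[of x0 y1] y' inj0[of _ 1] by (simp add: \<phi>1x0 hom0_simps(3) flip: y1)
  have quad1: "qf V' (\<phi>1 x) = \<phi>0 (\<mu> * qf V x)" for x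
  proof (rule V'.ring_two_cancel)
    have "\<phi>0 2 = 2" by (rule is_ring_hom_numeral[OF hom0])
    then show "2 * qf V' (\<phi>1 x) = 2 * \<phi>0 (\<mu> * qf V x)"
      using polar1[of x x] by (simp add: V.beta_self V'.beta_self hom0_simps)
  qed
  have sim: "similitude V V' \<phi>1 \<phi>0 \<mu> (polar V x0 y1)"
    by unfold_locales (fact bij0 hom0 incl0 bij1 add1 scale1 unit quad1)+
  interpret similitude V V' \<phi>1 \<phi>0 \<mu> "polar V x0 y1" by (rule sim)
  show ?thesis
  proof (rule that[OF sim])
    show "\<phi> = conj_map"
      by (rule compatible_unique[OF ext]) (simp add: compatible_def compat)
    \<comment> \<open>The degree of \<phi>1 is \<open>m - k\<close>: \<open>y0\<close> contributes
      \<open>- k\<close> and \<open>w0\<close> contributes \<open>m\<close>.\<close>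
    fix j x assume "x \<in> \<Gamma>V j"
    from shift[OF V.rank_one_graded[OF this y0(1)] w0(1)]
    show "\<phi>1 x \<in> \<Gamma>V' (j + (m - k))" by (simp add: \<phi>1_def algebra_simps)
  qed
qed

text \<open>The unflipped case. Applied to the opposite of \<open>V\<close>, it yields the flipped
  case too.\<close>

lemma trialitarian_imp_graded_cyc_iso:
  assumes V: "graded_cyclic_composition V \<Gamma>V \<Gamma>L" and V': "graded_cyclic_composition V' \<Gamma>V' \<Gamma>L'"
    and \<phi>: "involution_iso V V' \<phi>" and graded: "\<And>g. \<phi> ` End_grading V \<Gamma>V g = End_grading V' \<Gamma>V' g"
    and rot: "\<And>l. centre_map V V' \<phi> (rot V l) = rot V' (centre_map V V' \<phi> l)"
    and alpha: "\<And>c. c \<in> carrier (Cl V) \<Longrightarrow> alpha V' (Cl_map V V' \<phi> c) = map_prod \<phi> \<phi> (alpha V c)"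
  obtains \<phi>1 \<phi>0 where "graded_cyc_iso V \<Gamma>V \<Gamma>L V' \<Gamma>V' \<Gamma>L' \<phi>1 \<phi>0" "compatible V \<phi>1 \<phi>"
proof -
  interpret V: graded_cyclic_composition V \<Gamma>V \<Gamma>L by fact
  interpret V': graded_cyclic_composition V' \<Gamma>V' \<Gamma>L' by fact
  obtain \<phi>1 \<phi>0 \<mu> \<mu>' d where sim: "similitude V V' \<phi>1 \<phi>0 \<mu> \<mu>'" and \<phi>_eq: "\<phi> = similitude.conj_map V \<phi>1"
    and shift: "\<And>k x. x \<in> \<Gamma>V k \<Longrightarrow> \<phi>1 x \<in> \<Gamma>V' (k + d)"
    by (rule graded_Skolem_Noether[OF V V' \<phi> graded]) (assumption | blast)+
  interpret similitude V V' \<phi>1 \<phi>0 \<mu> \<mu>' by (rule sim)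
  have rot0: "\<phi>0 (rot V l) = rot V' (\<phi>0 l)" for l
    using rot[of l] by (simp add: \<phi>_eq centre_map_conj)
  have shift_inv: "x \<in> \<Gamma>V k" if "\<phi>1 x \<in> \<Gamma>V' (k + d)" for x k
    by (rule graded_bij_preimage[OF V.grading_V V'.module_FV V'.grading_V add1 _ shift that])
      (use bij1 in \<open>auto simp: bij_def\<close>)
  have End12: "(\<lambda>v. prd V x (prd V v y)) \<in> End V" "(\<lambda>v. prd V (prd V y v) x) \<in> End V" for x y
    by (rule V.EndI; simp add: V.star_add_left V.star_add_right V.star_scale_left V.star_scale_right)+
  have triality: "\<phi>1 (prd V x (prd V v y)) = scl V' (\<phi>0 (rot V \<mu>')) (prd V' (\<phi>1 x) (prd V' (\<phi>1 v) (\<phi>1 y)))"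
    "\<phi>1 (prd V (prd V y v) x) = scl V' (\<phi>0 (rot V (rot V \<mu>'))) (prd V' (prd V' (\<phi>1 y) (\<phi>1 v)) (\<phi>1 x))"
    for x y v
    using alpha[OF V.kappa_closed[OF V.rank_one_End], of x y]
    unfolding \<phi>_eq alpha_Cl_map_rank_one V.alpha_kappa map_prod_simp
    by (auto simp: rot0 fun_eq_iff simp flip: conj_apply[OF End12(1)] conj_apply[OF End12(2)])
  define circ where "circ x y = inv_into UNIV \<phi>1 (prd V' (\<phi>1 x) (\<phi>1 y))" for x y
  have circ: "\<phi>1 (circ x y) = prd V' (\<phi>1 x) (\<phi>1 y)" for x y by (simp add: circ_def)
  have unit1: "rot V \<mu> * rot V \<mu>' = 1" using arg_cong[OF unit, of "rot V"] by simp
  have unit2: "rot V (rot V \<mu>) * rot V (rot V \<mu>') = 1" using arg_cong[OF unit1, of "rot V"] by simp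
  obtain \<nu> where \<nu>: "\<And>x y. circ x y = scl V \<nu> (prd V x y)" "rot V \<mu> = \<nu> * rot V (rot V \<nu>)"
  proof (rule V.products_scalar_multiple[of circ \<mu> \<mu>'])
    show "circ (x + y) z = circ x z + circ y z" "circ x (y + z) = circ x y + circ x z"
      "circ (scl V l x) y = scl V (rot V l) (circ x y)"
      "circ x (scl V l y) = scl V (rot V (rot V l)) (circ x y)" for x y z l
      by (subst inj1[symmetric]; simp add: circ add1 scale1 rot0 V'.star_add_left V'.star_add_right
          V'.star_scale_left V'.star_scale_right)+
    fix x v y
    have "prd V x (prd V v y) = scl V (rot V \<mu>') (circ x (circ v y))"
      by (subst inj1[symmetric]) (simp add: triality circ scale1)
    then show "circ x (circ v y) = scl V (rot V \<mu>) (prd V x (prd V v y))" by (simp add: unit1)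
    have "prd V (prd V y v) x = scl V (rot V (rot V \<mu>')) (circ (circ y v) x)"
      by (subst inj1[symmetric]) (simp add: triality circ scale1)
    then show "circ (circ y v) x = scl V (rot V (rot V \<mu>)) (prd V (prd V y v) x)" by (simp add: unit2)
  qed (rule unit, blast)

  obtain x y a b where xy: "x \<in> \<Gamma>V a" "y \<in> \<Gamma>V b" "prd V x y \<noteq> 0" by (rule V.homogeneous_star_nonzero)
  \<comment> \<open>Two factors each shift the degree by \<open>d\<close> and pulling back along
    \<phi>1 undoes one shift; the remaining \<open>d\<close> is the degree of \<nu>.\<close>
  have "\<phi>1 (circ x y) \<in> \<Gamma>V' ((a + b + d) + d)"
    using V'.star_graded[OF shift[OF xy(1)] shift[OF xy(2)]] by (simp add: circ algebra_simps)
  then have "scl V \<nu> (prd V x y) \<in> \<Gamma>V (a + b + d)" using shift_inv \<nu>(1) by metis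
  from V.scalar_graded[OF V.star_graded[OF xy(1,2)] xy(3) this] have \<nu>_graded: "\<nu> \<in> \<Gamma>L d" .
  have "\<nu> \<noteq> 0"
  proof
    assume "\<nu> = 0"
    then have "rot V \<mu> = 0" using \<nu>(2) by simp
    then show False using unit1 V.L_nonzero by simp
  qed
  then obtain \<nu>' where \<nu>': "\<nu>' \<in> \<Gamma>L (- d)" "\<nu> * \<nu>' = 1" using V.homogeneous_unit[OF \<nu>_graded] by blast
  have "\<mu> = rot V (rot V (rot V \<mu>))" by simp
  also have "\<dots> = rot V \<nu> * rot V (rot V \<nu>)" by (simp add: \<nu>(2) mult.commute)
  also have "\<dots> = \<nu> * \<nu>" by (rule V.homogeneous_norm[OF \<nu>_graded])
  finally have \<mu>: "\<mu> = \<nu> * \<nu>" .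
  have norm': "rot V \<nu>' * rot V (rot V \<nu>') = \<nu>' * \<nu>'" by (rule V.homogeneous_norm[OF \<nu>'(1)])

  \<comment> \<open>The scalar \<nu>' has degree \<open>- d\<close>, so it corrects the degree of
    \<phi>1 along with its multiplier and its failure to be multiplicative.\<close>
  define \<psi> where "\<psi> x = \<phi>1 (scl V \<nu>' x)" for x
  have \<psi>_image: "\<psi> ` \<Gamma>V g = \<Gamma>V' g" for g
  proof
    show "\<psi> ` \<Gamma>V g \<subseteq> \<Gamma>V' g"
      using shift[OF V.scale_graded[OF \<nu>'(1)]] by (fastforce simp: \<psi>_def)
    show "\<Gamma>V' g \<subseteq> \<psi> ` \<Gamma>V g"
    proof
      fix w assume w: "w \<in> \<Gamma>V' g"
      obtain z where z: "w = \<phi>1 z" by (rule surj1)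
      then have "z \<in> \<Gamma>V (g - d)" using w by (intro shift_inv) simp
      from V.scale_graded[OF \<nu>_graded this] have "scl V \<nu> z \<in> \<Gamma>V g" by simp
      moreover have "w = \<psi> (scl V \<nu> z)" using \<nu>'(2) by (simp add: \<psi>_def z mult.commute)
      ultimately show "w \<in> \<psi> ` \<Gamma>V g" by blast
    qed
  qed
  have \<phi>0_image: "\<phi>0 ` \<Gamma>L g = \<Gamma>L' g" for g
  proof
    show "\<phi>0 ` \<Gamma>L g \<subseteq> \<Gamma>L' g"
    proof
      fix m assume "m \<in> \<phi>0 ` \<Gamma>L g"
      then obtain l where l: "m = \<phi>0 l" "End_scale V l id \<in> End_grading V \<Gamma>V g"
        by (auto simp: V.scalar_graded_iff)
      then have "\<phi> (End_scale V l id) \<in> End_grading V' \<Gamma>V' g" using graded by blast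
      then show "m \<in> \<Gamma>L' g" by (simp add: \<phi>_eq conj_scalar l(1) V'.scalar_graded_iff)
    qed
    show "\<Gamma>L' g \<subseteq> \<phi>0 ` \<Gamma>L g"
    proof
      fix m assume m: "m \<in> \<Gamma>L' g"
      obtain l where l: "m = \<phi>0 l" using bij0 by (metis bij_pointE)
      \<comment> \<open>The degree of \<open>m\<close> is recognised on its homothety, which lies in
        the image of the component of degree \<open>g\<close>; injectivity brings it back to the
        homothety of \<open>l\<close>.\<close>
      have "conj_map (End_scale V l id) \<in> conj_map ` End_grading V \<Gamma>V g"
        using m graded[of g] by (simp add: conj_scalar V'.scalar_graded_iff \<phi>_eq flip: l)
      then obtain a where a: "a \<in> End_grading V \<Gamma>V g" "conj_map (End_scale V l id) = conj_map a" by blast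
      have "inj_on conj_map (End V)" using conj_ring_iso by (auto simp: ring_iso_def bij_betw_def)
      then have "End_scale V l id = a"
        using a V.scalar_End by (auto simp: inj_on_def V.End_grading_iff)
      then show "m \<in> \<phi>0 ` \<Gamma>L g" using a(1) l by (auto simp: V.scalar_graded_iff)
    qed
  qed
  have "bij \<psi>"
  proof (rule bijI)
    show "inj \<psi>"
    proof (rule injI)
      fix x y assume "\<psi> x = \<psi> y"
      then have "scl V \<nu> (scl V \<nu>' x) = scl V \<nu> (scl V \<nu>' y)" by (simp add: \<psi>_def inj1)
      then show "x = y" by (simp add: \<nu>'(2))
    qed
    have "w = \<psi> (scl V \<nu> (inv_into UNIV \<phi>1 w))" for w
      using \<nu>'(2) by (simp add: \<psi>_def mult.commute)
    then show "surj \<psi>" unfolding surj_def by blast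
  qed
  moreover have "\<psi> (prd V x y) = prd V' (\<psi> x) (\<psi> y)" for x y
  proof -
    have "prd V' (\<psi> x) (\<psi> y) = \<phi>1 (scl V (\<nu> * (rot V \<nu>' * rot V (rot V \<nu>'))) (prd V x y))"
      unfolding \<psi>_def
      by (simp add: \<nu>(1) V.star_scale_left V.star_scale_right mult.commute flip: circ)
    \<comment> \<open>By \<open>norm'\<close> the left side is \<nu> times the square of \<nu>', and
      one factor cancels.\<close>
    also have "\<nu> * (rot V \<nu>' * rot V (rot V \<nu>')) = \<nu>'"
      using \<nu>'(2) by (simp add: norm' flip: mult.assoc)
    finally show ?thesis by (simp add: \<psi>_def)
  qed
  moreover have "\<phi>0 (qf V x) = qf V' (\<psi> x)" for x
  proof -
    have "\<mu> * qf V (scl V \<nu>' x) = (\<nu> * \<nu>') * (\<nu> * \<nu>') * qf V x"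
      by (simp add: \<mu> V.quad_scale power2_eq_square ac_simps)
    then show ?thesis by (simp add: \<psi>_def multiplier \<nu>'(2))
  qed
  moreover have "\<psi> (scl V l x) = scl V' (\<phi>0 l) (\<psi> x)" for l x
    by (simp add: \<psi>_def mult.commute flip: scale1)
  moreover have "\<psi> (x + y) = \<psi> x + \<psi> y" for x y
    by (simp add: \<psi>_def V.M.scale_right_distrib add1)
  ultimately have "graded_cyc_iso V \<Gamma>V \<Gamma>L V' \<Gamma>V' \<Gamma>L' \<psi> \<phi>0"
    unfolding graded_cyc_iso_def cyc_iso_def
    using bij0 hom0 incl0 rot0 \<psi>_image \<phi>0_image by blast
  moreover have "compatible V \<psi> \<phi>"
    by (simp add: compatible_def \<psi>_def \<phi>_eq conj_apply flip: V.End_scale_apply)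
  ultimately show ?thesis by (rule that)
qed

lemma ex1_pairI:
  assumes "P a b" "\<And>x y. P x y \<Longrightarrow> x = a \<and> y = b"
  shows "\<exists>!(x, y). P x y"
proof (rule ex1I)
  show "case (a, b) of (x, y) \<Rightarrow> P x y" by (simp add: assms(1))
  show "p = (a, b)" if "case p of (x, y) \<Rightarrow> P x y" for p
    using assms(2)[of "fst p" "snd p"] that by (cases p) simp
qed

theorem theorem13:
  fixes V :: "('f::field, 'f ^ 3, 'v::ab_group_add) cyc"
    and V' :: "('f, 'l::comm_ring_1, 'w::ab_group_add) cyc"
    and \<Gamma>V :: "'g::ab_group_add \<Rightarrow> 'v set" and \<Gamma>L :: "'g \<Rightarrow> ('f ^ 3) set"
    and \<Gamma>V' :: "'g \<Rightarrow> 'w set" and \<Gamma>L' :: "'g \<Rightarrow> 'l set"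
  assumes char: "CHAR('f) \<noteq> 2" "CHAR('f) \<noteq> 3"
    and cube_root: "\<exists>\<omega>::'f. \<omega> ^ 3 = 1 \<and> \<omega> \<noteq> 1"
    and diagonal: "incl V = vec"
    and V: "cyclic_composition_algebra V" "has_rank V 8"
    and V': "cyclic_composition_algebra V'" "has_rank V' 8"
    and grading: "type_III V \<Gamma>V \<Gamma>L" "type_III V' \<Gamma>V' \<Gamma>L'"
  shows "(\<forall>W\<in>{V, opposite V}. \<forall>\<phi>1 \<phi>0. graded_cyc_iso W \<Gamma>V \<Gamma>L V' \<Gamma>V' \<Gamma>L' \<phi>1 \<phi>0 \<longrightarrow>
            (\<exists>!\<phi>. graded_trialitarian_iso V \<Gamma>V V' \<Gamma>V' \<phi> \<and> compatible V \<phi>1 \<phi>)) \<and>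
         (\<forall>\<phi>. graded_trialitarian_iso V \<Gamma>V V' \<Gamma>V' \<phi> \<longrightarrow>
            (\<exists>W W'. {W, W'} = {V, opposite V} \<and>
              (\<exists>!(\<phi>1, \<phi>0). graded_cyc_iso W \<Gamma>V \<Gamma>L V' \<Gamma>V' \<Gamma>L' \<phi>1 \<phi>0 \<and> compatible V \<phi>1 \<phi>) \<and>
              (\<nexists>\<phi>1 \<phi>0. graded_cyc_iso W' \<Gamma>V \<Gamma>L V' \<Gamma>V' \<Gamma>L' \<phi>1 \<phi>0 \<and> compatible V \<phi>1 \<phi>)))"
proof -
  have graded: "graded_cyclic_composition V \<Gamma>V \<Gamma>L" and graded': "graded_cyclic_composition V' \<Gamma>V' \<Gamma>L'"
    by unfold_locales (fact V V' char grading)+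
  interpret V: graded_cyclic_composition V \<Gamma>V \<Gamma>L by (rule graded)
  interpret V': graded_cyclic_composition V' \<Gamma>V' \<Gamma>L' by (rule graded')
  have op: "graded_cyclic_composition (opposite V) \<Gamma>V \<Gamma>L" by (rule V.graded_opposite)
  note r = V.cyclic_composition_rank8_axioms and r' = V'.cyclic_composition_rank8_axioms
  have tri_op: "graded_trialitarian_iso (opposite V) \<Gamma>V V' \<Gamma>V' = graded_trialitarian_iso V \<Gamma>V V' \<Gamma>V'"
    by (simp add: graded_trialitarian_iso_def fun_eq_iff trialitarian_iso_opposite[OF r r'])
  have forward: "\<exists>!\<phi>. graded_trialitarian_iso V \<Gamma>V V' \<Gamma>V' \<phi> \<and> compatible V \<phi>1 \<phi>"
    if "W \<in> {V, opposite V}" "graded_cyc_iso W \<Gamma>V \<Gamma>L V' \<Gamma>V' \<Gamma>L' \<phi>1 \<phi>0" for W \<phi>1 \<phi>0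
    using that graded_cyc_iso_imp_trialitarian[OF graded graded', of \<phi>1 \<phi>0]
      graded_cyc_iso_imp_trialitarian[OF op graded', of \<phi>1 \<phi>0]
    by (auto simp: tri_op)
  have backward: "\<exists>W W'. {W, W'} = {V, opposite V} \<and>
      (\<exists>!(\<phi>1, \<phi>0). graded_cyc_iso W \<Gamma>V \<Gamma>L V' \<Gamma>V' \<Gamma>L' \<phi>1 \<phi>0 \<and> compatible V \<phi>1 \<phi>) \<and>
      (\<nexists>\<phi>1 \<phi>0. graded_cyc_iso W' \<Gamma>V \<Gamma>L V' \<Gamma>V' \<Gamma>L' \<phi>1 \<phi>0 \<and> compatible V \<phi>1 \<phi>)"
    if \<phi>: "graded_trialitarian_iso V \<Gamma>V V' \<Gamma>V' \<phi>" for \<phi>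
  proof -
    let ?f = "centre_map V V' \<phi>"
    let ?iso = "\<lambda>W \<phi>1 \<phi>0. graded_cyc_iso W \<Gamma>V \<Gamma>L V' \<Gamma>V' \<Gamma>L' \<phi>1 \<phi>0 \<and> compatible V \<phi>1 \<phi>"
    have inv: "involution_iso V V' \<phi>" and im: "\<And>g. \<phi> ` End_grading V \<Gamma>V g = End_grading V' \<Gamma>V' g"
      using \<phi> by (auto simp: graded_trialitarian_iso_def trialitarian_iso_def)
    have ext: "\<phi> \<in> extensional (End V)" using inv by (simp add: involution_iso_def)
    have ext': "\<phi> \<in> extensional (End (opposite V))" using ext by simp
    have not_both: "\<not> (?iso V \<phi>1 \<phi>0 \<and> ?iso (opposite V) \<psi>1 \<psi>0)" for \<phi>1 \<phi>0 \<psi>1 \<psi>0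
      using not_iso_from_both[OF graded r' ext, of \<phi>1 \<phi>0 \<psi>1 \<psi>0] by (auto simp: graded_cyc_iso_def)
    from \<phi> consider
      (id) "\<And>l. ?f (rot V l) = rot V' (?f l)"
        "\<And>c. c \<in> carrier (Cl V) \<Longrightarrow> alpha V' (Cl_map V V' \<phi> c) = map_prod \<phi> \<phi> (alpha V c)"
    | (flip) "\<And>l. ?f (rot V l) = rot V' (rot V' (?f l))"
        "\<And>c. c \<in> carrier (Cl V) \<Longrightarrow> alpha V' (Cl_map V V' \<phi> c) = map_prod \<phi> \<phi> (prod.swap (alpha V c))"
      unfolding graded_trialitarian_iso_def trialitarian_iso_def by blast
    then show ?thesis
    proof cases
      case id
      obtain \<phi>1 \<phi>0 where iso: "?iso V \<phi>1 \<phi>0"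
        using trialitarian_imp_graded_cyc_iso[OF graded graded' inv im id] by blast
      have "\<psi>1 = \<phi>1 \<and> \<psi>0 = \<phi>0" if "?iso V \<psi>1 \<psi>0" for \<psi>1 \<psi>0
        using compatible_graded_cyc_iso_unique[OF graded graded' ext] iso that by blast
      with iso have "\<exists>!(\<phi>1, \<phi>0). ?iso V \<phi>1 \<phi>0" by (rule ex1_pairI)
      moreover have "\<nexists>\<phi>1 \<phi>0. ?iso (opposite V) \<phi>1 \<phi>0" using iso not_both by blast
      ultimately show ?thesis by (intro exI[of _ V] exI[of _ "opposite V"] conjI refl)
    next
      case flip
      \<comment> \<open>Over the opposite, the rotation is the square of \<rho>; two applications of
        \<open>flip\<close> give a fourth power on the right, which is the rotation of V'
        itself.\<close>
      have rot: "centre_map (opposite V) V' \<phi> (rot (opposite V) l) = rot V' (centre_map (opposite V) V' \<phi> l)" for l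
        by (simp add: flip(1))
      have alpha: "alpha V' (Cl_map (opposite V) V' \<phi> c) = map_prod \<phi> \<phi> (alpha (opposite V) c)"
        if "c \<in> carrier (Cl (opposite V))" for c
        using flip(2) that by (simp add: V.alpha_opposite)
      have "involution_iso (opposite V) V' \<phi>"
        "\<And>g. \<phi> ` End_grading (opposite V) \<Gamma>V g = End_grading V' \<Gamma>V' g"
        using inv im by simp_all
      from trialitarian_imp_graded_cyc_iso[OF op graded' this rot alpha]
      obtain \<phi>1 \<phi>0 where "graded_cyc_iso (opposite V) \<Gamma>V \<Gamma>L V' \<Gamma>V' \<Gamma>L' \<phi>1 \<phi>0"
        "compatible (opposite V) \<phi>1 \<phi>" by blast
      then have iso: "?iso (opposite V) \<phi>1 \<phi>0" by simp
      have "\<psi>1 = \<phi>1 \<and> \<psi>0 = \<phi>0" if "?iso (opposite V) \<psi>1 \<psi>0" for \<psi>1 \<psi>0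
        using compatible_graded_cyc_iso_unique[OF op graded' ext'] iso that
        unfolding opposite_maps by blast
      with iso have "\<exists>!(\<phi>1, \<phi>0). ?iso (opposite V) \<phi>1 \<phi>0" by (rule ex1_pairI)
      moreover have "\<nexists>\<phi>1 \<phi>0. ?iso V \<phi>1 \<phi>0" using iso not_both by blast
      ultimately show ?thesis
        by (intro exI[of _ "opposite V"] exI[of _ V] conjI insert_commute)
    qed
  qed
  show ?thesis
    by (intro conjI ballI allI impI) (erule (1) forward, erule backward)
qed

end
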